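(* Let $m,m'\geqslant 2$ and let $k_1,\dots,k_m$, $h_1,\dots,h_m$, $k'_1,\dots,k'_{m'}$, $h'_1,\dots,h'_{m'}$ be integers with $k_{i+1}\geqslant k_i$, $h_{i+1}\geqslant h_i$ ($1\leqslant i\leqslant m-1$), $k_j\geqslant h_j$ ($1\leqslant j\leqslant m$), $k'_{u+1}\geqslant k'_u$, $h'_{u+1}\geqslant h'_u$ ($1\leqslant u\leqslant m'-1$), $k'_v\geqslant h'_v$ ($1\leqslant v\leqslant m'$), and $k_m-h_m=k'_{m'}-h'_{m'}$, such that $CHS(\{k_s;h_s\}_{s=1}^{m})$ and $CHS(\{k'_t;h'_t\}_{t=1}^{m'})$ are monotonic constructable hexagonal systems (so $h_1=h'_1=1$, $h_{i+1}\leqslant k_i$ and $h'_{u+1}\leqslant k'_u$). Let $F(\{k_s;h_s\}_{s=1}^{m}|\{k'_t;h'_t\}_{t=1}^{m'})$ denote the forcing polynomial, in the variable $x$, of the CHS with one turning $CHS(\{k_s;h_s\}_{s=1}^{m}|\{k'_t;h'_t\}_{t=1}^{m'})$. Put $p(z)=\min\{p:C_{p,z}\text{ exists}\}$ and $q=\min\{q:C'_{q,k'_{m'}}\text{ exists}\}$. (1) If $k_{m-1}+k'_{m'-1}<k_m+k'_{m'}$, then $$\begin{aligned} &F(\{k_s;h_s\}_{s=1}^{m}|\{k'_t;h'_t\}_{t=1}^{m'})\\ =&\sum_{i=h_m-1}^{k_m-1}F(\{\min\{k_s,i\};h_s\}_{s=1}^{m-1})\,F(\{\min\{k'_t,i-h_m+h'_{m'}\};h'_t\}_{t=1}^{m'-1})\,x\\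 &+\sum_{j=p(k_m)}^{m}\sum_{i=q}^{m'}F(\{\min\{k_s,k_m-1\};h_s\}_{s=1}^{j-1})\,F(\{\min\{k'_t,k'_{m'}-1\};h'_t\}_{t=1}^{i-1})\,x. \end{aligned}$$ (2) If $k_{m-1}+k'_{m'-1}=k_m+k'_{m'}$, and the maximal zigzag hexagonal chain $\mathcal Z$ starting from $C_{m,k_m}$ contains $n$ $(\geqslant 2)$ hexagons, namely $\mathcal{Z}=C_{m,k_m}C_{m-1,k_m}C_{m-1,k_m-1}C_{m-2,k_m-1}C_{m-2,k_m-2}\cdots C_{m-\lfloor\frac n2\rfloor,\,k_m-\lfloor\frac{n-1}{2}\rfloor}$, then $$\begin{aligned} &F(\{k_s;h_s\}_{s=1}^{m}|\{k'_t;h'_t\}_{t=1}^{m'})\\ =&\sum_{i=h_m-1}^{k_m-1}F(\{\min\{k_s,i\};h_s\}_{s=1}^{m-1})\,F(\{\min\{k'_t,i-h_m+h'_{m'}\};h'_t\}_{t=1}^{m'-1})\,x\\ &+\sum_{j=p(k_m)}^{m-1}F(\{\min\{k_s,k_m-1\};h_s\}_{s=1}^{j-1})\,F(\{k'_t;h'_t\}_{t=1}^{m'-1})\,x\\ &+\sum_{j=q}^{m'-1}F(\{k_s;h_s\}_{s=1}^{m-1})\,F(\{\min\{k'_t,k'_{m'}-1\};h'_t\}_{t=1}^{j-1})\,x\\ &-\sum_{i=p(k_m)}^{m-1}\sum_{j=q}^{m'-1}F(\{\min\{k_s,k_m-1\};h_s\}_{s=1}^{i-1})\,F(\{\min\{k'_t,k'_{m'}-1\};h'_t\}_{t=1}^{j-1})\,x^2\\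 &+\sum_{i=h_{m-1}-1}^{k_m-2}F(\{\min\{k_s,i\};h_s\}_{s=1}^{m-2})\,F(\{\min\{k'_t,k'_{m'}-1\};h'_t\}_{t=1}^{m'-1})\,x^2\\ &+\sum_{w=1}^{\lfloor\frac n2\rfloor-1}\ \sum_{i=p(k_m-w)}^{m-w-1}\ \sum_{j=h'_{m'-1}-1}^{k'_{m'}-1}F(\{\min\{k_s,k_m-w-1\};h_s\}_{s=1}^{i-1})\,F(\{\min\{k'_t,j\};h'_t\}_{t=1}^{m'-2})\,x^{w+2}\\ &+\sum_{w=1}^{\lfloor\frac n2\rfloor-1}\ \sum_{i=h_{m-w-1}-1}^{k_m-w-2}F(\{\min\{k_s,i\};h_s\}_{s=1}^{m-w-2})\,F(\{\min\{k'_t,k'_{m'}-1\};h'_t\}_{t=1}^{m'-1})\,x^{w+2}+\xi_n, \end{aligned}$$ where, if $n$ is even, $$\xi_n=\sum_{j=h'_{m'-1}-1}^{k'_{m'}-1}F(\{\min\{k_s,k_m-\tfrac n2\};h_s\}_{s=1}^{m-\frac n2-1})\,F(\{\min\{k'_t,j\};h'_t\}_{t=1}^{m'-2})\,x^{\frac n2+1},$$ and, if $n$ is odd, $$\xi_n=F(\{k_s;h_s\}_{s=1}^{m-\frac{n+1}{2}})\,F(\{\min\{k'_t,k'_{m'}-1\};h'_t\}_{t=1}^{m'-1})\,x^{\frac{n+1}{2}}.$$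
   Context: Forcing polynomial. A perfect matching $M$ of a graph $G$ is a set of disjoint edges covering all vertices of $G$. A forcing set of $M$ is a subset $S\subseteq M$ that is contained in no other perfect matching of $G$. The forcing number $f(G,M)$ is the smallest cardinality of a forcing set of $M$. The forcing polynomial of $G$ is $F(G,x)=\sum_{M}x^{f(G,M)}$, the sum being over all perfect matchings $M$ of $G$. Monotonic CHS. A hexagonal system is a 2-connected finite plane graph in which every interior face is a regular hexagon. Consider the regular hexagonal tiling of the plane with hexagons of side length $\sqrt3/3$ placed so that each hexagon has two vertical edges (so centers of adjacent hexagons are at distance $1$). For integers $i,j$ let $C_{i,j}$ be the hexagon of the tiling with center $\left(-\frac{i-1}{2}-(j-1),\,-\frac{\sqrt3}{2}(i-1)\right)$; thus $C_{i,j+1}$ is the left neighbour of $C_{i,j}$, $C_{i+1,j}$ is its lower-left neighbour, and $C_{i+1,j-1}$ is its lower-right neighbour. The (left-)monotonic constructable hexagonal system $CHS(\{k_s;h_s\}_{s=1}^m)$ is the hexagonal system (plane graph) formed by the vertices and edges of the hexagons $C_{i,j}$ with $1\leqslant i\leqslant m$ and $h_i\leqslant j\leqslant k_i$; its $i$th row (from the top) is the linear chain of hexagons from $C_{i,k_i}$ (leftmost) to $C_{i,h_i}$ (rightmost), and the top right corner hexagon is $C_{1,1}$, i.e. $h_1=1$. CHS with one turning. Given monotonic $CHS(\{k_s;h_s\}_{s=1}^{m})$ and $CHS(\{k'_t;h'_t\}_{t=1}^{m'})$ with $k_m-h_m=k'_{m'}-h'_{m'}$, place both in the left-monotonic way,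 i.e. in the regular hexagonal tiling with hexagons of side length $\sqrt3/3$ having two vertical edges each, the first consisting of the hexagons with centers $\left(-\frac{i-1}{2}-(j-1),\,-\frac{\sqrt3}{2}(i-1)\right)$ for $1\leqslant i\leqslant m$, $h_i\leqslant j\leqslant k_i$, and the second of the hexagons with centers $\left(-\frac{t-1}{2}-(j-1),\,-\frac{\sqrt3}{2}(t-1)\right)$ for $1\leqslant t\leqslant m'$, $h'_t\leqslant j\leqslant k'_t$; then turn the second one upside down (reflect it in a horizontal line), and paste (identify) the $m$th row of the first with the $m'$th row of the second. The resulting hexagonal system is denoted $CHS(\{k_s;h_s\}_{s=1}^{m}|\{k'_t;h'_t\}_{t=1}^{m'})$. Hexagons coming from the first system keep the labels $C_{i,j}$ ($1\leqslant i\leqslant m$, $h_i\leqslant j\leqslant k_i$), and those from the second are labelled $C'_{t,j}$ ($1\leqslant t\leqslant m'$, $h'_t\leqslant j\leqslant k'_t$); in the pasted row $C_{m,i}=C'_{m',\,i-h_m+h'_{m'}}$. Explicitly, if $(a,b)$ is the center of $C_{m,h_m}$, then $C'_{t,j}$ has center $\left(a+\frac{m'-t}{2}-(j-h'_{m'}),\ b-\frac{\sqrt3}{2}(m'-t)\right)$. "$C_{p,z}$ exists" means $1\leqslant p\leqslant m$ and $h_p\leqslant z\leqslant k_p$; "$C'_{q,z}$ exists" means $1\leqslant q\leqslant m'$ and $h'_q\leqslant z\leqslant k'_q$. Maximal zigzag chain. $\mathcal Z$ is the sequence of hexagons whose $r$th member is $C_{m-\lfloor r/2\rfloor,\,k_m-\lfloor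 (r-1)/2\rfloor}$, $r=1,2,\dots,n$, where $n$ is the largest integer such that all these hexagons exist. Notation: $F(\{k_s;h_s\}_{s=1}^{m})=F(CHS(\{k_s;h_s\}_{s=1}^{m}),x)$ and $F(\{k_s;h_s\}_{s=1}^{m}|\{k'_t;h'_t\}_{t=1}^{m'})=F(CHS(\{k_s;h_s\}_{s=1}^{m}|\{k'_t;h'_t\}_{t=1}^{m'}),x)$. For arrays with empty last rows, $CHS(\{b_s;d_s\}_{s=1}^{i})=CHS(\{b_s;d_s\}_{s=1}^{i-1})$ (hence the same for $F$) if $b_i<d_i$ and $i\geqslant 1$; if $j=0$, $CHS(\{b_s;d_s\}_{s=1}^{j})$ is the empty graph and $F(\{b_s;d_s\}_{s=1}^{j})=1$. Empty sums are $0$. *)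

theory Defs
  imports Complex_Main "HOL-Computational_Algebra.Polynomial"
begin

section \<open>Forcing polynomials of finite simple graphs\<close>

text \<open>A simple graph is a pair of a vertex set and a set of two-element edges. The forcing
  polynomial below is meaningful only for finite graphs.\<close>

type_synonym 'a ugraph = "'a set \<times> 'a set set"

definition perfect_matching :: "'a ugraph \<Rightarrow> 'a set set \<Rightarrow> bool" where
  "perfect_matching G M \<longleftrightarrow> M \<subseteq> snd G \<and> pairwise disjnt M \<and> \<Union> M = fst G"

definition forcing_set :: "'a ugraph \<Rightarrow> 'a set set \<Rightarrow> 'a set set \<Rightarrow> bool" where
  "forcing_set G M S \<longleftrightarrow> S \<subseteq> M \<and> (\<forall>N. perfect_matching G N \<and> S \<subseteq> N \<longrightarrow> N = M)"

definition forcing_number :: "'a ugraph \<Rightarrow> 'a set set \<Rightarrow> nat" where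
  "forcing_number G M = (LEAST c. \<exists>S. forcing_set G M S \<and> card S = c)"

definition forcing_polynomial :: "'a ugraph \<Rightarrow> int poly" where
  "forcing_polynomial G = (\<Sum>M | perfect_matching G M. monom 1 (forcing_number G M))"

section \<open>Hexagonal systems in the regular tiling\<close>

text \<open>The corners, in clockwise order from the top one, of the hexagon with centre \<open>(a, b)\<close>,
  side length \<open>sqrt 3 / 3\<close> and two vertical edges.\<close>

fun hexagon_corners :: "real \<times> real \<Rightarrow> (real \<times> real) list" where
  "hexagon_corners (a, b) =
    [(a, b + sqrt 3 / 3), (a + 1/2, b + sqrt 3 / 6), (a + 1/2, b - sqrt 3 / 6),
     (a, b - sqrt 3 / 3), (a - 1/2, b - sqrt 3 / 6), (a - 1/2, b + sqrt 3 / 6)]"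

definition hexagon_edges :: "real \<times> real \<Rightarrow> (real \<times> real) set set" where
  "hexagon_edges c =
    {{hexagon_corners c ! l, hexagon_corners c ! ((l + 1) mod 6)} | l. l < 6}"

text \<open>The plane graph formed by the hexagons with centres in \<open>H\<close>. All edges are straight segments,
  so an edge is given by its two end points.\<close>

definition hexagon_graph :: "(real \<times> real) set \<Rightarrow> (real \<times> real) ugraph" where
  "hexagon_graph H = (\<Union>c\<in>H. set (hexagon_corners c), \<Union>c\<in>H. hexagon_edges c)"

section \<open>Monotonic constructable hexagonal systems\<close>

text \<open>An array \<open>{k_s; h_s}\<close> with \<open>s = 1, \<dots>, m\<close> is given by \<open>m\<close> and two functions \<open>k\<close>, \<open>h\<close>, of which
  only the values at \<open>1, \<dots>, m\<close> matter. Rows with \<open>k s < h s\<close> contribute no hexagon, so the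
  convention that empty last rows are dropped holds by construction.\<close>

definition cell_exists :: "nat \<Rightarrow> (nat \<Rightarrow> int) \<Rightarrow> (nat \<Rightarrow> int) \<Rightarrow> nat \<Rightarrow> int \<Rightarrow> bool" where
  "cell_exists m k h i j \<longleftrightarrow> 1 \<le> i \<and> i \<le> m \<and> h i \<le> j \<and> j \<le> k i"

definition cell_center :: "nat \<Rightarrow> int \<Rightarrow> real \<times> real" where
  "cell_center i j =
    (- ((real i - 1) / 2) - (real_of_int j - 1), - (sqrt 3 / 2) * (real i - 1))"

definition CHS_centers :: "nat \<Rightarrow> (nat \<Rightarrow> int) \<Rightarrow> (nat \<Rightarrow> int) \<Rightarrow> (real \<times> real) set" where
  "CHS_centers m k h = {cell_center i j | i j. cell_exists m k h i j}"

definition CHS :: "nat \<Rightarrow> (nat \<Rightarrow> int) \<Rightarrow> (nat \<Rightarrow> int) \<Rightarrow> (real \<times> real) ugraph" where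
  "CHS m k h = hexagon_graph (CHS_centers m k h)"

text \<open>For arrays that are nondecreasing in both components, \<open>h (s + 1) \<le> k s\<close> says that
  consecutive rows share an edge, i.e. that \<open>CHS m k h\<close> is 2-connected. The condition \<open>h 1 = 1\<close> makes
  the first cell of row 1 the top right corner.\<close>

definition monotonic_CHS :: "nat \<Rightarrow> (nat \<Rightarrow> int) \<Rightarrow> (nat \<Rightarrow> int) \<Rightarrow> bool" where
  "monotonic_CHS m k h \<longleftrightarrow>
     1 \<le> m \<and> h 1 = 1 \<and> (\<forall>s\<in>{1..m}. h s \<le> k s) \<and>
     (\<forall>s\<in>{1..<m}. k s \<le> k (s + 1) \<and> h s \<le> h (s + 1) \<and> h (s + 1) \<le> k s)"

section \<open>Systems with one turning\<close>

text \<open>The centre of the cell \<open>(t, j)\<close> of the second system (with \<open>m'\<close> rows, and last row starting at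
  index \<open>l' = h' m'\<close>), once that system has been turned upside down and pasted so that its cell
  \<open>(m', l')\<close> has the centre \<open>(a, b)\<close>.\<close>

fun turned_center :: "real \<times> real \<Rightarrow> nat \<Rightarrow> int \<Rightarrow> nat \<Rightarrow> int \<Rightarrow> real \<times> real" where
  "turned_center (a, b) m' l' t j =
    (a + (real m' - real t) / 2 - real_of_int (j - l'), b - sqrt 3 / 2 * (real m' - real t))"

definition CHS_turn ::
  "nat \<Rightarrow> (nat \<Rightarrow> int) \<Rightarrow> (nat \<Rightarrow> int) \<Rightarrow> nat \<Rightarrow> (nat \<Rightarrow> int) \<Rightarrow> (nat \<Rightarrow> int) \<Rightarrow> (real \<times> real) ugraph"
  where
  "CHS_turn m k h m' k' h' = hexagon_graph
     (CHS_centers m k h \<union>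
      {turned_center (cell_center m (h m)) m' (h' m') t j | t j. cell_exists m' k' h' t j})"

text \<open>The turned cells arise from the cells of the second system by a reflection in a horizontal
  line and a translation, and the two last rows are identified.\<close>

lemma turned_center_eq_reflection:
  "turned_center (a, b) m' l' t j =
    (fst (cell_center t j) + (a - fst (cell_center m' l')),
     - snd (cell_center t j) + (b + snd (cell_center m' l')))"
  by (simp add: cell_center_def field_simps)

lemma turned_center_last_row:
  "turned_center (cell_center m (h m)) m' (h' m') m' (i - h m + h' m') = cell_center m i"
  by (simp add: cell_center_def)

section \<open>The polynomials and the maximal zigzag chain\<close>

definition F :: "nat \<Rightarrow> (nat \<Rightarrow> int) \<Rightarrow> (nat \<Rightarrow> int) \<Rightarrow> int poly" where
  "F m k h = forcing_polynomial (CHS m k h)"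

definition F_turn ::
  "nat \<Rightarrow> (nat \<Rightarrow> int) \<Rightarrow> (nat \<Rightarrow> int) \<Rightarrow> nat \<Rightarrow> (nat \<Rightarrow> int) \<Rightarrow> (nat \<Rightarrow> int) \<Rightarrow> int poly" where
  "F_turn m k h m' k' h' = forcing_polynomial (CHS_turn m k h m' k' h')"

lemma F_empty_last_row:
  assumes "1 \<le> i" and "b i < d i"
  shows "F i b d = F (i - 1) b d"
proof -
  have "cell_exists i b d = cell_exists (i - 1) b d"
  proof (intro ext)
    fix s j
    show "cell_exists i b d s j = cell_exists (i - 1) b d s j"
      using assms by (cases "s = i") (auto simp: cell_exists_def)
  qed
  then show ?thesis
    by (simp add: F_def CHS_def CHS_centers_def)
qed

lemma F_zero_rows: "F 0 b d = 1"
proof -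
  have G: "CHS 0 b d = ({}, {})"
    by (auto simp: CHS_def CHS_centers_def cell_exists_def hexagon_graph_def)
  have pm: "perfect_matching (({}, {}) :: (real \<times> real) ugraph) M \<longleftrightarrow> M = {}" for M
    by (auto simp: perfect_matching_def)
  have "forcing_number (({}, {}) :: (real \<times> real) ugraph) {} = 0"
    by (simp add: forcing_number_def forcing_set_def pm)
  then show ?thesis
    by (simp add: F_def G forcing_polynomial_def pm monom_0)
qed

text \<open>The number of hexagons of the maximal zigzag chain starting from the cell \<open>(m, k m)\<close>. A truncated
  subtraction in the row index yields row 0, which has no cells.\<close>

definition zigzag_length :: "nat \<Rightarrow> (nat \<Rightarrow> int) \<Rightarrow> (nat \<Rightarrow> int) \<Rightarrow> nat" where
  "zigzag_length m k h =
    (GREATEST n. \<forall>r\<in>{1..n}. cell_exists m k h (m - r div 2) (k m - int ((r - 1) div 2)))"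

end

theory Submission
  imports Defs
begin

text \<open>
  In a perfect matching of a hexagonal system of this kind every row contains exactly one vertical
  edge. Number the vertical edges of a row so that edge \<open>j\<close> is the left edge of hexagon \<open>j\<close>, and let
  \<open>v r\<close> be the index of the matched vertical edge of row \<open>r\<close>. The matchings of one half of the system
  then are the sequences \<open>v 1 \<le> \<dots> \<le> v m\<close> with \<open>h r - 1 \<le> v r \<le> k r\<close>, and the two halves agree on the
  row that they share (lemma \<open>matching_of_bij\<close>). Every edge becomes a test on such a sequence: a
  vertical edge asks whether \<open>v r = j\<close>, and the slanted edges between rows \<open>r\<close> and \<open>r + 1\<close> ask
  whether \<open>j\<close> lies between \<open>v r\<close> and \<open>v (r + 1)\<close>, or outside. The forcing number is the least number
  of tests that the given sequence passes and no other sequence passes.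

  The formula comes from splitting the matchings into classes. In a class the rows from \<open>i\<close> on have
  prescribed values, and the rows above \<open>i\<close> only obey an upper bound \<open>c\<close>; such a class is a product of
  the sets of matchings of two smaller systems, one from each half, whose hexagons with index greater
  than \<open>c\<close> have been cut off. It contributes the product of the two smaller forcing polynomials times
  \<open>x ^ n\<close>, provided that \<open>n\<close> tests force a matching into the class, and that each
  member of the class can be changed in its prescribed rows in \<open>n\<close> ways that fail pairwise disjoint
  sets of tests, none of them a test about the free rows (lemmas \<open>test_number_product\<close> and
  \<open>sum_weight_tail_class\<close>). Almost always the change is the rotation of one alternating hexagon, which
  moves one \<open>v r\<close> by one; rotations in different rows hardly ever fail a common test
  (lemma \<open>sum_weight_tail_class_moves\<close>).

  Let \<open>K\<close> be the largest index in the shared row. The matchings with \<open>v m = c < K\<close> give the first sum.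
  If \<open>v m = K\<close>, consider the columns of rows with value \<open>K\<close> that end in the shared row, one in each half.
  When one half cannot have a column of height two (case 1), a single test fixes both columns,
  although they may only be changed together. When both can (case 2), a column of height at least two costs one
  test in its own half, and matchings with two such columns are counted by inclusion and exclusion.
  Matchings without such a column have \<open>v (m - 1) < K\<close> in both halves. They are followed down the staircase
  \<open>v (m - w) = K - w\<close> along the zigzag chain until the sequence repeats a value, drops by two or
  more, or the chain ends; these alternatives are the remaining sums.
\<close>

section \<open>Test systems\<close>

text \<open>If the candidates are perfect matchings and an edge tests for membership, these are the forcing
  sets. Finiteness matters because the tests below form infinite families, and \<open>card\<close> is 0 on infinite sets.\<close>

definition identifies :: "('e \<Rightarrow> 'w \<Rightarrow> bool) \<Rightarrow> 'e set \<Rightarrow> 'w set \<Rightarrow> 'w \<Rightarrow> 'e set \<Rightarrow> bool" where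
  "identifies H T W v S \<longleftrightarrow> finite S \<and> S \<subseteq> T \<and> (\<forall>e\<in>S. H e v) \<and>
     (\<forall>w\<in>W. (\<forall>e\<in>S. H e w) \<longrightarrow> w = v)"

definition test_number :: "('e \<Rightarrow> 'w \<Rightarrow> bool) \<Rightarrow> 'e set \<Rightarrow> 'w set \<Rightarrow> 'w \<Rightarrow> nat" where
  "test_number H T W v = (LEAST c. \<exists>S. identifies H T W v S \<and> card S = c)"

definition test_polynomial :: "('e \<Rightarrow> 'w \<Rightarrow> bool) \<Rightarrow> 'e set \<Rightarrow> 'w set \<Rightarrow> int poly" where
  "test_polynomial H T W = (\<Sum>v\<in>W. monom 1 (test_number H T W v))"

lemma test_number_le: "identifies H T W v S \<Longrightarrow> test_number H T W v \<le> card S"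
  unfolding test_number_def by (rule Least_le) blast

lemma test_number_attained:
  assumes "identifies H T W v S"
  obtains S' where "identifies H T W v S'" "card S' = test_number H T W v"
  using LeastI_ex[of "\<lambda>c. \<exists>S. identifies H T W v S \<and> card S = c"] assms
  unfolding test_number_def by blast

lemma Least_eq_if_mutually_bounded:
  fixes P Q :: "nat \<Rightarrow> bool"
  assumes PQ: "\<And>c. P c \<Longrightarrow> \<exists>d\<le>c. Q d" and QP: "\<And>c. Q c \<Longrightarrow> \<exists>d\<le>c. P d"
  shows "Least P = Least Q"
proof (cases "Ex P")
  case True
  then have P: "P (Least P)" by (metis LeastI)
  with PQ obtain d where d: "d \<le> Least P" "Q d" by blast
  then have Q: "Q (Least Q)" by (metis LeastI)
  with QP obtain d' where d': "d' \<le> Least Q" "P d'" by blast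
  have "Least Q \<le> d" "Least P \<le> d'" using d d' by (simp_all add: Least_le)
  with d d' show ?thesis by linarith
next
  case False
  moreover have "\<not> Ex Q" using QP False by blast
  ultimately have "P = Q" by auto
  then show ?thesis by simp
qed

text \<open>A test with the same outcome for all candidates identifies nothing, so it needs no counterpart.
  This makes it possible to use a family of tests that does not depend on the shape of the system.\<close>

definition simulates ::
  "('e \<Rightarrow> 'w \<Rightarrow> bool) \<Rightarrow> 'e set \<Rightarrow> 'w set \<Rightarrow> ('d \<Rightarrow> 'w \<Rightarrow> bool) \<Rightarrow> 'd set \<Rightarrow> bool" where
  "simulates H T W H' T' \<longleftrightarrow> (\<forall>e\<in>T.
     (\<forall>w\<in>W. \<forall>w'\<in>W. H e w = H e w') \<or> (\<exists>e'\<in>T'. \<forall>w\<in>W. H e w = H' e' w))"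

lemma identifies_simulated:
  assumes sim: "simulates H T W H' T'" and v: "v \<in> W" and S: "identifies H T W v S"
  shows "\<exists>S'. identifies H' T' W v S' \<and> card S' \<le> card S"
proof -
  define N where "N = {e\<in>S. \<not> (\<forall>w\<in>W. \<forall>w'\<in>W. H e w = H e w')}"
  have ST: "S \<subseteq> T" "finite S" "\<forall>e\<in>S. H e v"
    and uniq: "\<And>w. w \<in> W \<Longrightarrow> \<forall>e\<in>S. H e w \<Longrightarrow> w = v"
    using S by (auto simp: identifies_def)
  have "\<forall>e\<in>N. \<exists>e'\<in>T'. \<forall>w\<in>W. H e w = H' e' w"
    using sim ST unfolding simulates_def N_def by blast
  then obtain \<phi> where \<phi>: "\<And>e. e \<in> N \<Longrightarrow> \<phi> e \<in> T'"
      "\<And>e w. e \<in> N \<Longrightarrow> w \<in> W \<Longrightarrow> H e w = H' (\<phi> e) w"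
    by metis
  have N: "N \<subseteq> S" "finite N" using ST by (auto simp: N_def)
  have "w = v" if w: "w \<in> W" and all: "\<forall>e\<in>\<phi> ` N. H' e w" for w
  proof (rule uniq[OF w], rule ballI)
    fix e assume e: "e \<in> S"
    show "H e w"
    proof (cases "e \<in> N")
      case True then show ?thesis using \<phi>(2) w all by auto
    next
      case False then show ?thesis using e ST v w by (auto simp: N_def)
    qed
  qed
  moreover have "\<forall>e\<in>\<phi> ` N. H' e v" using \<phi>(2)[OF _ v] ST(3) N(1) by blast
  ultimately have "identifies H' T' W v (\<phi> ` N)"
    using \<phi>(1) N by (auto simp: identifies_def)
  moreover have "card (\<phi> ` N) \<le> card S"
    using card_image_le[OF N(2), of \<phi>] card_mono[OF ST(2) N(1)] by linarith
  ultimately show ?thesis by blast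
qed

lemma test_polynomial_eq_if_simulating:
  assumes g: "bij_betw g W W'"
    and sim: "simulates H T W (\<lambda>e w. H' e (g w)) T'"
    and sim': "simulates (\<lambda>e w. H' e (g w)) T' W H T"
  shows "test_polynomial H T W = test_polynomial H' T' W'"
proof -
  have idf: "identifies H' T' W' (g v) S \<longleftrightarrow> identifies (\<lambda>e w. H' e (g w)) T' W v S"
    if "v \<in> W" for v S
  proof -
    have "W' = g ` W" "\<And>w. w \<in> W \<Longrightarrow> g w = g v \<longleftrightarrow> w = v"
      using g that by (auto simp: bij_betw_def inj_on_def)
    then show ?thesis by (auto simp: identifies_def)
  qed
  have "test_number H T W v = test_number H' T' W' (g v)" if v: "v \<in> W" for v
    unfolding test_number_def idf[OF v]
    by (rule Least_eq_if_mutually_bounded)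
       (use identifies_simulated[OF sim v] identifies_simulated[OF sim' v] in blast)+
  then have "test_polynomial H T W = (\<Sum>v\<in>W. monom 1 (test_number H' T' W' (g v)))"
    by (simp add: test_polynomial_def)
  also have "\<dots> = test_polynomial H' T' W'"
    unfolding test_polynomial_def using sum.reindex_bij_betw[OF g] .
  finally show ?thesis .
qed

lemma forcing_polynomial_eq_test_polynomial:
  assumes "finite (snd G)"
  shows "forcing_polynomial G = test_polynomial (\<in>) (snd G) {M. perfect_matching G M}"
proof -
  have "forcing_set G M S \<longleftrightarrow> identifies (\<in>) (snd G) {M. perfect_matching G M} M S"
    if M: "perfect_matching G M" for M S
  proof -
    have "M \<subseteq> snd G" using M by (simp add: perfect_matching_def)
    moreover have "finite M" using calculation assms finite_subset by blast
    ultimately show ?thesis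
      unfolding forcing_set_def identifies_def using finite_subset by (auto; blast)
  qed
  then show ?thesis
    by (simp add: forcing_polynomial_def test_polynomial_def forcing_number_def test_number_def)
qed

text \<open>The local form of a perfect matching, which can be checked one vertex at a time.\<close>

lemma perfect_matching_iff:
  assumes "\<Union> (snd G) \<subseteq> fst G" "{} \<notin> snd G"
  shows "perfect_matching G M \<longleftrightarrow> M \<subseteq> snd G \<and> (\<forall>x\<in>fst G. \<exists>!e. e \<in> M \<and> x \<in> e)"
proof
  assume "perfect_matching G M"
  then have M: "M \<subseteq> snd G" "\<Union> M = fst G"
    and dis: "\<And>e e'. e \<in> M \<Longrightarrow> e' \<in> M \<Longrightarrow> e \<noteq> e' \<Longrightarrow> e \<inter> e' = {}"
    by (auto simp: perfect_matching_def pairwise_def disjnt_def)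
  have "\<exists>!e. e \<in> M \<and> x \<in> e" if "x \<in> fst G" for x
  proof -
    have "x \<in> \<Union> M" using M that by simp
    then obtain e where e: "e \<in> M" "x \<in> e" by (rule UnionE)
    have "e' = e" if "e' \<in> M \<and> x \<in> e'" for e'
      using dis[of e e'] e that by (metis IntI empty_iff)
    then show ?thesis using e by (metis (no_types))
  qed
  then show "M \<subseteq> snd G \<and> (\<forall>x\<in>fst G. \<exists>!e. e \<in> M \<and> x \<in> e)"
    using M by simp
next
  assume M: "M \<subseteq> snd G \<and> (\<forall>x\<in>fst G. \<exists>!e. e \<in> M \<and> x \<in> e)"
  have "\<Union> M = fst G"
  proof
    show "\<Union> M \<subseteq> fst G" using M assms(1) by (meson Union_mono subset_trans)
    show "fst G \<subseteq> \<Union> M" using M by (metis UnionI subsetI)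
  qed
  moreover have "disjnt e e'" if ee: "e \<in> M" "e' \<in> M" "e \<noteq> e'" for e e'
    unfolding disjnt_def
  proof (rule equals0I)
    fix x assume x: "x \<in> e \<inter> e'"
    then have "x \<in> fst G" using M assms(1) ee by (metis IntD1 UnionI subsetD)
    then show False using M ee x by (metis IntD1 IntD2)
  qed
  ultimately show "perfect_matching G M" using M by (simp add: perfect_matching_def pairwise_def)
qed

definition lost :: "('e \<Rightarrow> 'w \<Rightarrow> bool) \<Rightarrow> 'e set \<Rightarrow> 'w \<Rightarrow> 'w \<Rightarrow> 'e set" where
  "lost H T v w = {e\<in>T. H e v \<and> \<not> H e w}"

text \<open>The arithmetic of a class that \<open>g\<close> makes a product of two test systems, indexed by
  \<open>False\<close> and \<open>True\<close>. The sets \<open>R s\<close> contain the tests that may depend on the factor \<open>s\<close>. For the upper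
  bound, \<open>S0\<close> first confines the candidate to the class, and identifying sets of the factors do the
  rest. For the lower bound, an identifying set restricted to \<open>R s\<close> identifies the factor \<open>s\<close>, because its other
  tests do not depend on that factor; moreover it must contain a test that fails for \<open>N t\<close>, for
  every \<open>t < c\<close>, and all these tests are different and outside of the sets \<open>R s\<close>.\<close>

lemma test_number_product:
  fixes g :: "(bool \<Rightarrow> 'a) \<Rightarrow> 'w" and W1 :: "bool \<Rightarrow> 'a set"
  assumes gW: "\<And>a. (\<And>s. a s \<in> W1 s) \<Longrightarrow> g a \<in> W"
    and inj: "\<And>a b. (\<And>s. a s \<in> W1 s) \<Longrightarrow> (\<And>s. b s \<in> W1 s) \<Longrightarrow> g a = g b \<Longrightarrow> a = b"
    and R: "\<And>s. R s \<subseteq> T" "R False \<inter> R True = {}"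
    and indep: "\<And>e s a b. (\<And>s. a s \<in> W1 s) \<Longrightarrow> b \<in> W1 s \<Longrightarrow> e \<in> T \<Longrightarrow> e \<notin> R s
                 \<Longrightarrow> H e (g (a(s := b))) = H e (g a)"
    and down: "\<And>e s. e \<in> R s \<Longrightarrow> \<exists>e1\<in>T1 s. \<forall>a. (\<forall>s. a s \<in> W1 s) \<longrightarrow> H e (g a) = H1 e1 (a s)"
    and up: "\<And>e1 s. e1 \<in> T1 s \<Longrightarrow> (\<forall>w\<in>W1 s. \<forall>w'\<in>W1 s. H1 e1 w = H1 e1 w') \<or>
                 (\<exists>e\<in>T. \<forall>a. (\<forall>s. a s \<in> W1 s) \<longrightarrow> H e (g a) = H1 e1 (a s))"
    and ident: "\<And>s v. v \<in> W1 s \<Longrightarrow> \<exists>S. identifies H1 (T1 s) (W1 s) v S"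
    and a: "\<And>s. a s \<in> W1 s"
    and S0: "finite S0" "S0 \<subseteq> T" "card S0 \<le> c" "\<And>e. e \<in> S0 \<Longrightarrow> H e (g a)"
            "\<And>w. w \<in> W \<Longrightarrow> \<forall>e\<in>S0. H e w \<Longrightarrow> \<exists>b. (\<forall>s. b s \<in> W1 s) \<and> w = g b"
    and N: "\<And>t. t < c \<Longrightarrow> N t \<in> W" "\<And>t. t < c \<Longrightarrow> N t \<noteq> g a"
           "\<And>t s. t < c \<Longrightarrow> lost H T (g a) (N t) \<inter> R s = {}"
           "\<And>t u. t < u \<Longrightarrow> u < c \<Longrightarrow> lost H T (g a) (N t) \<inter> lost H T (g a) (N u) = {}"
  shows "test_number H T W (g a) =
     test_number H1 (T1 False) (W1 False) (a False) + test_number H1 (T1 True) (W1 True) (a True) + c"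
proof (rule antisym)
  let ?f = "\<lambda>s. test_number H1 (T1 s) (W1 s) (a s)"
  \<comment> \<open>Optimal identifying sets of the two factors are translated into tests on the class.\<close>
  have "\<exists>S. identifies H1 (T1 s) (W1 s) (a s) S \<and> card S = ?f s" for s
    using ident[OF a] test_number_attained by metis
  then obtain S1 where S1: "\<And>s. identifies H1 (T1 s) (W1 s) (a s) (S1 s)" "\<And>s. card (S1 s) = ?f s"
    by metis
  have "\<exists>S\<subseteq>T. finite S \<and> card S \<le> ?f s \<and> (\<forall>e\<in>S. H e (g a)) \<and>
         (\<forall>b. (\<forall>s. b s \<in> W1 s) \<longrightarrow> (\<forall>e\<in>S. H e (g b)) \<longrightarrow> b s = a s)" for s
  proof -
    define C where "C = {e\<in>S1 s. \<not> (\<forall>w\<in>W1 s. \<forall>w'\<in>W1 s. H1 e w = H1 e w')}"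
    have fin: "finite (S1 s)" "S1 s \<subseteq> T1 s" "\<And>e. e \<in> S1 s \<Longrightarrow> H1 e (a s)"
      and uq: "\<And>w. w \<in> W1 s \<Longrightarrow> \<forall>e\<in>S1 s. H1 e w \<Longrightarrow> w = a s"
      using S1(1)[of s] by (auto simp: identifies_def)
    have "\<forall>e\<in>C. \<exists>e'\<in>T. \<forall>a. (\<forall>s. a s \<in> W1 s) \<longrightarrow> H e' (g a) = H1 e (a s)"
      using up fin(2) unfolding C_def by blast
    then obtain \<phi> where \<phi>: "\<And>e. e \<in> C \<Longrightarrow> \<phi> e \<in> T"
       "\<And>e a. e \<in> C \<Longrightarrow> (\<And>s. a s \<in> W1 s) \<Longrightarrow> H (\<phi> e) (g a) = H1 e (a s)"
      by metis
    have C: "C \<subseteq> S1 s" "finite C" using fin by (auto simp: C_def)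
    have "b s = a s" if b: "\<And>s. b s \<in> W1 s" and all: "\<forall>e\<in>\<phi> ` C. H e (g b)" for b
    proof (rule uq[OF b], rule ballI)
      fix e assume e: "e \<in> S1 s"
      show "H1 e (b s)"
      proof (cases "e \<in> C")
        case True then show ?thesis using \<phi>(2)[of e b] b all by auto
      next
        case False
        then have "H1 e (b s) = H1 e (a s)" using e a b by (auto simp: C_def)
        then show ?thesis using fin(3) e by simp
      qed
    qed
    moreover have "\<forall>e\<in>\<phi> ` C. H e (g a)"
      using \<phi>(2)[OF _ a] fin(3) C(1) by auto
    moreover have "card (\<phi> ` C) \<le> ?f s"
      using card_image_le[OF C(2), of \<phi>] card_mono[OF fin(1) C(1)] S1(2)[of s] by linarith
    ultimately show ?thesis
      using \<phi>(1) C(2) by (intro exI[of _ "\<phi> ` C"]) auto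
  qed
  then obtain S2 where S2: "\<And>s. S2 s \<subseteq> T" "\<And>s. finite (S2 s)" "\<And>s. card (S2 s) \<le> ?f s"
     "\<And>s e. e \<in> S2 s \<Longrightarrow> H e (g a)"
     "\<And>s b. (\<And>s. b s \<in> W1 s) \<Longrightarrow> \<forall>e\<in>S2 s. H e (g b) \<Longrightarrow> b s = a s"
    by metis
  have "identifies H T W (g a) (S2 False \<union> S2 True \<union> S0)"
    unfolding identifies_def
  proof (intro conjI ballI impI)
    fix w assume w: "w \<in> W" "\<forall>e\<in>S2 False \<union> S2 True \<union> S0. H e w"
    then obtain b where b: "\<forall>s. b s \<in> W1 s" "w = g b" using S0(5) by blast
    have "b s = a s" for s
      by (rule S2(5)) (use b w in \<open>cases s; auto\<close>)+
    then show "w = g a" using b by (metis ext)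
  qed (use S2 S0 in auto)
  then have "test_number H T W (g a) \<le> card (S2 False \<union> S2 True \<union> S0)"
    by (rule test_number_le)
  also have "\<dots> \<le> card (S2 False) + card (S2 True) + card S0"
    by (meson card_Un_le le_trans add_le_mono le_refl)
  finally show "test_number H T W (g a) \<le> ?f False + ?f True + c"
    using S2(3)[of False] S2(3)[of True] S0(3) by linarith
  \<comment> \<open>Conversely, an optimal identifying set of the class splits into three disjoint parts.\<close>
  have "\<exists>S. identifies H T W (g a) S"
    using \<open>identifies H T W (g a) (S2 False \<union> S2 True \<union> S0)\<close> by blast
  then obtain S where S: "identifies H T W (g a) S" "card S = test_number H T W (g a)"
    using test_number_attained by metis
  have ST: "finite S" "S \<subseteq> T" "\<And>e. e \<in> S \<Longrightarrow> H e (g a)"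
    and uq: "\<And>w. w \<in> W \<Longrightarrow> \<forall>e\<in>S. H e w \<Longrightarrow> w = g a"
    using S(1) by (auto simp: identifies_def)
  have part: "?f s \<le> card (S \<inter> R s)" for s
  proof -
    have "\<forall>e\<in>S \<inter> R s. \<exists>e1\<in>T1 s. \<forall>a. (\<forall>s. a s \<in> W1 s) \<longrightarrow> H e (g a) = H1 e1 (a s)"
      using down by blast
    then obtain \<psi> where \<psi>: "\<And>e. e \<in> S \<inter> R s \<Longrightarrow> \<psi> e \<in> T1 s"
       "\<And>e a. e \<in> S \<inter> R s \<Longrightarrow> (\<And>s. a s \<in> W1 s) \<Longrightarrow> H e (g a) = H1 (\<psi> e) (a s)"
      by metis
    have "w = a s" if w: "w \<in> W1 s" and all: "\<forall>e\<in>\<psi> ` (S \<inter> R s). H1 e w" for w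
    proof -
      have b: "(a(s := w)) t \<in> W1 t" for t using a w by auto
      have "H e (g (a(s := w)))" if e: "e \<in> S" for e
      proof (cases "e \<in> R s")
        case True
        then show ?thesis using \<psi>(2)[of e "a(s := w)"] b e all by auto
      next
        case False
        then show ?thesis using indep[of a w s e] a w e ST by auto
      qed
      then have "g (a(s := w)) = g a" using uq gW b by blast
      then have "a(s := w) = a" using inj b a by blast
      then show ?thesis by (metis fun_upd_same)
    qed
    then have "identifies H1 (T1 s) (W1 s) (a s) (\<psi> ` (S \<inter> R s))"
      unfolding identifies_def using \<psi>(1) \<psi>(2)[OF _ a] ST by auto
    then have "?f s \<le> card (\<psi> ` (S \<inter> R s))" by (rule test_number_le)
    also have "\<dots> \<le> card (S \<inter> R s)" using ST(1) by (intro card_image_le) auto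
    finally show ?thesis .
  qed
  have "\<exists>e\<in>S. e \<in> lost H T (g a) (N t)" if "t < c" for t
    using uq[OF N(1)[OF that]] N(2)[OF that] ST unfolding lost_def by blast
  then obtain \<epsilon> where \<epsilon>: "\<And>t. t < c \<Longrightarrow> \<epsilon> t \<in> S" "\<And>t. t < c \<Longrightarrow> \<epsilon> t \<in> lost H T (g a) (N t)"
    by metis
  have "inj_on \<epsilon> {..<c}"
  proof (rule linorder_inj_onI)
    fix t u assume "t < u" "t \<in> {..<c}" "u \<in> {..<c}"
    then show "\<epsilon> t \<noteq> \<epsilon> u" using N(4)[of t u] \<epsilon>(2)[of t] \<epsilon>(2)[of u] by auto
  qed auto
  then have cE: "card (\<epsilon> ` {..<c}) = c" by (simp add: card_image)
  have dis: "\<epsilon> ` {..<c} \<inter> R s = {}" for s using N(3) \<epsilon>(2) by blast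
  have "?f False + ?f True + c \<le> card (S \<inter> R False) + card (S \<inter> R True) + card (\<epsilon> ` {..<c})"
    using part[of False] part[of True] cE by linarith
  also have "\<dots> = card ((S \<inter> R False) \<union> (S \<inter> R True) \<union> \<epsilon> ` {..<c})"
  proof -
    have "(S \<inter> R False) \<inter> (S \<inter> R True) = {}" using R(2) by blast
    moreover have "(S \<inter> R False \<union> S \<inter> R True) \<inter> \<epsilon> ` {..<c} = {}"
      using dis by blast
    ultimately show ?thesis using ST(1) by (simp add: card_Un_disjoint)
  qed
  also have "\<dots> \<le> card S" using ST(1) \<epsilon>(1) by (intro card_mono) auto
  finally show "?f False + ?f True + c \<le> test_number H T W (g a)" using S(2) by simp
qed

section \<open>Bonds, profiles and the matchings of a zigzag path\<close>

text \<open>Names of edges. A zigzag path runs between rows \<open>r\<close> and \<open>r + 1\<close>; from right to left it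
  meets, for each \<open>j\<close>, first the lower end of the vertical edge \<open>j\<close> of row \<open>r\<close>, called a foot, and then the upper end of the
  vertical edge \<open>j\<close> of row \<open>r + 1\<close>, called a head. \<open>Outer r j\<close> joins foot \<open>j\<close> to head \<open>j\<close>, and
  \<open>Inner r j\<close> joins head \<open>j\<close> to foot \<open>j + 1\<close>. The zigzag above the first row has number 0.\<close>

datatype bond = Vertical nat int | Outer nat int | Inner nat int

text \<open>Once the vertical edges \<open>v r\<close> and \<open>v (Suc r)\<close> are matched, the rest of the zigzag consists of
  three paths, whose perfect matchings are unique: this is membership of a bond in the resulting matching.\<close>

fun holds :: "bond \<Rightarrow> (nat \<Rightarrow> int) \<Rightarrow> bool" where
  "holds (Vertical r j) v \<longleftrightarrow> v r = j"
| "holds (Outer r j) v \<longleftrightarrow> j < v r \<or> v (Suc r) < j"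
| "holds (Inner r j) v \<longleftrightarrow> v r \<le> j \<and> j < v (Suc r)"

text \<open>The positions of the matched vertical edges in a system with \<open>n\<close> rows whose hexagons have
  index at most \<open>c\<close>. The conventions \<open>v 0 = 0\<close> and \<open>v r = c\<close> below the last row make the zigzags above
  the first and below the last row follow the same rule as all others. They also absorb empty last rows,
  since \<open>h r = c + 1\<close> forces \<open>v r = c\<close>.\<close>

definition profiles :: "int \<Rightarrow> nat \<Rightarrow> (nat \<Rightarrow> int) \<Rightarrow> (nat \<Rightarrow> int) \<Rightarrow> (nat \<Rightarrow> int) set" where
  "profiles c n k h = {v. v 0 = 0 \<and> mono v \<and> (\<forall>r\<in>{1..n}. h r - 1 \<le> v r \<and> v r \<le> k r) \<and> (\<forall>r>n. v r = c)}"

definition exactly_one :: "bool \<Rightarrow> bool \<Rightarrow> bool \<Rightarrow> bool" where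
  "exactly_one p q r \<longleftrightarrow> (p \<or> q \<or> r) \<and> \<not> (p \<and> q) \<and> \<not> (p \<and> r) \<and> \<not> (q \<and> r)"

text \<open>One zigzag path, traversed from \<open>lo\<close> to \<open>hi\<close>, with exactly one foot matched from above, namely \<open>v\<close>. Before
  \<open>v\<close> the matching has no choice but \<open>A\<close>; from \<open>v\<close> on it is shifted to \<open>B\<close>, until a head
  \<open>w\<close> that is matched from below puts it back to \<open>A\<close>. The path ends with a head, so \<open>w\<close> must occur.\<close>

lemma zigzag_path_matching:
  fixes A B Va Vb :: "int \<Rightarrow> bool" and lo hi v :: int
  assumes foot: "\<And>j. lo \<le> j \<Longrightarrow> j \<le> hi \<Longrightarrow> exactly_one (Va j) (A j) (B (j - 1))"
    and head: "\<And>j. lo \<le> j \<Longrightarrow> j \<le> hi \<Longrightarrow> exactly_one (Vb j) (A j) (B j)"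
    and Va: "\<And>j. Va j \<longleftrightarrow> j = v" and v: "lo \<le> v" "v \<le> hi"
    and range: "\<And>j. A j \<Longrightarrow> lo \<le> j \<and> j \<le> hi" "\<And>j. B j \<Longrightarrow> lo \<le> j \<and> j < hi"
      "\<And>j. Vb j \<Longrightarrow> lo \<le> j \<and> j \<le> hi"
  obtains w where "v \<le> w" "w \<le> hi" "\<And>j. Vb j \<longleftrightarrow> j = w"
    "\<And>j. A j \<longleftrightarrow> lo \<le> j \<and> j \<le> hi \<and> (j < v \<or> w < j)" "\<And>j. B j \<longleftrightarrow> v \<le> j \<and> j < w"
proof -
  have below: "A j \<and> \<not> B j \<and> \<not> Vb j" if "lo \<le> j" "j < v" for j
    using that
  proof (induction j rule: int_ge_induct)
    case base
    then show ?case using foot[of lo] head[of lo] Va[of lo] range(2)[of "lo - 1"] v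
      by (auto simp: exactly_one_def)
  next
    case (step i)
    then show ?case using foot[of "i + 1"] head[of "i + 1"] Va[of "i + 1"] v
      by (auto simp: exactly_one_def)
  qed
  have Av: "\<not> A v" using foot[of v] Va[of v] v by (auto simp: exactly_one_def)
  have run: "(\<forall>i. v \<le> i \<and> i \<le> j \<longrightarrow> \<not> Vb i) \<longrightarrow> \<not> A j \<and> B j" if "v \<le> j" "j \<le> hi" for j
    using that
  proof (induction j rule: int_ge_induct)
    case base
    then show ?case using Av head[of v] v by (auto simp: exactly_one_def)
  next
    case (step i)
    then show ?case using foot[of "i + 1"] head[of "i + 1"] v
      by (auto simp: exactly_one_def)
  qed
  have "\<exists>j. v \<le> j \<and> j \<le> hi \<and> Vb j"
    using run[of hi] v range(2)[of hi] by force
  then obtain j0 where j0: "v \<le> j0" "j0 \<le> hi" "Vb j0" by blast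
  define w where "w = v + int (LEAST d. Vb (v + int d))"
  have ex: "\<exists>d. Vb (v + int d)" using j0 by (intro exI[of _ "nat (j0 - v)"]) simp
  have w: "Vb w" unfolding w_def using LeastI_ex[OF ex] .
  have first: "\<not> Vb i" if "v \<le> i" "i < w" for i
    using not_less_Least[of "nat (i - v)" "\<lambda>d. Vb (v + int d)"] that by (simp add: w_def)
  have vw: "v \<le> w" by (simp add: w_def)
  have whi: "w \<le> hi" using range(3)[OF w] by simp
  have mid: "\<not> A j \<and> B j \<and> \<not> Vb j" if "v \<le> j" "j < w" for j
    using run[of j] first that whi by auto
  have Bw: "\<not> B w" "\<not> A w" using head[of w] w vw v whi by (auto simp: exactly_one_def)
  have above: "A j \<and> \<not> B j \<and> \<not> Vb j" if "w + 1 \<le> j" "j \<le> hi" for j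
    using that
  proof (induction j rule: int_ge_induct)
    case base
    then show ?case using foot[of "w + 1"] head[of "w + 1"] Va[of "w + 1"] v vw Bw
      by (auto simp: exactly_one_def)
  next
    case (step i)
    then show ?case using foot[of "i + 1"] head[of "i + 1"] Va[of "i + 1"] v vw
      by (auto simp: exactly_one_def)
  qed
  show ?thesis
  proof (rule that[OF vw whi])
    fix j
    consider "j < lo \<or> hi < j" | "lo \<le> j" "j < v" | "v \<le> j" "j < w" | "j = w" | "w + 1 \<le> j" "j \<le> hi"
      by linarith
    then have "(Vb j \<longleftrightarrow> j = w) \<and> (A j \<longleftrightarrow> lo \<le> j \<and> j \<le> hi \<and> (j < v \<or> w < j)) \<and> (B j \<longleftrightarrow> v \<le> j \<and> j < w)"
    proof cases
      case 1 then show ?thesis using range[of j] v vw whi by fastforce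
    next
      case 2 then show ?thesis using below[of j] v vw whi by simp
    next
      case 3 then show ?thesis using mid[of j] v vw whi by simp
    next
      case 4 then show ?thesis using w Bw vw by simp
    next
      case 5 then show ?thesis using above[of j] v vw whi by simp
    qed
    then show "Vb j \<longleftrightarrow> j = w" "A j \<longleftrightarrow> lo \<le> j \<and> j \<le> hi \<and> (j < v \<or> w < j)" "B j \<longleftrightarrow> v \<le> j \<and> j < w"
      by blast+
  qed
qed

section \<open>Perfect matchings of a system with one turning\<close>

datatype corner = Foot bool nat int | Head bool nat int

text \<open>The Boolean selects the half: \<open>False\<close> is the first system and \<open>True\<close> the second one. Each half is
  described in its own unturned position, so that all statements are symmetric in the two halves.\<close>

locale turned_system =
  fixes m :: "bool \<Rightarrow> nat" and k h :: "bool \<Rightarrow> nat \<Rightarrow> int"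
  assumes mono_CHS: "\<And>s. monotonic_CHS (m s) (k s) (h s)"
    and same_length: "\<And>s. k s (m s) - h s (m s) = k (\<not> s) (m (\<not> s)) - h (\<not> s) (m (\<not> s))"
begin

abbreviation l :: "bool \<Rightarrow> int" where "l s \<equiv> h s (m s)"

definition lo :: "bool \<Rightarrow> nat \<Rightarrow> int" where "lo s r = (if r = 0 then 0 else h s r - 1)"

lemma m_pos: "1 \<le> m s" and h_1: "h s 1 = 1" and h_1': "h s (Suc 0) = 1"
  and h_le_k: "1 \<le> r \<Longrightarrow> r \<le> m s \<Longrightarrow> h s r \<le> k s r"
  and k_Suc: "1 \<le> r \<Longrightarrow> r < m s \<Longrightarrow> k s r \<le> k s (Suc r)"
  and h_Suc: "1 \<le> r \<Longrightarrow> r < m s \<Longrightarrow> h s r \<le> h s (Suc r)"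
  and h_Suc_le_k: "1 \<le> r \<Longrightarrow> r < m s \<Longrightarrow> h s (Suc r) \<le> k s r"
  using mono_CHS[of s] by (auto simp: monotonic_CHS_def)

lemma h_mono: "r \<le> r' \<Longrightarrow> 1 \<le> r \<Longrightarrow> r' \<le> m s \<Longrightarrow> h s r \<le> h s r'"
proof (induction r' rule: dec_induct)
  case (step n) then show ?case using h_Suc[of n s] by simp
qed simp

lemma k_mono: "r \<le> r' \<Longrightarrow> 1 \<le> r \<Longrightarrow> r' \<le> m s \<Longrightarrow> k s r \<le> k s r'"
proof (induction r' rule: dec_induct)
  case (step n) then show ?case using k_Suc[of n s] by simp
qed simp

lemma h_pos: "1 \<le> r \<Longrightarrow> r \<le> m s \<Longrightarrow> 1 \<le> h s r"
  using h_mono[of 1 r s] h_1[of s] by simp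

lemma lo_le_k: "r < m s \<Longrightarrow> lo s r < k s (Suc r)"
  using h_le_k[of "Suc r" s] h_Suc[of r s] h_1'[of s] by (cases "r = 0") (auto simp: lo_def)

lemma lo_Suc: "r < m s \<Longrightarrow> lo s r \<le> h s (Suc r) - 1"
  using h_Suc[of r s] h_1'[of s] by (cases "r = 0") (auto simp: lo_def)

text \<open>The shared row is numbered differently in the two halves.\<close>

definition across :: "bool \<Rightarrow> int \<Rightarrow> int" where
  "across s j = j - l s + l (\<not> s)"

lemma across_across[simp]: "across (\<not> s) (across s j) = j" "across s (across (\<not> s) j) = j"
  "across True (across False j) = j" "across False (across True j) = j"
  by (auto simp: across_def)

lemma across_inj[simp]: "across s i = across s j \<longleftrightarrow> i = j" 
  by (auto simp: across_def)

lemma across_k: "across s (k s (m s)) = k (\<not> s) (m (\<not> s))"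
  using same_length[of s] by (simp add: across_def)

text \<open>A vertical edge of the shared row joins a head of one half to a head of the other, because
  the second half is upside down. It therefore has two names; \<open>bond_edge_eq\<close> shows that this is the only ambiguity.\<close>

fun bond_edge :: "bool \<Rightarrow> bond \<Rightarrow> corner set" where
  "bond_edge s (Vertical r j) = {Head s (r - 1) j,
     if r = m s then Head (\<not> s) (m (\<not> s) - 1) (across s j) else Foot s r j}"
| "bond_edge s (Outer r j) = {Foot s r j, Head s r j}"
| "bond_edge s (Inner r j) = {Head s r j, Foot s r (j + 1)}"

fun bond_exists :: "bool \<Rightarrow> bond \<Rightarrow> bool" where
  "bond_exists s (Vertical r j) \<longleftrightarrow> 1 \<le> r \<and> r \<le> m s \<and> h s r - 1 \<le> j \<and> j \<le> k s r"
| "bond_exists s (Outer r j) \<longleftrightarrow> r < m s \<and> lo s r \<le> j \<and> j \<le> k s (Suc r) \<and> (0 < r \<or> 0 < j)"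
| "bond_exists s (Inner r j) \<longleftrightarrow> r < m s \<and> lo s r \<le> j \<and> j < k s (Suc r)"

fun corner_exists :: "corner \<Rightarrow> bool" where
  "corner_exists (Foot s r j) \<longleftrightarrow> r < m s \<and> lo s r \<le> j \<and> j \<le> k s (Suc r) \<and> (0 < r \<or> 0 < j)"
| "corner_exists (Head s r j) \<longleftrightarrow> r < m s \<and> lo s r \<le> j \<and> j \<le> k s (Suc r)"

definition label_graph :: "corner ugraph" where
  "label_graph = (Collect corner_exists, {bond_edge s e | s e. bond_exists s e})"

definition turned_profiles :: "(bool \<Rightarrow> nat \<Rightarrow> int) set" where
  "turned_profiles = {w. (\<forall>s. w s \<in> profiles (w s (m s)) (m s) (k s) (h s)) \<and>
     (\<forall>s. w (\<not> s) (m (\<not> s)) = across s (w s (m s)))}"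

definition matching_of :: "(bool \<Rightarrow> nat \<Rightarrow> int) \<Rightarrow> corner set set" where
  "matching_of w = {bond_edge s e | s e. bond_exists s e \<and> holds e (w s)}"

lemma Foot_in_bond_edge:
  assumes "bond_exists s' e"
  shows "Foot s r j \<in> bond_edge s' e \<longleftrightarrow>
    s' = s \<and> (e = Vertical r j \<and> r \<noteq> m s \<or> e = Outer r j \<or> e = Inner r (j - 1))"
proof (cases "s' = s")
  case True
  then show ?thesis using assms by (cases e) auto
next
  case False
  then show ?thesis using assms by (cases e) auto
qed

lemma Head_in_bond_edge:
  assumes "bond_exists s' e"
  shows "Head s r j \<in> bond_edge s' e \<longleftrightarrow>
    s' = s \<and> (e = Vertical (Suc r) j \<or> e = Outer r j \<or> e = Inner r j) \<or>
    s' = (\<not> s) \<and> Suc r = m s \<and> e = Vertical (m (\<not> s)) (across s j)"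
proof (cases "s' = s")
  case True
  then show ?thesis using assms m_pos[of s] by (cases e) auto
next
  case False
  then have "s' = (\<not> s)" by auto
  then show ?thesis using assms m_pos[of s] by (cases e) (auto simp: across_def)
qed

lemma bond_edge_across:
  "bond_edge (\<not> s) (Vertical (m (\<not> s)) (across s j)) = bond_edge s (Vertical (m s) j)"
  by auto

lemma bond_exists_across:
  "bond_exists (\<not> s) (Vertical (m (\<not> s)) (across s j)) \<longleftrightarrow> bond_exists s (Vertical (m s) j)"
  using same_length[of s] m_pos[of s] m_pos[of "\<not> s"] by (auto simp: across_def)

lemma bond_edge_eq:
  assumes "bond_exists s e" "bond_exists s' e'" "bond_edge s e = bond_edge s' e'"
  shows "s' = s \<and> e' = e \<or> (\<exists>j. s' = (\<not> s) \<and> e = Vertical (m s) j \<and> e' = Vertical (m (\<not> s)) (across s j))"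
proof (cases e)
  case (Vertical r j)
  then have 1: "Head s (r - 1) j \<in> bond_edge s' e'" using assms(3) by auto
  have r: "Suc (r - 1) = r" using assms(1) Vertical by simp
  from 1[unfolded Head_in_bond_edge[OF assms(2)]] r
  consider "s' = s" "e' = Vertical r j" | "s' = s" "e' = Outer (r - 1) j" | "s' = s" "e' = Inner (r - 1) j"
    | "s' = (\<not> s)" "r = m s" "e' = Vertical (m (\<not> s)) (across s j)" by auto
  then show ?thesis
  proof cases
    case 2
    have "Foot s (r - 1) j \<in> bond_edge s e" using 2 assms(3) by simp
    then show ?thesis using Vertical r by (auto split: if_splits)
  next
    case 3
    have "Foot s (r - 1) (j + 1) \<in> bond_edge s e" using 3 assms(3) by simp
    then show ?thesis using Vertical r by (auto split: if_splits)
  qed (use Vertical in auto)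
next
  case (Outer r j)
  then have 1: "Head s r j \<in> bond_edge s' e'" "Foot s r j \<in> bond_edge s' e'" using assms(3) by auto
  show ?thesis using 1[unfolded Head_in_bond_edge[OF assms(2)] Foot_in_bond_edge[OF assms(2)]] Outer
    by auto
next
  case (Inner r j)
  then have 1: "Head s r j \<in> bond_edge s' e'" "Foot s r (j + 1) \<in> bond_edge s' e'" using assms(3) by auto
  show ?thesis using 1[unfolded Head_in_bond_edge[OF assms(2)] Foot_in_bond_edge[OF assms(2)]] Inner
    by auto
qed

lemma bond_edge_in_matching_of:
  assumes w: "w \<in> turned_profiles" and e: "bond_exists s e"
  shows "bond_edge s e \<in> matching_of w \<longleftrightarrow> holds e (w s)"
proof
  assume "bond_edge s e \<in> matching_of w"
  then obtain s' e' where e': "bond_exists s' e'" "holds e' (w s')" "bond_edge s e = bond_edge s' e'"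
    by (auto simp: matching_of_def)
  have "w (\<not> s) (m (\<not> s)) = across s (w s (m s))" using w by (simp add: turned_profiles_def)
  then show "holds e (w s)" using bond_edge_eq[OF e e'(1,3)] e'(2) by auto
qed (use e in \<open>auto simp: matching_of_def\<close>)

lemma corner_exists_if_in_bond_edge:
  assumes "bond_exists s e" "x \<in> bond_edge s e"
  shows "corner_exists x"
proof (cases e)
  case (Vertical r j)
  then have r: "1 \<le> r" "r \<le> m s" "h s r - 1 \<le> j" "j \<le> k s r" using assms(1) by auto
  obtain r0 where r0: "r = Suc r0" using r by (cases r) auto
  obtain n where n: "m (\<not> s) = Suc n" using m_pos[of "\<not> s"] by (cases "m (\<not> s)") auto
  have 1: "corner_exists (Head s r0 j)" using r lo_Suc[of r0 s] by (simp add: r0)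
  have 2: "corner_exists (Foot s r j)" if "r \<noteq> m s"
    using r that k_Suc[of r s] by (auto simp: lo_def)
  have 3: "corner_exists (Head (\<not> s) n (across s j))" if "r = m s"
    using r that same_length[of s] lo_Suc[of n "\<not> s"] by (auto simp: n across_def)
  show ?thesis using 1 2 3 assms(2) Vertical by (auto simp: r0 n split: if_splits)
next
  case (Inner r j)
  then show ?thesis using assms by (cases "r = 0") (auto simp: lo_def)
qed (use assms in auto)

lemma edges_label_graph: "\<Union> (snd label_graph) \<subseteq> fst label_graph" "{} \<notin> snd label_graph"
proof
  fix x assume "x \<in> \<Union> (snd label_graph)"
  then show "x \<in> fst label_graph"
    using corner_exists_if_in_bond_edge by (auto simp: label_graph_def)
next
  show "{} \<notin> snd label_graph"
  proof
    assume "{} \<in> snd label_graph"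
    then obtain s e where "bond_edge s e = {}" by (auto simp: label_graph_def)
    then show False by (cases e) auto
  qed
qed

lemma profiles_bounds:
  assumes "w \<in> turned_profiles"
  shows "w s 0 = 0" "r \<le> r' \<Longrightarrow> w s r \<le> w s r'"
    "1 \<le> r \<Longrightarrow> r \<le> m s \<Longrightarrow> h s r - 1 \<le> w s r" "1 \<le> r \<Longrightarrow> r \<le> m s \<Longrightarrow> w s r \<le> k s r"
    "r < m s \<Longrightarrow> lo s r \<le> w s r"  "r < m s \<Longrightarrow> w s r \<le> k s (Suc r)"
    "w (\<not> s) (m (\<not> s)) = across s (w s (m s))" "m s \<le> r \<Longrightarrow> w s r = w s (m s)"
proof -
  have w: "w s \<in> profiles (w s (m s)) (m s) (k s) (h s)"
    and eq: "w (\<not> s) (m (\<not> s)) = across s (w s (m s))"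
    using assms by (auto simp: turned_profiles_def)
  show w0: "w s 0 = 0" and mn: "r \<le> r' \<Longrightarrow> w s r \<le> w s r'"
    and "1 \<le> r \<Longrightarrow> r \<le> m s \<Longrightarrow> h s r - 1 \<le> w s r" and "1 \<le> r \<Longrightarrow> r \<le> m s \<Longrightarrow> w s r \<le> k s r"
    for r r' using w by (auto simp: profiles_def mono_def)
  show "w (\<not> s) (m (\<not> s)) = across s (w s (m s))" by (rule eq)
  show "m s \<le> r \<Longrightarrow> w s r = w s (m s)"
    using w by (cases "r = m s") (auto simp: profiles_def)
  have kS: "\<forall>r\<in>{1..m s}. h s r - 1 \<le> w s r \<and> w s r \<le> k s r" using w by (simp add: profiles_def)
  show "lo s r \<le> w s r" if "r < m s"
    using that kS w0 by (auto simp: lo_def)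
  show "w s r \<le> k s (Suc r)" if "r < m s"
    using mn[of r "Suc r"] bspec[OF kS, of "Suc r"] that by simp
qed

lemma one_bond_at_Foot:
  assumes w: "w \<in> turned_profiles" and x: "corner_exists (Foot s r j)"
  shows "\<exists>!b. b \<in> {Vertical r j, Outer r j, Inner r (j - 1)} \<and> bond_exists s b \<and> holds b (w s)"
proof -
  note W = profiles_bounds[OF w, where s = s]
  have x': "r < m s" "lo s r \<le> j" "j \<le> k s (Suc r)" "0 < r \<or> 0 < j" using x by auto
  have mon: "w s r \<le> w s (Suc r)" and lo: "lo s r \<le> w s r"
    and hi: "w s (Suc r) \<le> k s (Suc r)" using W(2)[where r = r and r' = "Suc r"] W(5)[where r = r] W(4)[where r = "Suc r"] x' by auto
  consider "w s r = j" | "j < w s r \<or> w s (Suc r) < j" | "w s r < j" "j \<le> w s (Suc r)" by linarith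
  then show ?thesis
  proof cases
    case 1
    then have "1 \<le> r" using x' profiles_bounds(1)[OF w, of s] by (cases r) auto
    then have "bond_exists s (Vertical r j)" using 1 x' W(3)[where r = r] W(4)[where r = r] by simp
    then show ?thesis using 1 mon by (intro ex1I[of _ "Vertical r j"]) auto
  next
    case 2
    then show ?thesis using x' mon by (intro ex1I[of _ "Outer r j"]) auto
  next
    case 3
    then show ?thesis using x' lo hi by (intro ex1I[of _ "Inner r (j - 1)"]) auto
  qed
qed

lemma one_bond_at_Head:
  assumes w: "w \<in> turned_profiles" and x: "corner_exists (Head s r j)"
  shows "\<exists>!b. b \<in> {Vertical (Suc r) j, Outer r j, Inner r j} \<and> bond_exists s b \<and> holds b (w s)"
proof -
  note W = profiles_bounds[OF w, where s = s]
  have x': "r < m s" "lo s r \<le> j" "j \<le> k s (Suc r)" using x by auto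
  have mon: "w s r \<le> w s (Suc r)" and lo: "lo s r \<le> w s r"
    and hi: "w s (Suc r) \<le> k s (Suc r)" using W(2)[where r = r and r' = "Suc r"] W(5)[where r = r] W(4)[where r = "Suc r"] x' by auto
  consider "w s (Suc r) = j" | "j < w s r \<or> w s (Suc r) < j" | "w s r \<le> j" "j < w s (Suc r)" by linarith
  then show ?thesis
  proof cases
    case 1
    then have "bond_exists s (Vertical (Suc r) j)" using x' W(3)[where r = "Suc r"] hi by simp
    then show ?thesis using 1 mon by (intro ex1I[of _ "Vertical (Suc r) j"]) auto
  next
    case 2
    moreover have "0 < r \<or> 0 < j"
      using 2 x' lo profiles_bounds(1)[OF w, of s] mon by (cases r) (auto simp: lo_def)
    ultimately show ?thesis using x' mon by (intro ex1I[of _ "Outer r j"]) auto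
  next
    case 3
    then show ?thesis using x' lo hi by (intro ex1I[of _ "Inner r j"]) auto
  qed
qed

lemma matching_of_perfect:
  assumes w: "w \<in> turned_profiles"
  shows "perfect_matching label_graph (matching_of w)"
proof -
  have edges: "matching_of w \<subseteq> snd label_graph" by (auto simp: matching_of_def label_graph_def)
  have foot: "\<exists>!e. e \<in> matching_of w \<and> Foot s r j \<in> e" if x: "corner_exists (Foot s r j)" for s r j
  proof -
    let ?B = "{Vertical r j, Outer r j, Inner r (j - 1)}"
    have inc: "Foot s r j \<in> bond_edge s' b \<longleftrightarrow> s' = s \<and> b \<in> ?B" if "bond_exists s' b" for s' b
      using Foot_in_bond_edge[OF that, of s r j] x by auto
    obtain b where b: "b \<in> ?B" "bond_exists s b" "holds b (w s)"
      and uniq: "\<And>b'. b' \<in> ?B \<Longrightarrow> bond_exists s b' \<Longrightarrow> holds b' (w s) \<Longrightarrow> b' = b"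
      using one_bond_at_Foot[OF w x] by (metis (no_types, lifting))
    show ?thesis
    proof (rule ex1I[of _ "bond_edge s b"])
      show "bond_edge s b \<in> matching_of w \<and> Foot s r j \<in> bond_edge s b"
        using b inc[OF b(2)] by (auto simp: matching_of_def)
    next
      fix e assume "e \<in> matching_of w \<and> Foot s r j \<in> e"
      then obtain s' b' where b': "e = bond_edge s' b'" "bond_exists s' b'" "holds b' (w s')"
        "Foot s r j \<in> bond_edge s' b'" by (auto simp: matching_of_def)
      then have "s' = s" "b' \<in> ?B" using inc[OF b'(2)] by blast+
      then show "e = bond_edge s b" using uniq[of b'] b' by simp
    qed
  qed
  have head: "\<exists>!e. e \<in> matching_of w \<and> Head s r j \<in> e" if x: "corner_exists (Head s r j)" for s r j
  proof -
    let ?B = "{Vertical (Suc r) j, Outer r j, Inner r j}"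
    obtain b where b: "b \<in> ?B" "bond_exists s b" "holds b (w s)"
      and uniq: "\<And>b'. b' \<in> ?B \<Longrightarrow> bond_exists s b' \<Longrightarrow> holds b' (w s) \<Longrightarrow> b' = b"
      using one_bond_at_Head[OF w x] by (metis (no_types, lifting))
    show ?thesis
    proof (rule ex1I[of _ "bond_edge s b"])
      show "bond_edge s b \<in> matching_of w \<and> Head s r j \<in> bond_edge s b"
        using b Head_in_bond_edge[OF b(2), of s r j] by (auto simp: matching_of_def)
    next
      fix e assume "e \<in> matching_of w \<and> Head s r j \<in> e"
      then obtain s' b' where b': "e = bond_edge s' b'" "bond_exists s' b'" "holds b' (w s')"
        "Head s r j \<in> bond_edge s' b'" by (auto simp: matching_of_def)
      then consider "s' = s" "b' \<in> ?B"
        | "s' = (\<not> s)" "Suc r = m s" "b' = Vertical (m (\<not> s)) (across s j)"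
        using Head_in_bond_edge[OF b'(2), of s r j] by auto
      then show "e = bond_edge s b"
      proof cases
        case 1
        then show ?thesis using uniq[of b'] b' by simp
      next
        case 2
        then have "bond_exists s (Vertical (Suc r) j)"
          using b'(2) bond_exists_across[of s j] by simp
        moreover have "holds (Vertical (Suc r) j) (w s)"
          using b'(3) 2 profiles_bounds(7)[OF w, of s] by simp
        ultimately have "Vertical (Suc r) j = b" using uniq by blast
        then show ?thesis using b'(1) 2 bond_edge_across[of s j] by simp
      qed
    qed
  qed
  have "\<exists>!e. e \<in> matching_of w \<and> x \<in> e" if "corner_exists x" for x
    using that foot head by (cases x) auto
  then have "\<forall>x\<in>fst label_graph. \<exists>!e. e \<in> matching_of w \<and> x \<in> e"
    by (simp add: label_graph_def)
  then show ?thesis using edges perfect_matching_iff[OF edges_label_graph] by blast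
qed

end

text \<open>Relabelling the vertices injectively carries perfect matchings to perfect matchings.\<close>

lemma perfect_matching_image_iff:
  assumes inj: "inj_on f V" and E: "\<Union> E \<subseteq> V"
  shows "perfect_matching (f ` V, (`) f ` E) N \<longleftrightarrow> (\<exists>M. perfect_matching (V, E) M \<and> N = (`) f ` M)"
proof -
  have dis: "disjnt (f ` a) (f ` b) \<longleftrightarrow> disjnt a b" if "a \<subseteq> V" "b \<subseteq> V" for a b
    using inj_on_image_Int[OF inj that] by (auto simp: disjnt_def)
  have inj2: "f ` a = f ` b \<longleftrightarrow> a = b" if "a \<subseteq> V" "b \<subseteq> V" for a b
    using inj_on_image_eq_iff[OF inj that] .
  have sub: "a \<subseteq> V" if "a \<in> M" "M \<subseteq> E" for a M using that E by blast
  have pw: "pairwise disjnt ((`) f ` M) \<longleftrightarrow> pairwise disjnt M" if "M \<subseteq> E" for M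
    using dis inj2 sub[OF _ that] by (fastforce simp: pairwise_def)
  have cov: "\<Union> ((`) f ` M) = f ` V \<longleftrightarrow> \<Union> M = V" if "M \<subseteq> E" for M
  proof -
    have "\<Union> ((`) f ` M) = f ` (\<Union> M)" by blast
    then show ?thesis using inj_on_image_eq_iff[OF inj, of "\<Union> M" V] sub[OF _ that] by auto
  qed
  show ?thesis
  proof
    assume N: "perfect_matching (f ` V, (`) f ` E) N"
    then obtain M where "M \<subseteq> E" "N = (`) f ` M"
      unfolding perfect_matching_def by (metis snd_conv subset_imageE)
    then show "\<exists>M. perfect_matching (V, E) M \<and> N = (`) f ` M"
      using N pw cov by (auto simp: perfect_matching_def)
  next
    assume "\<exists>M. perfect_matching (V, E) M \<and> N = (`) f ` M"
    then show "perfect_matching (f ` V, (`) f ` E) N"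
      using pw cov by (fastforce simp: perfect_matching_def)
  qed
qed

lemma forcing_polynomial_image:
  assumes inj: "inj_on f V" and E: "\<Union> E \<subseteq> V" and fin: "finite E"
  shows "forcing_polynomial (f ` V, (`) f ` E) = forcing_polynomial (V, E)"
proof -
  have injE: "inj_on ((`) f) E"
  proof (rule inj_onI)
    fix a b assume "a \<in> E" "b \<in> E" "f ` a = f ` b"
    then show "a = b" using inj_on_image_eq_iff[OF inj, of a b] E by blast
  qed
  have mem: "f ` e \<in> (`) f ` M \<longleftrightarrow> e \<in> M" if "e \<in> E" "M \<subseteq> E" for e M
    using inj_on_image_mem_iff[OF injE that] .
  have sub: "M \<subseteq> E" if "perfect_matching (V, E) M" for M
    using that by (simp add: perfect_matching_def)
  have "bij_betw ((`) ((`) f)) {M. perfect_matching (V, E) M} {N. perfect_matching (f ` V, (`) f ` E) N}"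
    unfolding bij_betw_def
  proof
    show "inj_on ((`) ((`) f)) {M. perfect_matching (V, E) M}"
      using inj_on_image_eq_iff[OF injE] sub by (intro inj_onI) blast
    show "(`) ((`) f) ` {M. perfect_matching (V, E) M} = {N. perfect_matching (f ` V, (`) f ` E) N}"
      using perfect_matching_image_iff[OF inj E] by auto
  qed
  moreover have "simulates (\<in>) E {M. perfect_matching (V, E) M} (\<lambda>e M. e \<in> (`) f ` M) ((`) f ` E)"
    unfolding simulates_def
  proof (rule ballI, rule disjI2)
    fix e assume "e \<in> E"
    then show "\<exists>e'\<in>(`) f ` E. \<forall>M\<in>{M. perfect_matching (V, E) M}. (e \<in> M) = (e' \<in> (`) f ` M)"
      using mem sub by (intro bexI[of _ "f ` e"]) simp_all
  qed
  moreover have "simulates (\<lambda>e M. e \<in> (`) f ` M) ((`) f ` E) {M. perfect_matching (V, E) M} (\<in>) E"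
    unfolding simulates_def
  proof (rule ballI, rule disjI2)
    fix e' assume "e' \<in> (`) f ` E"
    then obtain e where "e' = f ` e" "e \<in> E" by blast
    then show "\<exists>e\<in>E. \<forall>M\<in>{M. perfect_matching (V, E) M}. (e' \<in> (`) f ` M) = (e \<in> M)"
      using mem sub by (intro bexI[of _ e]) simp_all
  qed
  ultimately have "test_polynomial (\<in>) E {M. perfect_matching (V, E) M} =
      test_polynomial (\<in>) ((`) f ` E) {N. perfect_matching (f ` V, (`) f ` E) N}"
    by (rule test_polynomial_eq_if_simulating)
  then show ?thesis using fin by (simp add: forcing_polynomial_eq_test_polynomial)
qed

definition bonds :: "nat \<Rightarrow> bond set" where
  "bonds n = {b. case b of Vertical r j \<Rightarrow> r \<le> n | Outer r j \<Rightarrow> r < n | Inner r j \<Rightarrow> r < n}"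

definition holds_on :: "bool \<times> bond \<Rightarrow> (bool \<Rightarrow> nat \<Rightarrow> int) \<Rightarrow> bool" where
  "holds_on e w \<longleftrightarrow> holds (snd e) (w (fst e))"

context turned_system
begin

definition turned_bonds :: "(bool \<times> bond) set" where
  "turned_bonds = {(s, b). b \<in> bonds (m s)}"

text \<open>From the outermost row of each half towards the shared one, the zigzag lemma turns the unique
  matched vertical edge of a row into that of the next row. The virtual vertical edge 0 above the
  first row starts the induction: it stands for the foot that the zigzag above the first row lacks.\<close>

lemma profile_of_matching:
  assumes M: "perfect_matching label_graph M"
  shows "\<exists>w\<in>turned_profiles. M = matching_of w"
proof -
  define on where "on s b \<longleftrightarrow> bond_exists s b \<and> bond_edge s b \<in> M" for s b
  have ME: "M \<subseteq> {bond_edge s e | s e. bond_exists s e}"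
    and uniq: "\<And>x. corner_exists x \<Longrightarrow> \<exists>!e. e \<in> M \<and> x \<in> e"
    using M perfect_matching_iff[OF edges_label_graph] by (auto simp: label_graph_def)
  have same: "b = b'" if "on s b" "on s b'" "x \<in> bond_edge s b" "x \<in> bond_edge s b'" "corner_exists x"
    for s b b' x
  proof -
    have "bond_edge s b = bond_edge s b'" using that uniq[of x] by (auto simp: on_def)
    moreover have "bond_exists s b" "bond_exists s b'" using that by (simp_all add: on_def)
    ultimately have "s = s \<and> b' = b \<or> (\<exists>j. s = (\<not> s) \<and> b = Vertical (m s) j \<and> b' = Vertical (m (\<not> s)) (across s j))"
      by (intro bond_edge_eq)
    then show ?thesis by blast
  qed
  have foot: "exactly_one (on s (Vertical r j)) (on s (Outer r j)) (on s (Inner r (j - 1)))"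
    if x: "corner_exists (Foot s r j)" for s r j
  proof -
    have V: "Foot s r j \<in> bond_edge s (Vertical r j)" using x by simp
    obtain e where "e \<in> M" "Foot s r j \<in> e" using uniq[OF x] by blast
    then obtain b where "on s b" "b \<in> {Vertical r j, Outer r j, Inner r (j - 1)}"
      using ME Foot_in_bond_edge[of _ _ s r j] unfolding on_def by blast
    then show ?thesis
      using same[OF _ _ V _ x, of "Outer r j"] same[OF _ _ V _ x, of "Inner r (j - 1)"]
        same[OF _ _ _ _ x, of s "Outer r j" "Inner r (j - 1)"]
      by (auto simp: exactly_one_def)
  qed
  have across_on: "on (\<not> s) (Vertical (m (\<not> s)) (across s j)) \<longleftrightarrow> on s (Vertical (m s) j)" for s j
    unfolding on_def bond_exists_across bond_edge_across ..
  have head: "exactly_one (on s (Vertical (Suc r) j)) (on s (Outer r j)) (on s (Inner r j))"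
    if x: "corner_exists (Head s r j)" for s r j
  proof -
    obtain e where e: "e \<in> M" "Head s r j \<in> e" using uniq[OF x] by blast
    then obtain s' b' where b': "on s' b'" "Head s r j \<in> bond_edge s' b'"
      using ME unfolding on_def by blast
    then have "bond_exists s' b'" by (simp add: on_def)
    then have "\<exists>b. on s b \<and> b \<in> {Vertical (Suc r) j, Outer r j, Inner r j}"
      using b' Head_in_bond_edge[of s' b' s r j] across_on[of s j] by auto
    then obtain b where "on s b" "b \<in> {Vertical (Suc r) j, Outer r j, Inner r j}" by blast
    then show ?thesis
      using same[OF _ _ _ _ x, of s "Vertical (Suc r) j" "Outer r j"]
        same[OF _ _ _ _ x, of s "Vertical (Suc r) j" "Inner r j"]
        same[OF _ _ _ _ x, of s "Outer r j" "Inner r j"]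
      by (auto simp: exactly_one_def)
  qed
  \<comment> \<open>For \<open>r = 0\<close> this is the virtual vertical edge above the first row.\<close>
  define V where "V s r j \<longleftrightarrow> (if r = 0 then j = 0 else on s (Vertical r j))" for s r j
  define val where "val s r = (THE j. V s r j)" for s r
  have valI: "val s r = v" if "\<And>j. V s r j \<longleftrightarrow> j = v" for s r v
    unfolding val_def by (rule the_equality) (use that in blast)+
  have step: "val s r \<le> val s (Suc r) \<and> (\<forall>j. V s (Suc r) j \<longleftrightarrow> j = val s (Suc r)) \<and>
     (\<forall>j. on s (Outer r j) \<longleftrightarrow> bond_exists s (Outer r j) \<and> (j < val s r \<or> val s (Suc r) < j)) \<and>
     (\<forall>j. on s (Inner r j) \<longleftrightarrow> val s r \<le> j \<and> j < val s (Suc r))"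
    if r: "r < m s" and IH: "\<And>j. V s r j \<longleftrightarrow> j = val s r" for s r
  proof -
    have rng: "lo s r \<le> val s r \<and> val s r \<le> k s (Suc r)"
    proof (cases "r = 0")
      case True
      then have "val s r = 0" using IH[of 0] by (simp add: V_def)
      then show ?thesis using True lo_le_k[OF r] by (simp add: lo_def)
    next
      case False
      then have "bond_exists s (Vertical r (val s r))" using IH[of "val s r"] by (simp add: V_def on_def)
      then show ?thesis using False k_Suc[of r s] r by (auto simp: lo_def)
    qed
    obtain v where v: "val s r \<le> v" "v \<le> k s (Suc r)" "\<And>j. on s (Vertical (Suc r) j) \<longleftrightarrow> j = v"
      "\<And>j. on s (Outer r j) \<longleftrightarrow> lo s r \<le> j \<and> j \<le> k s (Suc r) \<and> (j < val s r \<or> v < j)"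
      "\<And>j. on s (Inner r j) \<longleftrightarrow> val s r \<le> j \<and> j < v"
    proof (rule zigzag_path_matching[where lo = "lo s r" and hi = "k s (Suc r)" and v = "val s r" and
          Va = "V s r" and A = "\<lambda>j. on s (Outer r j)" and B = "\<lambda>j. on s (Inner r j)" and
          Vb = "\<lambda>j. on s (Vertical (Suc r) j)"])
      fix j assume j: "lo s r \<le> j" "j \<le> k s (Suc r)"
      show "exactly_one (V s r j) (on s (Outer r j)) (on s (Inner r (j - 1)))"
      proof (cases "r = 0 \<and> j = 0")
        case True
        then show ?thesis by (simp add: exactly_one_def V_def on_def lo_def)
      next
        case False
        then have "0 < r \<or> 0 < j" using j by (cases "r = 0") (auto simp: lo_def)
        then have x: "corner_exists (Foot s r j)" using j r by simp
        have "on s (Vertical r j) \<longleftrightarrow> V s r j" using False by (auto simp: V_def on_def)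
        then show ?thesis using foot[OF x] by simp
      qed
      show "exactly_one (on s (Vertical (Suc r) j)) (on s (Outer r j)) (on s (Inner r j))"
        using head[of s r j] j r by simp
    next
      fix j
      have "lo s r \<le> h s (Suc r) - 1" using lo_Suc[OF r] .
      then show "on s (Outer r j) \<Longrightarrow> lo s r \<le> j \<and> j \<le> k s (Suc r)"
        "on s (Inner r j) \<Longrightarrow> lo s r \<le> j \<and> j < k s (Suc r)"
        "on s (Vertical (Suc r) j) \<Longrightarrow> lo s r \<le> j \<and> j \<le> k s (Suc r)"
        by (auto simp: on_def)
    qed (use IH rng in auto)
    have "\<And>j. V s (Suc r) j \<longleftrightarrow> j = v" using v(3) by (simp add: V_def)
    moreover have "val s (Suc r) = v" by (rule valI) (use v(3) in \<open>simp add: V_def\<close>)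
    moreover have "on s (Outer r j) \<longleftrightarrow> bond_exists s (Outer r j) \<and> (j < val s r \<or> v < j)" for j
      using v(4)[of j] by (auto simp: on_def)
    ultimately show ?thesis using v by simp
  qed
  have V: "r \<le> m s \<Longrightarrow> (\<forall>j. V s r j \<longleftrightarrow> j = val s r)" for s r
  proof (induction r)
    case 0
    have "V s 0 j \<longleftrightarrow> j = 0" for j by (simp add: V_def)
    then show ?case using valI[of s 0 0] by simp
  next
    case (Suc r) then show ?case using step[of r s] by simp
  qed
  have st: "val s r \<le> val s (Suc r)" 
     "\<And>j. on s (Outer r j) \<longleftrightarrow> bond_exists s (Outer r j) \<and> (j < val s r \<or> val s (Suc r) < j)"
     "\<And>j. on s (Inner r j) \<longleftrightarrow> val s r \<le> j \<and> j < val s (Suc r)"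
    if "r < m s" for s r
    using step[OF that] V[of r s] that by auto
  have vert: "on s (Vertical r j) \<longleftrightarrow> j = val s r" if "1 \<le> r" "r \<le> m s" for s r j
    using V[OF that(2)] that(1) by (simp add: V_def)
  define w where "w s r = val s (min r (m s))" for s r
  have bounds: "h s r - 1 \<le> w s r \<and> w s r \<le> k s r" if "1 \<le> r" "r \<le> m s" for s r
    using vert[OF that, of "val s r"] that by (simp add: on_def w_def)
  have "w s \<in> profiles (w s (m s)) (m s) (k s) (h s)" for s
  proof -
    have "w s r \<le> w s (Suc r)" for r
      using st(1)[of r s] by (cases "r < m s") (simp_all add: w_def)
    then have "mono (w s)" by (intro incseq_SucI)
    moreover have "w s 0 = 0" using V[of 0 s] by (simp add: V_def w_def)
    ultimately show ?thesis using bounds by (auto simp: profiles_def w_def)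
  qed
  moreover have "w (\<not> s) (m (\<not> s)) = across s (w s (m s))" for s
    using across_on[of s "val s (m s)"] vert[of "m s" s] vert[of "m (\<not> s)" "\<not> s"] m_pos
    by (simp add: w_def)
  ultimately have w: "w \<in> turned_profiles" by (simp add: turned_profiles_def)
  have on_iff: "on s b \<longleftrightarrow> holds b (w s)" if "bond_exists s b" for s b
  proof (cases b)
    case (Vertical r j) then show ?thesis using that vert[of r s j] by (auto simp: w_def)
  next
    case (Outer r j) then show ?thesis using that st(2)[of r s j] by (auto simp: w_def)
  next
    case (Inner r j) then show ?thesis using that st(3)[of r s j] by (auto simp: w_def)
  qed
  have "M = matching_of w"
  proof
    show "M \<subseteq> matching_of w"
      using ME on_iff unfolding on_def matching_of_def by blast
    show "matching_of w \<subseteq> M"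
      using on_iff unfolding on_def matching_of_def by blast
  qed
  with w show ?thesis by blast
qed

lemma matching_of_bij: "bij_betw matching_of turned_profiles {M. perfect_matching label_graph M}"
  unfolding bij_betw_def
proof
  show "inj_on matching_of turned_profiles"
  proof (rule inj_onI)
    fix w w' assume w: "w \<in> turned_profiles" and w': "w' \<in> turned_profiles"
      and eq: "matching_of w = matching_of w'"
    have 1: "w s r = w' s r" if r: "1 \<le> r" "r \<le> m s" for s r
    proof -
      have ex: "bond_exists s (Vertical r (w s r))"
        using r profiles_bounds(3)[OF w r] profiles_bounds(4)[OF w r] by simp
      have "holds (Vertical r (w s r)) (w' s)"
        using bond_edge_in_matching_of[OF w ex] bond_edge_in_matching_of[OF w' ex] eq by simp
      then show ?thesis by simp
    qed
    have "w s r = w' s r" for s r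
    proof -
      consider "r = 0" | "1 \<le> r" "r \<le> m s" | "m s \<le> r" by linarith
      then show ?thesis
      proof cases
        case 1
        then show ?thesis by (simp add: profiles_bounds(1)[OF w] profiles_bounds(1)[OF w'])
      next
        case 2
        then show ?thesis by (rule 1)
      next
        case 3
        have "w s (m s) = w' s (m s)" using 1[of "m s" s] m_pos[of s] by simp
        then show ?thesis using profiles_bounds(8)[OF w 3] profiles_bounds(8)[OF w' 3] by simp
      qed
    qed
    then show "w = w'" by blast
  qed
  show "matching_of ` turned_profiles = {M. perfect_matching label_graph M}"
    using matching_of_perfect profile_of_matching by blast
qed

lemma finite_bonds: "finite {b. bond_exists s b}"
proof -
  let ?I = "{..m s} \<times> {0..k s (m s)}"
  have "b \<in> case_prod Vertical ` ?I \<union> case_prod Outer ` ?I \<union> case_prod Inner ` ?I"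
    if b: "bond_exists s b" for b
  proof (cases b)
    case (Vertical r j)
    then have "(r, j) \<in> ?I" using b k_mono[of r "m s" s] h_pos[of r s] by auto
    then show ?thesis using Vertical by (auto intro!: rev_image_eqI)
  next
    case (Outer r j)
    then have "(r, j) \<in> ?I" using b k_mono[of "Suc r" "m s" s] h_pos[of r s] by (auto simp: lo_def split: if_splits)
    then show ?thesis using Outer by (auto intro!: rev_image_eqI)
  next
    case (Inner r j)
    then have "(r, j) \<in> ?I" using b k_mono[of "Suc r" "m s" s] h_pos[of r s] by (auto simp: lo_def split: if_splits)
    then show ?thesis using Inner by (auto intro!: rev_image_eqI)
  qed
  then have "{b. bond_exists s b} \<subseteq> case_prod Vertical ` ?I \<union> case_prod Outer ` ?I \<union> case_prod Inner ` ?I"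
    by blast
  then show ?thesis by (rule finite_subset) simp
qed

lemma finite_edges: "finite (snd label_graph)"
proof -
  have "snd label_graph = (\<Union>s. bond_edge s ` {b. bond_exists s b})"
    by (auto simp: label_graph_def)
  then show ?thesis using finite_bonds by simp
qed

lemma finite_turned_profiles: "finite turned_profiles"
proof -
  have "{M. perfect_matching label_graph M} \<subseteq> Pow (snd label_graph)"
    by (auto simp: perfect_matching_def)
  then have "finite {M. perfect_matching label_graph M}"
    using finite_edges by (simp add: finite_subset)
  then show ?thesis using bij_betw_finite[OF matching_of_bij] by blast
qed

text \<open>The bonds outside of the graph are constant tests on the profiles, and the bonds of the
  graph test for membership of their edges.\<close>

lemma forcing_polynomial_label_graph:
  "forcing_polynomial label_graph = test_polynomial holds_on turned_bonds turned_profiles"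
proof -
  have const: "holds b (w s) = holds b (w' s)"
    if b: "b \<in> bonds (m s)" "\<not> bond_exists s b" and w: "w \<in> turned_profiles" "w' \<in> turned_profiles"
    for s b w w'
  proof -
    note B = profiles_bounds[OF w(1), where s = s] and B' = profiles_bounds[OF w(2), where s = s]
    show ?thesis
    proof (cases b)
      case (Vertical r j)
      then show ?thesis using b B(1) B'(1) B(3,4)[of r] B'(3,4)[of r]
        by (cases "r = 0") (auto simp: bonds_def)
    next
      case (Outer r j)
      then have r: "r < m s" using b by (simp add: bonds_def)
      then show ?thesis using b Outer B(1) B'(1) B(4)[of "Suc r"] B'(4)[of "Suc r"]
          B(5)[of r] B'(5)[of r] B(2)[of 0 "Suc r"] B'(2)[of 0 "Suc r"]
        by (auto simp: not_le)
    next
      case (Inner r j)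
      then have r: "r < m s" using b by (simp add: bonds_def)
      then show ?thesis using b Inner B(4)[of "Suc r"] B'(4)[of "Suc r"] B(5)[of r] B'(5)[of r]
        by auto
    qed
  qed
  have ib: "b \<in> bonds (m s)" if "bond_exists s b" for s b
    using that by (cases b) (auto simp: bonds_def)
  have "simulates holds_on turned_bonds turned_profiles (\<lambda>e w. e \<in> matching_of w) (snd label_graph)"
    unfolding simulates_def
  proof
    fix e assume e: "e \<in> turned_bonds"
    obtain s b where sb: "e = (s, b)" by force
    have b: "b \<in> bonds (m s)" using e sb by (simp add: turned_bonds_def)
    show "(\<forall>w\<in>turned_profiles. \<forall>w'\<in>turned_profiles. holds_on e w = holds_on e w') \<or>
      (\<exists>e'\<in>snd label_graph. \<forall>w\<in>turned_profiles. holds_on e w = (e' \<in> matching_of w))"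
    proof (cases "bond_exists s b")
      case True
      then have "bond_edge s b \<in> snd label_graph" by (auto simp: label_graph_def)
      moreover have "\<forall>w\<in>turned_profiles. holds_on e w = (bond_edge s b \<in> matching_of w)"
        using bond_edge_in_matching_of[OF _ True] sb by (simp add: holds_on_def)
      ultimately show ?thesis by blast
    next
      case False
      have "holds_on e w = holds_on e w'" if "w \<in> turned_profiles" "w' \<in> turned_profiles" for w w'
        using const[OF b False that] by (simp only: sb holds_on_def fst_conv snd_conv)
      then show ?thesis by blast
    qed
  qed
  moreover have "simulates (\<lambda>e w. e \<in> matching_of w) (snd label_graph) turned_profiles holds_on turned_bonds"
    unfolding simulates_def
  proof
    fix e assume "e \<in> snd label_graph"
    then obtain s b where b: "e = bond_edge s b" "bond_exists s b" by (auto simp: label_graph_def)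
    have "(s, b) \<in> turned_bonds" using ib[OF b(2)] by (simp add: turned_bonds_def)
    moreover have "\<forall>w\<in>turned_profiles. (e \<in> matching_of w) = holds_on (s, b) w"
      using bond_edge_in_matching_of b by (simp add: holds_on_def)
    ultimately show "(\<forall>w\<in>turned_profiles. \<forall>w'\<in>turned_profiles. (e \<in> matching_of w) = (e \<in> matching_of w')) \<or>
      (\<exists>e'\<in>turned_bonds. \<forall>w\<in>turned_profiles. (e \<in> matching_of w) = holds_on e' w)"
      by (intro disjI2 bexI[of _ "(s, b)"])
  qed
  ultimately have "test_polynomial holds_on turned_bonds turned_profiles =
      test_polynomial (\<in>) (snd label_graph) {M. perfect_matching label_graph M}"
    by (rule test_polynomial_eq_if_simulating[OF matching_of_bij])
  then show ?thesis by (simp add: forcing_polynomial_eq_test_polynomial[OF finite_edges])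
qed

end

section \<open>The labelled graph as a subgraph of the hexagonal tiling\<close>

text \<open>Coordinates in which all corners and centres of hexagons are integral.\<close>

definition plane_point :: "int \<times> int \<Rightarrow> real \<times> real" where
  "plane_point p = (real_of_int (fst p) / 2, sqrt 3 / 6 * real_of_int (snd p))"

lemma inj_plane_point: "inj plane_point"
  by (rule injI) (auto simp: plane_point_def prod_eq_iff)

lemma hexagon_corners_plane_point:
  "hexagon_corners (plane_point (X, Y)) = map plane_point
     [(X, Y + 2), (X + 1, Y + 1), (X + 1, Y - 1), (X, Y - 2), (X - 1, Y - 1), (X - 1, Y + 1)]"
  by (simp add: plane_point_def field_simps)

lemma Collect_less_6: "{f l | l. l < (6::nat)} = {f 0, f 1, f 2, f 3, f 4, f 5}"
proof -
  have "{l::nat. l < 6} = {0, 1, 2, 3, 4, 5}" by auto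
  moreover have "{f l | l. l < (6::nat)} = f ` {l. l < 6}" by blast
  ultimately show ?thesis by simp
qed

lemma hexagon_edges_plane_point:
  "hexagon_edges (plane_point (X, Y)) = (`) plane_point `
     {{(X, Y + 2), (X + 1, Y + 1)}, {(X + 1, Y + 1), (X + 1, Y - 1)}, {(X + 1, Y - 1), (X, Y - 2)},
      {(X, Y - 2), (X - 1, Y - 1)}, {(X - 1, Y - 1), (X - 1, Y + 1)}, {(X - 1, Y + 1), (X, Y + 2)}}"
  unfolding hexagon_edges_def Collect_less_6 hexagon_corners_plane_point
  by simp

lemma fst_hexagon_graph: "fst (hexagon_graph H) = \<Union> (snd (hexagon_graph H))"
proof -
  have "set (hexagon_corners c) = \<Union> (hexagon_edges c)" for c
    unfolding hexagon_edges_def Collect_less_6 by (cases c) auto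
  then show ?thesis by (auto simp: hexagon_graph_def)
qed

context turned_system
begin

text \<open>The reflection and translation that turn the second half upside down and paste its last row
  onto that of the first half.\<close>

definition placed :: "bool \<Rightarrow> int \<times> int \<Rightarrow> int \<times> int" where
  "placed s p = (if s then (fst p + (int (m True) - int (m False)) + 2 * (l True - l False),
      6 - 3 * int (m True) - 3 * int (m False) - snd p) else p)"

fun corner_point :: "corner \<Rightarrow> int \<times> int" where
  "corner_point (Foot s r j) = placed s (2 - int r - 2 * j, 2 - 3 * int r)"
| "corner_point (Head s r j) = placed s (1 - int r - 2 * j, 1 - 3 * int r)"

lemma placed_eq_iff:
  assumes "4 - 3 * int (m s) \<le> snd p" "4 - 3 * int (m s') \<le> snd p'"
  shows "placed s p = placed s' p' \<longleftrightarrow> s = s' \<and> p = p'"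
  using assms by (cases s; cases s'; cases p; cases p') (auto simp: placed_def)

lemma corner_point_inj: "inj_on corner_point (Collect corner_exists)"
proof (rule inj_onI)
  fix x y assume x: "x \<in> Collect corner_exists" and y: "y \<in> Collect corner_exists"
    and eq: "corner_point x = corner_point y"
  \<comment> \<open>Feet and heads lie at different heights modulo 3.\<close>
  have mod3: "2 - 3 * int r \<noteq> 1 - 3 * int r'" for r r' by presburger
  show "x = y"
  proof (cases x)
    case X: (Foot s r j)
    show ?thesis
    proof (cases y)
      case Y: (Foot s' r' j')
      then show ?thesis using x y eq X by (simp add: placed_eq_iff)
    next
      case Y: (Head s' r' j')
      then show ?thesis using x y eq X mod3[of r r'] by (simp add: placed_eq_iff)
    qed
  next
    case X: (Head s r j)
    show ?thesis
    proof (cases y)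
      case Y: (Foot s' r' j')
      then show ?thesis using x y eq X mod3[of r' r] by (simp add: placed_eq_iff)
    next
      case Y: (Head s' r' j')
      then show ?thesis using x y eq X by (simp add: placed_eq_iff)
    qed
  qed
qed

text \<open>The edges of one hexagon. The lower half of a hexagon of the shared row is
  the upper half of the same hexagon seen from the other side.\<close>

definition cell_bonds :: "bool \<Rightarrow> nat \<Rightarrow> int \<Rightarrow> (bool \<times> bond) set" where
  "cell_bonds s i j = {(s, Inner (i - 1) (j - 1)), (s, Outer (i - 1) j), (s, Vertical i (j - 1)), (s, Vertical i j)}
     \<union> (if i = m s then {(\<not> s, Inner (m (\<not> s) - 1) (across s j - 1)), (\<not> s, Outer (m (\<not> s) - 1) (across s j))}
        else {(s, Outer i (j - 1)), (s, Inner i (j - 1))})"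

definition cell_point :: "bool \<Rightarrow> nat \<Rightarrow> int \<Rightarrow> int \<times> int" where
  "cell_point s i j = placed s (3 - int i - 2 * j, 3 - 3 * int i)"

lemma hexagon_edges_cell:
  assumes "cell_exists (m s) (k s) (h s) i j"
  shows "hexagon_edges (plane_point (cell_point s i j)) =
    (\<lambda>(t, b). plane_point ` corner_point ` bond_edge t b) ` cell_bonds s i j"
proof -
  obtain i0 where i: "i = Suc i0" using assms by (cases i) (auto simp: cell_exists_def)
  obtain n where n: "m (\<not> s) = Suc n" using m_pos[of "\<not> s"] by (cases "m (\<not> s)") auto
  obtain X Y where XY: "cell_point s i j = (X, Y)" by force
  define pt where "pt u v = (X + u, Y + (if s then - v else v))" for u v :: int
  have pt: "placed s (3 - int i - 2 * j + u, 3 - 3 * int i + v) = pt u v" for u v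
    using XY by (auto simp: cell_point_def placed_def pt_def)
  have top: "corner_point (Foot s i0 j) = pt 0 2" "corner_point (Head s i0 j) = pt (- 1) 1"
    "corner_point (Head s i0 (j - 1)) = pt 1 1"
    unfolding pt[symmetric] by (simp_all add: i algebra_simps)
  have low: "corner_point (Foot s i (j - 1)) = pt 1 (- 1)" "corner_point (Foot s i j) = pt (- 1) (- 1)"
    "corner_point (Head s i (j - 1)) = pt 0 (- 2)"
    unfolding pt[symmetric] by (simp_all add: algebra_simps)
  have low': "corner_point (Head (\<not> s) n (across s (j - 1))) = pt 1 (- 1)"
    "corner_point (Head (\<not> s) n (across s j)) = pt (- 1) (- 1)"
    "corner_point (Foot (\<not> s) n (across s j)) = pt 0 (- 2)" if "i = m s"
    unfolding pt[symmetric] using n that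
    by (cases s; simp add: placed_def across_def algebra_simps)+
  have e: "i - 1 = i0" "m (\<not> s) - 1 = n" using i n by simp_all
  have shift: "across s (j - 1) = across s j - 1" by (simp add: across_def)
  have R: "(\<lambda>(t, b). corner_point ` bond_edge t b) ` cell_bonds s i j =
    {{pt 1 1, pt 0 2}, {pt 0 2, pt (- 1) 1}, {pt 1 1, pt 1 (- 1)}, {pt (- 1) 1, pt (- 1) (- 1)},
     {pt 1 (- 1), pt 0 (- 2)}, {pt 0 (- 2), pt (- 1) (- 1)}}"
  proof (cases "i = m s")
    case True
    have "cell_bonds s i j = {(s, Inner i0 (j - 1)), (s, Outer i0 j), (s, Vertical i (j - 1)), (s, Vertical i j),
        (\<not> s, Inner n (across s j - 1)), (\<not> s, Outer n (across s j))}"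
      unfolding cell_bonds_def e using True by auto
    moreover have "m s - 1 = i0" using True i by simp
    ultimately show ?thesis using True top low'[OF True] shift n
      by (simp del: corner_point.simps)
  next
    case False
    have "cell_bonds s i j = {(s, Inner i0 (j - 1)), (s, Outer i0 j), (s, Vertical i (j - 1)), (s, Vertical i j),
        (s, Outer i (j - 1)), (s, Inner i (j - 1))}"
      unfolding cell_bonds_def e using False by auto
    then show ?thesis using False top low e by (simp del: corner_point.simps)
  qed
  have L: "{{(X, Y + 2), (X + 1, Y + 1)}, {(X + 1, Y + 1), (X + 1, Y - 1)}, {(X + 1, Y - 1), (X, Y - 2)},
      {(X, Y - 2), (X - 1, Y - 1)}, {(X - 1, Y - 1), (X - 1, Y + 1)}, {(X - 1, Y + 1), (X, Y + 2)}} =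
    {{pt 1 1, pt 0 2}, {pt 0 2, pt (- 1) 1}, {pt 1 1, pt 1 (- 1)}, {pt (- 1) 1, pt (- 1) (- 1)},
     {pt 1 (- 1), pt 0 (- 2)}, {pt 0 (- 2), pt (- 1) (- 1)}}"
  proof -
    have 1: "{{a, b}, {b, c}, {c, d}, {d, e}, {e, f}, {f, a}} = {{b, a}, {a, f}, {b, c}, {f, e}, {c, d}, {d, e}}"
      "{{a, b}, {b, c}, {c, d}, {d, e}, {e, f}, {f, a}} = {{c, d}, {d, e}, {c, b}, {e, f}, {b, a}, {a, f}}"
      for a b c d e f :: "int \<times> int"
      by (simp_all only: insert_commute)
    show ?thesis
    proof (cases s)
      case True
      then show ?thesis by (simp add: pt_def) (rule 1(2))
    next
      case False
      then show ?thesis by (simp add: pt_def) (rule 1(1))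
    qed
  qed
  have "(\<lambda>(t, b). plane_point ` corner_point ` bond_edge t b) ` cell_bonds s i j =
    (`) plane_point ` ((\<lambda>(t, b). corner_point ` bond_edge t b) ` cell_bonds s i j)"
    unfolding image_image by (rule image_cong) auto
  then show ?thesis unfolding R XY hexagon_edges_plane_point L by (rule sym)
qed

lemma cell_bonds_exist: "(\<Union>s. \<Union>(i, j)\<in>{(i, j). cell_exists (m s) (k s) (h s) i j}. cell_bonds s i j) = {(s, b). bond_exists s b}"
proof (intro equalityI subsetI)
  fix e assume "e \<in> (\<Union>s. \<Union>(i, j)\<in>{(i, j). cell_exists (m s) (k s) (h s) i j}. cell_bonds s i j)"
  then obtain s i j where c: "cell_exists (m s) (k s) (h s) i j" and e: "e \<in> cell_bonds s i j" by auto
  have i: "1 \<le> i" "i \<le> m s" "h s i \<le> j" "j \<le> k s i" using c by (auto simp: cell_exists_def)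
  obtain i0 where i0: "i = Suc i0" using i by (cases i) auto
  obtain n where n: "m (\<not> s) = Suc n" using m_pos[of "\<not> s"] by (cases "m (\<not> s)") auto
  have lo: "lo s i0 \<le> h s i - 1" using lo_Suc[of i0 s] i i0 by simp
  have lo': "lo (\<not> s) n \<le> l (\<not> s) - 1" using lo_Suc[of n "\<not> s"] n by simp
  have 1: "bond_exists s (Inner i0 (j - 1))" "bond_exists s (Outer i0 j)"
     "bond_exists s (Vertical i (j - 1))" "bond_exists s (Vertical i j)"
    using i i0 lo h_pos[of i s] by auto
  have 2: "bond_exists s (Outer i (j - 1))" "bond_exists s (Inner i (j - 1))" if "i \<noteq> m s"
    using i i0 that k_Suc[of i s] by (auto simp: lo_def)
  have 3: "bond_exists (\<not> s) (Inner n (across s j - 1))" "bond_exists (\<not> s) (Outer n (across s j))" if "i = m s"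
    using i i0 n that lo' same_length[of s] h_pos[of "m (\<not> s)" "\<not> s"] by (auto simp: across_def)
  show "e \<in> {(s, b). bond_exists s b}"
    using e 1 2 3 by (auto simp: cell_bonds_def i0 n split: if_splits)
next
  fix e assume "e \<in> {(s, b). bond_exists s b}"
  then obtain s b where e: "e = (s, b)" and b: "bond_exists s b" by auto
  have "\<exists>i j. cell_exists (m s) (k s) (h s) i j \<and> (s, b) \<in> cell_bonds s i j"
  proof (cases b)
    case (Vertical r j)
    show ?thesis
    proof (cases "h s r \<le> j")
      case True
      then show ?thesis using Vertical b by (intro exI[of _ r] exI[of _ j]) (auto simp: cell_exists_def cell_bonds_def)
    next
      case False
      then show ?thesis using Vertical b h_le_k[of r s]
        by (intro exI[of _ r] exI[of _ "j + 1"]) (auto simp: cell_exists_def cell_bonds_def)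
    qed
  next
    case (Outer r j)
    show ?thesis
    proof (cases "h s (Suc r) \<le> j")
      case True
      then show ?thesis using Outer b
        by (intro exI[of _ "Suc r"] exI[of _ j]) (auto simp: cell_exists_def cell_bonds_def)
    next
      case False
      then have "r \<noteq> 0" using Outer b h_1'[of s] by (cases "r = 0") auto
      then show ?thesis using False Outer b h_Suc_le_k[of r s]
        by (intro exI[of _ r] exI[of _ "j + 1"]) (auto simp: cell_exists_def cell_bonds_def lo_def)
    qed
  next
    case (Inner r j)
    show ?thesis
    proof (cases "h s (Suc r) \<le> j + 1")
      case True
      then show ?thesis using Inner b
        by (intro exI[of _ "Suc r"] exI[of _ "j + 1"]) (auto simp: cell_exists_def cell_bonds_def)
    next
      case False
      then have "r \<noteq> 0" using Inner b h_1'[of s] by (cases "r = 0") (auto simp: lo_def)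
      then show ?thesis using False Inner b h_Suc_le_k[of r s]
        by (intro exI[of _ r] exI[of _ "j + 1"]) (auto simp: cell_exists_def cell_bonds_def lo_def)
    qed
  qed
  then show "e \<in> (\<Union>s. \<Union>(i, j)\<in>{(i, j). cell_exists (m s) (k s) (h s) i j}. cell_bonds s i j)"
    using e by blast
qed

lemma fst_label_graph: "fst label_graph = \<Union> (snd label_graph)"
proof
  show "\<Union> (snd label_graph) \<subseteq> fst label_graph" by (rule edges_label_graph)
  show "fst label_graph \<subseteq> \<Union> (snd label_graph)"
  proof
    fix x assume "x \<in> fst label_graph"
    then have x: "corner_exists x" by (simp add: label_graph_def)
    have "\<exists>s b. bond_exists s b \<and> x \<in> bond_edge s b"
    proof (cases x)
      case (Foot s r j)
      then show ?thesis using x by (intro exI[of _ s] exI[of _ "Outer r j"]) auto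
    next
      case (Head s r j)
      show ?thesis
      proof (cases "r = 0 \<and> j = 0")
        case True
        then show ?thesis using x Head h_le_k[of 1 s] m_pos[of s] h_1'[of s]
          by (intro exI[of _ s] exI[of _ "Inner r j"]) (auto simp: lo_def)
      next
        case False
        then show ?thesis using x Head
          by (intro exI[of _ s] exI[of _ "Outer r j"]) (cases "r = 0"; auto simp: lo_def)
      qed
    qed
    then show "x \<in> \<Union> (snd label_graph)" by (auto simp: label_graph_def)
  qed
qed

lemma CHS_turn_eq_image:
  "CHS_turn (m False) (k False) (h False) (m True) (k True) (h True) =
    ((plane_point \<circ> corner_point) ` fst label_graph, (`) (plane_point \<circ> corner_point) ` snd label_graph)"
proof -
  let ?C = "CHS_centers (m False) (k False) (h False) \<union>
      {turned_center (cell_center (m False) (l False)) (m True) (l True) t j | t j. cell_exists (m True) (k True) (h True) t j}"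
  let ?D = "\<lambda>s. {(i, j). cell_exists (m s) (k s) (h s) i j}"
  have 1: "cell_center i j = plane_point (cell_point False i j)" if "1 \<le> i" for i j
    using that by (simp add: cell_center_def plane_point_def cell_point_def placed_def field_simps)
  have 2: "turned_center (cell_center (m False) (l False)) (m True) (l True) i j = plane_point (cell_point True i j)" for i j
    by (simp add: cell_center_def plane_point_def cell_point_def placed_def field_simps)
  have C: "?C = (\<Union>s. (\<lambda>(i, j). plane_point (cell_point s i j)) ` ?D s)"
    unfolding UNIV_bool CHS_centers_def using 1 2 by (auto simp: cell_exists_def; force)
  have flat: "(\<Union>c\<in>(\<Union>s. f s ` D s). E c) = (\<Union>s. \<Union>x\<in>D s. E (f s x))"
    for f :: "bool \<Rightarrow> 'a \<Rightarrow> 'b" and D and E :: "'b \<Rightarrow> 'c set" by blast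
  have "snd (hexagon_graph ?C) = (\<Union>s. \<Union>(i, j)\<in>?D s. hexagon_edges (plane_point (cell_point s i j)))"
    unfolding C hexagon_graph_def snd_conv flat by (simp only: split_def)
  also have "\<dots> = (\<Union>s. \<Union>(i, j)\<in>?D s. (\<lambda>(t, b). plane_point ` corner_point ` bond_edge t b) ` cell_bonds s i j)"
    by (intro SUP_cong refl) (auto simp: hexagon_edges_cell)
  also have "\<dots> = (\<lambda>(t, b). plane_point ` corner_point ` bond_edge t b) `
      (\<Union>s. \<Union>(i, j)\<in>?D s. cell_bonds s i j)"
    by (simp only: image_UN split_def)
  also have "\<dots> = (`) (plane_point \<circ> corner_point) ` snd label_graph"
  proof -
    have "snd label_graph = (\<lambda>(s, b). bond_edge s b) ` {(s, b). bond_exists s b}"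
      by (auto simp: label_graph_def)
    then show ?thesis
      unfolding cell_bonds_exist by (simp only: image_image split_def o_def)
  qed
  finally have E: "snd (hexagon_graph ?C) = (`) (plane_point \<circ> corner_point) ` snd label_graph" .
  then have V: "fst (hexagon_graph ?C) = (plane_point \<circ> corner_point) ` fst label_graph"
    unfolding fst_hexagon_graph fst_label_graph by (simp only: image_Union)
  have "hexagon_graph ?C = ((plane_point \<circ> corner_point) ` fst label_graph,
      (`) (plane_point \<circ> corner_point) ` snd label_graph)"
    using V E by (intro prod_eqI) (simp_all only: fst_conv snd_conv)
  then show ?thesis unfolding CHS_turn_def .
qed

lemma F_turn_eq_test_polynomial:
  "F_turn (m False) (k False) (h False) (m True) (k True) (h True) =
    test_polynomial holds_on turned_bonds turned_profiles"
proof -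
  have "inj_on (plane_point \<circ> corner_point) (fst label_graph)"
    using comp_inj_on[OF corner_point_inj inj_on_subset[OF inj_plane_point subset_UNIV]]
    by (simp add: label_graph_def)
  then show ?thesis
    unfolding F_turn_def CHS_turn_eq_image
    using forcing_polynomial_image[of "plane_point \<circ> corner_point" "fst label_graph" "snd label_graph"]
      edges_label_graph finite_edges forcing_polynomial_label_graph by simp
qed

end

section \<open>Systems without a turning\<close>

text \<open>A system without a turning is one with a second half that consists of the shared row only.\<close>

lemma CHS_eq_CHS_turn:
  assumes "1 \<le> n"
  shows "CHS n k h = CHS_turn n k h 1 (\<lambda>_. k n - h n + 1) (\<lambda>_. 1)"
proof -
  have "turned_center (cell_center n (h n)) 1 1 t j \<in> CHS_centers n k h"
    if "cell_exists 1 (\<lambda>_. k n - h n + 1) (\<lambda>_. 1) t j" for t j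
  proof -
    have t: "t = 1" "1 \<le> j" "j \<le> k n - h n + 1" using that by (auto simp: cell_exists_def)
    have "turned_center (cell_center n (h n)) 1 1 t j = cell_center n (j - 1 + h n)"
      using turned_center_last_row[of n h 1 "\<lambda>_. 1" "j - 1 + h n"] t(1) by simp
    moreover have "cell_exists n k h n (j - 1 + h n)" using t assms by (auto simp: cell_exists_def)
    ultimately show ?thesis unfolding CHS_centers_def by blast
  qed
  then have "CHS_centers n k h \<union> {turned_center (cell_center n (h n)) 1 1 t j | t j.
      cell_exists 1 (\<lambda>_. k n - h n + 1) (\<lambda>_. 1) t j} = CHS_centers n k h" by blast
  then show ?thesis by (simp add: CHS_def CHS_turn_def)
qed

text \<open>The zigzag below the last row is zigzag 0 of the second half. In terms of the first half its
  bonds are those of a zigzag with constant lower neighbour \<open>C\<close>: the inner and outer bonds exchange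
  their roles, and the indices are shifted by one in one of the two cases.\<close>

lemma F_eq_test_polynomial_nonempty:
  assumes mono: "monotonic_CHS n k h" and C: "k n \<le> C"
  shows "F n k h = test_polynomial holds UNIV (profiles C n k h)"
proof -
  define mm where "mm s = (if s then 1 else n)" for s
  define kk where "kk s = (if s then (\<lambda>_. k n - h n + 1) else k)" for s
  define hh where "hh s = (if s then (\<lambda>_. 1) else h)" for s
  have n: "1 \<le> n" "h n \<le> k n" using mono by (auto simp: monotonic_CHS_def)
  have "monotonic_CHS (mm s) (kk s) (hh s)" for s
    using mono n by (cases s) (auto simp: mm_def kk_def hh_def monotonic_CHS_def)
  then interpret turned_system mm kk hh
    by unfold_locales (auto simp: mm_def kk_def hh_def)
  have tp: "w \<in> turned_profiles \<longleftrightarrow> w False \<in> profiles (w False n) n k h \<and>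
      w True 0 = 0 \<and> (\<forall>r\<ge>1. w True r = w False n - h n + 1)" (is "_ \<longleftrightarrow> ?R w") for w
  proof
    assume w: "w \<in> turned_profiles"
    have "w False \<in> profiles (w False n) n k h"
    proof -
      have "\<forall>s. w s \<in> profiles (w s (mm s)) (mm s) (kk s) (hh s)"
        using w by (simp add: turned_profiles_def)
      from spec[OF this, of False] show ?thesis by (simp add: mm_def kk_def hh_def)
    qed
    moreover have "w True r = w False n - h n + 1" if "r \<ge> 1" for r
      using profiles_bounds(7)[OF w, of False] profiles_bounds(8)[OF w, of True r] that
      by (simp add: mm_def hh_def across_def)
    ultimately show "?R w" using profiles_bounds(1)[OF w] by simp
  next
    assume w: "?R w"
    have b: "h n - 1 \<le> w False n" "w False n \<le> k n" using w n by (auto simp: profiles_def)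
    have "mono (w True)"
    proof (rule incseq_SucI)
      fix r show "w True r \<le> w True (Suc r)" using w b by (cases r) auto
    qed
    then have T: "w True \<in> profiles (w True 1) 1 (kk True) (hh True)"
      using w b by (auto simp: profiles_def kk_def hh_def)
    have "w s \<in> profiles (w s (mm s)) (mm s) (kk s) (hh s)" for s
      using w T by (cases s) (simp_all add: mm_def kk_def hh_def)
    moreover have "w (\<not> s) (mm (\<not> s)) = across s (w s (mm s))" for s
      using w by (cases s) (auto simp: mm_def across_def hh_def)
    ultimately show "w \<in> turned_profiles"
      unfolding turned_profiles_def by blast
  qed
  define g where "g w r = (if r \<le> n then w False r else C)" for w :: "bool \<Rightarrow> nat \<Rightarrow> int" and r
  define g' where "g' v s r = (if s then if r = 0 then 0 else v n - h n + 1 else v (min r n))"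
    for v :: "nat \<Rightarrow> int" and s r
  have bij: "bij_betw g turned_profiles (profiles C n k h)"
  proof (rule bij_betw_byWitness[where f' = g'])
    show "g ` turned_profiles \<subseteq> profiles C n k h"
    proof (rule image_subsetI)
      fix w assume "w \<in> turned_profiles"
      then have w: "w False \<in> profiles (w False n) n k h" by (simp add: tp)
      have "w False n \<le> C" using w n C by (force simp: profiles_def)
      then have "mono (g w)"
        using w by (intro incseq_SucI) (auto simp: g_def profiles_def mono_def not_less_eq_eq le_less_Suc_eq)
      then show "g w \<in> profiles C n k h" using w by (auto simp: g_def profiles_def)
    qed
    show "g' ` profiles C n k h \<subseteq> turned_profiles"
    proof (rule image_subsetI)
      fix v assume v: "v \<in> profiles C n k h"
      have "mono (\<lambda>r. v (min r n))" using v by (auto simp: profiles_def mono_def)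
      then have "(\<lambda>r. v (min r n)) \<in> profiles (v n) n k h"
        using v n by (auto simp: profiles_def min_def)
      moreover have "g' v False = (\<lambda>r. v (min r n))" by (simp add: g'_def fun_eq_iff)
      ultimately show "g' v \<in> turned_profiles" unfolding tp by (simp add: g'_def)
    qed
    show "\<forall>w\<in>turned_profiles. g' (g w) = w"
    proof (intro ballI ext)
      fix w s r assume "w \<in> turned_profiles"
      then have w: "w False \<in> profiles (w False n) n k h" "w True 0 = 0"
        "\<And>r. r \<ge> 1 \<Longrightarrow> w True r = w False n - h n + 1" by (simp_all add: tp)
      show "g' (g w) s r = w s r"
      proof (cases s)
        case True
        then show ?thesis using w(2) w(3)[of r] by (cases r) (simp_all add: g_def g'_def)
      next
        case False
        have "w False r = w False n" if "n < r" using w(1) that by (simp add: profiles_def)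
        then show ?thesis using False by (simp add: g_def g'_def min_def)
      qed
    qed
    show "\<forall>v\<in>profiles C n k h. g (g' v) = v"
      by (auto simp: g_def g'_def profiles_def fun_eq_iff)
  qed
  have bd: "h n - 1 \<le> w False n" "w False n \<le> k n" "w True 0 = 0" "w False 0 = 0" "w True (Suc 0) = w False n - h n + 1"
    if "w \<in> turned_profiles" for w
    using that n by (auto simp: tp profiles_def)
  let ?H = "\<lambda>e w. holds e (g w)"
  have simI: "(\<forall>w\<in>turned_profiles. \<forall>w'\<in>turned_profiles. P w = P w') \<or> (\<exists>e'\<in>T. \<forall>w\<in>turned_profiles. P w = Q e' w)"
    if "(\<exists>b. \<forall>w\<in>turned_profiles. P w = b) \<or> (\<exists>e'\<in>T. \<forall>w\<in>turned_profiles. P w = Q e' w)"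
    for P :: "(bool \<Rightarrow> nat \<Rightarrow> int) \<Rightarrow> bool" and T and Q :: "'z \<Rightarrow> (bool \<Rightarrow> nat \<Rightarrow> int) \<Rightarrow> bool"
    using that by metis
  have "simulates holds_on turned_bonds turned_profiles ?H UNIV"
    unfolding simulates_def
  proof (rule ballI, rule simI)
    fix e assume e: "e \<in> turned_bonds"
    obtain s b where sb: "e = (s, b)" by force
    have b: "b \<in> bonds (mm s)" using e sb by (simp add: turned_bonds_def)
    show "(\<exists>b. \<forall>w\<in>turned_profiles. holds_on e w = b) \<or> (\<exists>e'\<in>UNIV. \<forall>w\<in>turned_profiles. holds_on e w = ?H e' w)"
    proof (cases s)
      case False
      then have "\<forall>w\<in>turned_profiles. holds_on e w = ?H b w"
        using b by (cases b) (auto simp: sb holds_on_def g_def bonds_def mm_def)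
      then show ?thesis by blast
    next
      case True
      show ?thesis
      proof (cases b)
        case (Vertical r j)
        show ?thesis
        proof (cases "r = 0")
          case True
          then have "\<forall>w\<in>turned_profiles. holds_on e w = (j = 0)"
            using Vertical \<open>s\<close> by (auto simp: sb holds_on_def bd(3,4,5))
          then show ?thesis by blast
        next
          case False
          then have "r = 1" using b Vertical \<open>s\<close> by (simp add: bonds_def mm_def)
          then have "\<forall>w\<in>turned_profiles. holds_on e w = ?H (Vertical n (j + h n - 1)) w"
            using Vertical \<open>s\<close> by (auto simp: sb holds_on_def g_def bd(5))
          then show ?thesis by blast
        qed
      next
        case (Outer r j)
        then have r: "r = 0" using b \<open>s\<close> by (simp add: bonds_def mm_def)
        consider "j < 0" | "0 \<le> j" "j + h n - 2 < C" | "0 \<le> j" "C \<le> j + h n - 2" by linarith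
        then show ?thesis
        proof cases
          case 1
          then have "\<forall>w\<in>turned_profiles. holds_on e w = True"
            using Outer r \<open>s\<close> by (auto simp: sb holds_on_def bd(3,4,5))
          then show ?thesis by blast
        next
          case 2
          then have "\<forall>w\<in>turned_profiles. holds_on e w = ?H (Inner n (j + h n - 2)) w"
            using Outer r \<open>s\<close> by (auto simp: sb holds_on_def g_def bd(3,4,5))
          then show ?thesis by blast
        next
          case 3
          then have "\<forall>w\<in>turned_profiles. holds_on e w = True"
            using bd(2,5) Outer r \<open>s\<close> C by (force simp: sb holds_on_def)
          then show ?thesis by blast
        qed
      next
        case (Inner r j)
        then have r: "r = 0" using b \<open>s\<close> by (simp add: bonds_def mm_def)
        consider "j < 0" | "0 \<le> j" "j + h n - 1 \<le> C" | "0 \<le> j" "C < j + h n - 1" by linarith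
        then show ?thesis
        proof cases
          case 1
          then have "\<forall>w\<in>turned_profiles. holds_on e w = False"
            using Inner r \<open>s\<close> by (auto simp: sb holds_on_def bd(3,4,5))
          then show ?thesis by blast
        next
          case 2
          then have "\<forall>w\<in>turned_profiles. holds_on e w = ?H (Outer n (j + h n - 1)) w"
            using Inner r \<open>s\<close> by (auto simp: sb holds_on_def g_def bd(3,4,5))
          then show ?thesis by blast
        next
          case 3
          then have "\<forall>w\<in>turned_profiles. holds_on e w = False"
            using bd(2,5) Inner r \<open>s\<close> C by (force simp: sb holds_on_def)
          then show ?thesis by blast
        qed
      qed
    qed
  qed
  moreover have "simulates ?H UNIV turned_profiles holds_on turned_bonds"
    unfolding simulates_def
  proof (rule ballI, rule simI)
    fix b
    have inT: "(False, b) \<in> turned_bonds" if "b \<in> bonds n" for b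
      using that by (simp add: turned_bonds_def mm_def)
    have inT': "(True, Outer 0 j) \<in> turned_bonds" "(True, Inner 0 j) \<in> turned_bonds" for j
      by (simp_all add: turned_bonds_def mm_def bonds_def)
    show "(\<exists>c. \<forall>w\<in>turned_profiles. ?H b w = c) \<or> (\<exists>e'\<in>turned_bonds. \<forall>w\<in>turned_profiles. ?H b w = holds_on e' w)"
    proof (cases "b \<in> bonds n")
      case True
      then have "\<forall>w\<in>turned_profiles. ?H b w = holds_on (False, b) w"
        by (cases b) (auto simp: holds_on_def g_def bonds_def)
      then show ?thesis using inT[OF True] by blast
    next
      case False
      show ?thesis
      proof (cases b)
        case (Vertical r j)
        then have "\<forall>w\<in>turned_profiles. ?H b w = (C = j)" using False by (auto simp: bonds_def g_def)
        then show ?thesis by blast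
      next
        case (Outer r j)
        show ?thesis
        proof (cases "r = n")
          case r: True
          consider "C < j \<or> j < h n - 1" | "j \<le> C" "h n - 1 \<le> j" by linarith
          then show ?thesis
          proof cases
            case 1
            then have "\<forall>w\<in>turned_profiles. ?H b w = True"
              using bd(1) Outer r by (force simp: g_def)
            then show ?thesis by blast
          next
            case 2
            then have "\<forall>w\<in>turned_profiles. ?H b w = holds_on (True, Inner 0 (j - h n + 1)) w"
              using Outer r by (auto simp: g_def holds_on_def bd(3,4,5))
            then show ?thesis using inT' by blast
          qed
        next
          case False
          then have "\<forall>w\<in>turned_profiles. ?H b w = (j \<noteq> C)"
            using \<open>b \<notin> bonds n\<close> Outer by (auto simp: bonds_def g_def)
          then show ?thesis by blast
        qed
      next
        case (Inner r j)
        show ?thesis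
        proof (cases "r = n")
          case r: True
          consider "C \<le> j \<or> j < h n - 2" | "j < C" "h n - 2 \<le> j" by linarith
          then show ?thesis
          proof cases
            case 1
            then have "\<forall>w\<in>turned_profiles. ?H b w = False"
              using bd(1) Inner r by (force simp: g_def)
            then show ?thesis by blast
          next
            case 2
            then have "\<forall>w\<in>turned_profiles. ?H b w = holds_on (True, Outer 0 (j - h n + 2)) w"
              using Inner r by (auto simp: g_def holds_on_def bd(3,4,5))
            then show ?thesis using inT' by blast
          qed
        next
          case False
          then have "\<forall>w\<in>turned_profiles. ?H b w = False"
            using \<open>b \<notin> bonds n\<close> Inner by (auto simp: bonds_def g_def)
          then show ?thesis by blast
        qed
      qed
    qed
  qed
  ultimately have "test_polynomial holds_on turned_bonds turned_profiles =
      test_polynomial holds UNIV (profiles C n k h)"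
    by (rule test_polynomial_eq_if_simulating[OF bij])
  moreover have "F n k h = F_turn (mm False) (kk False) (hh False) (mm True) (kk True) (hh True)"
    using CHS_eq_CHS_turn[OF n(1)] by (simp add: F_def F_turn_def mm_def kk_def hh_def)
  ultimately show ?thesis using F_turn_eq_test_polynomial by simp
qed

lemma F_cong:
  assumes "\<And>s. 1 \<le> s \<Longrightarrow> s \<le> n \<Longrightarrow> k s = k' s"
  shows "F n k h = F n k' h"
proof -
  have "cell_exists n k h = cell_exists n k' h"
    using assms by (auto simp: cell_exists_def fun_eq_iff)
  then show ?thesis by (simp add: F_def CHS_def CHS_centers_def)
qed

lemma monotonic_CHS_h_mono:
  assumes "monotonic_CHS n k h" "1 \<le> r" "r \<le> r'" "r' \<le> n"
  shows "h r \<le> h r'"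
  using assms(3,2,4)
proof (induction r' rule: dec_induct)
  case (step i)
  have "\<forall>s\<in>{1..<n}. h s \<le> h (s + 1)" using assms(1) by (simp add: monotonic_CHS_def)
  then have "h i \<le> h (Suc i)" using step by simp
  then show ?case using step by simp
qed simp

text \<open>After the hexagons with index greater than \<open>c\<close> are cut off, the last rows may be empty. They are dropped
  on the left, and have the constant value \<open>c\<close> on the right.\<close>

lemma F_capped_eq_test_polynomial:
  assumes mono: "monotonic_CHS n k h"
  shows "j \<le> n \<Longrightarrow> 0 \<le> c \<Longrightarrow> (1 \<le> j \<Longrightarrow> h j - 1 \<le> c) \<Longrightarrow>
    F j (\<lambda>s. min (k s) c) h = test_polynomial holds UNIV (profiles c j k h)"
proof (induction j)
  case 0
  define v :: "nat \<Rightarrow> int" where "v = (\<lambda>r. if r = 0 then 0 else c)"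
  have "mono v" using 0 by (auto simp: v_def mono_def)
  then have "profiles c 0 k h = {v}" by (auto simp: profiles_def v_def fun_eq_iff)
  moreover have "test_number holds UNIV {v} v = 0"
    using test_number_le[of holds UNIV "{v}" v "{}"] by (simp add: identifies_def)
  ultimately show ?case by (simp add: F_zero_rows test_polynomial_def)
next
  case (Suc i)
  have hm: "\<And>r. 1 \<le> r \<Longrightarrow> r \<le> Suc i \<Longrightarrow> h r \<le> h (Suc i)"
    using monotonic_CHS_h_mono[OF mono] Suc.prems by blast
  show ?case
  proof (cases "h (Suc i) \<le> c")
    case True
    have "monotonic_CHS (Suc i) (\<lambda>s. min (k s) c) h"
      unfolding monotonic_CHS_def
    proof (intro conjI ballI)
      show "h 1 = 1" using mono by (simp add: monotonic_CHS_def)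
      fix s assume s: "s \<in> {1..Suc i}"
      then show "h s \<le> min (k s) c" using mono hm[of s] True Suc.prems by (auto simp: monotonic_CHS_def)
    next
      fix s assume s: "s \<in> {1..<Suc i}"
      then have "k s \<le> k (s + 1)" "h s \<le> h (s + 1)" "h (s + 1) \<le> k s" "h (s + 1) \<le> h (Suc i)"
        using mono hm[of "s + 1"] Suc.prems by (auto simp: monotonic_CHS_def)
      then show "min (k s) c \<le> min (k (s + 1)) c" "h s \<le> h (s + 1)" "h (s + 1) \<le> min (k s) c"
        using True by auto
    qed simp
    then have "F (Suc i) (\<lambda>s. min (k s) c) h = test_polynomial holds UNIV (profiles c (Suc i) (\<lambda>s. min (k s) c) h)"
      by (rule F_eq_test_polynomial_nonempty) simp
    also have "profiles c (Suc i) (\<lambda>s. min (k s) c) h = profiles c (Suc i) k h"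
    proof -
      have "v r \<le> c" if "mono v" "\<forall>r>Suc i. v r = c" "r \<le> Suc i" for v :: "nat \<Rightarrow> int" and r
        using monoD[OF that(1), of r "Suc (Suc i)"] that by simp
      then show ?thesis by (auto simp: profiles_def)
    qed
    finally show ?thesis .
  next
    case False
    then have c: "h (Suc i) = c + 1" using Suc.prems by simp
    have "F (Suc i) (\<lambda>s. min (k s) c) h = F i (\<lambda>s. min (k s) c) h"
      using F_empty_last_row[of "Suc i" "\<lambda>s. min (k s) c" h] c by simp
    also have "\<dots> = test_polynomial holds UNIV (profiles c i k h)"
      by (rule Suc.IH) (use Suc.prems hm[of i] c in auto)
    also have "profiles c i k h = profiles c (Suc i) k h"
    proof (intro set_eqI iffI)
      fix v assume v: "v \<in> profiles c i k h"
      have "h (Suc i) \<le> k (Suc i)" using mono Suc.prems by (auto simp: monotonic_CHS_def)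
      then show "v \<in> profiles c (Suc i) k h" using v c
        by (auto simp: profiles_def le_Suc_eq)
    next
      fix v assume v: "v \<in> profiles c (Suc i) k h"
      then have "v (Suc i) \<le> v (Suc (Suc i))" "v (Suc (Suc i)) = c" "h (Suc i) - 1 \<le> v (Suc i)"
        by (auto simp: profiles_def mono_def)
      then have "v (Suc i) = c" using c by simp
      then have "v r = c" if "r > i" for r
        using v that by (cases "r = Suc i") (auto simp: profiles_def)
      then show "v \<in> profiles c i k h" using v by (auto simp: profiles_def)
    qed
    finally show ?thesis .
  qed
qed

section \<open>Classes of matchings with a prescribed tail\<close>

definition glue :: "nat \<Rightarrow> (nat \<Rightarrow> int) \<Rightarrow> (nat \<Rightarrow> int) \<Rightarrow> nat \<Rightarrow> int" where
  "glue i v u = (\<lambda>r. if r < i then v r else u r)"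

text \<open>The tests about the rows above \<open>i\<close> that distinguish profiles bounded by \<open>c\<close>. In the
  zigzag just above row \<open>i\<close>, every bond with a larger index is a constant test, because \<open>v (i - 1) \<le> c\<close>.\<close>

definition free_bonds :: "nat \<Rightarrow> int \<Rightarrow> bond set" where
  "free_bonds i c = {b. case b of Vertical r j \<Rightarrow> r < i
     | Outer r j \<Rightarrow> Suc r < i \<or> Suc r = i \<and> j \<le> c
     | Inner r j \<Rightarrow> Suc r < i \<or> Suc r = i \<and> j < c}"

lemma holds_glue:
  assumes "1 \<le> i" "c \<le> u i" and v: "v \<in> profiles c (i - 1) k h" and v': "v' \<in> profiles c (i - 1) k h"
  shows "b \<in> free_bonds i c \<Longrightarrow> holds b (glue i v u) = holds b v"
    and "b \<notin> free_bonds i c \<Longrightarrow> holds b (glue i v u) = holds b (glue i v' u)"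
    and "b \<notin> free_bonds i c \<Longrightarrow> holds b v = holds b v'"
proof -
  have V: "v r = c" "v' r = c" if "i \<le> r" for r using v v' that assms(1) by (auto simp: profiles_def)
  have le: "v r \<le> c" "v' r \<le> c" if "Suc r = i" for r
    using v v' V[of i] that monoD[of v r i] monoD[of v' r i] by (auto simp: profiles_def)
  show "b \<in> free_bonds i c \<Longrightarrow> holds b (glue i v u) = holds b v"
    using V assms(2) by (cases b) (auto simp: free_bonds_def glue_def)
  show "b \<notin> free_bonds i c \<Longrightarrow> holds b (glue i v u) = holds b (glue i v' u)"
    using V le assms(2) by (cases b) (force simp: free_bonds_def glue_def not_less_eq less_Suc_eq)+
  show "b \<notin> free_bonds i c \<Longrightarrow> holds b v = holds b v'"
    using V le by (cases b) (force simp: free_bonds_def not_less_eq less_Suc_eq)+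
qed

lemma identifies_profile:
  assumes v: "v \<in> profiles c n k h"
  shows "identifies holds UNIV (profiles c n k h) v ((\<lambda>r. Vertical r (v r)) ` {..n})"
  unfolding identifies_def
proof (intro conjI ballI impI)
  fix w assume w: "w \<in> profiles c n k h" and "\<forall>e\<in>(\<lambda>r. Vertical r (v r)) ` {..n}. holds e w"
  then have "w r = v r" if "r \<le> n" for r using that by auto
  moreover have "w r = v r" if "r > n" for r using v w that by (simp add: profiles_def)
  ultimately show "w = v" by (metis ext not_le)
qed auto

context turned_system
begin

definition valid_tail :: "bool \<Rightarrow> nat \<Rightarrow> int \<Rightarrow> (nat \<Rightarrow> int) \<Rightarrow> bool" where
  "valid_tail s i c u \<longleftrightarrow> 1 \<le> i \<and> i \<le> m s \<and> 0 \<le> c \<and> c \<le> u i \<and>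
     (\<forall>r\<in>{i..m s}. h s r - 1 \<le> u r \<and> u r \<le> k s r) \<and> (\<forall>r\<in>{i..<m s}. u r \<le> u (Suc r))"

text \<open>In each half \<open>s\<close> the rows from \<open>i s\<close> on follow \<open>u s\<close>, and the rows above are bounded by \<open>c s\<close>.
  Monotonicity reduces the bound to the row \<open>i s - 1\<close>.\<close>

definition tail_class :: "(bool \<Rightarrow> nat) \<Rightarrow> (bool \<Rightarrow> int) \<Rightarrow> (bool \<Rightarrow> nat \<Rightarrow> int) \<Rightarrow> (bool \<Rightarrow> nat \<Rightarrow> int) set" where
  "tail_class i c u = {w \<in> turned_profiles. \<forall>s. (\<forall>r\<in>{i s..m s}. w s r = u s r) \<and> w s (i s - 1) \<le> c s}"

lemma glue_profile:
  assumes u: "valid_tail s i c u" and v: "v \<in> profiles c (i - 1) (k s) (h s)"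
  shows "glue i v (\<lambda>r. u (min r (m s))) \<in> profiles (u (m s)) (m s) (k s) (h s)"
proof -
  have i: "1 \<le> i" "i \<le> m s" "c \<le> u i" using u by (auto simp: valid_tail_def)
  have vi: "v i = c" "mono v" "v 0 = 0" using v i by (auto simp: profiles_def)
  have "glue i v (\<lambda>r. u (min r (m s))) r \<le> glue i v (\<lambda>r. u (min r (m s))) (Suc r)" for r
  proof -
    consider "Suc r < i" | "Suc r = i" | "i \<le> r" "r < m s" | "m s \<le> r" by linarith
    then show ?thesis
    proof cases
      case 1 then show ?thesis using vi(2) by (simp add: glue_def mono_def)
    next
      case 2
      have "v r \<le> v i" using vi(2) 2 by (auto simp: mono_def)
      then show ?thesis using 2 vi i by (auto simp: glue_def min_def)
    next
      case 3 then show ?thesis using u by (auto simp: glue_def valid_tail_def min_def)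
    next
      case 4 then show ?thesis using i by (simp add: glue_def)
    qed
  qed
  then have "mono (glue i v (\<lambda>r. u (min r (m s))))" by (rule incseq_SucI)
  moreover have "h s r - 1 \<le> glue i v (\<lambda>r. u (min r (m s))) r \<and> glue i v (\<lambda>r. u (min r (m s))) r \<le> k s r"
    if "r \<in> {1..m s}" for r
  proof (cases "r < i")
    case True
    then have "r \<in> {1..i - 1}" using that by auto
    then show ?thesis using v True by (auto simp: profiles_def glue_def)
  next
    case False then show ?thesis using u that by (auto simp: valid_tail_def glue_def)
  qed
  ultimately show ?thesis using vi i by (simp add: profiles_def glue_def)
qed

lemma tail_class_eq_glue:
  assumes u: "\<And>s. valid_tail s (i s) (c s) (u s)"
    and across: "u True (m True) = across False (u False (m False))"
  defines "g \<equiv> (\<lambda>a s. glue (i s) (a s) (\<lambda>r. u s (min r (m s))))"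
  shows "bij_betw g {a. \<forall>s. a s \<in> profiles (c s) (i s - 1) (k s) (h s)} (tail_class i c u)"
proof -
  have I: "1 \<le> i s" "i s \<le> m s" "0 \<le> c s" for s using u[of s] by (auto simp: valid_tail_def)
  define g' where "g' w s = glue (i s) (w s) (\<lambda>_. c s)" for w :: "bool \<Rightarrow> nat \<Rightarrow> int" and s
  show ?thesis
  proof (rule bij_betw_byWitness[where f' = g'])
    show "\<forall>a\<in>{a. \<forall>s. a s \<in> profiles (c s) (i s - 1) (k s) (h s)}. g' (g a) = a"
    proof (intro ballI ext)
      fix a s r assume a: "a \<in> {a. \<forall>s. a s \<in> profiles (c s) (i s - 1) (k s) (h s)}"
      have "a s r = c s" if "i s \<le> r" using a I[of s] that by (auto simp: profiles_def)
      then show "g' (g a) s r = a s r" by (simp add: g_def g'_def glue_def)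
    qed
    show "\<forall>w\<in>tail_class i c u. g (g' w) = w"
    proof (intro ballI ext)
      fix w s r assume w: "w \<in> tail_class i c u"
      then have "w \<in> turned_profiles" by (simp add: tail_class_def)
      note P = profiles_bounds(8)[OF this, of s r]
      have e: "\<forall>r\<in>{i s..m s}. w s r = u s r" using w by (simp add: tail_class_def)
      have "w s r = u s (min r (m s))" if "i s \<le> r"
        using e that P I[of s] by (cases "r \<le> m s") (simp_all add: min_def)
      then show "g (g' w) s r = w s r" by (simp add: g_def g'_def glue_def)
    qed
    show "g ` {a. \<forall>s. a s \<in> profiles (c s) (i s - 1) (k s) (h s)} \<subseteq> tail_class i c u"
    proof (rule image_subsetI)
      fix a assume a: "a \<in> {a. \<forall>s. a s \<in> profiles (c s) (i s - 1) (k s) (h s)}"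
      have gm: "g a s r = u s r" if "i s \<le> r" "r \<le> m s" for s r using that by (simp add: g_def glue_def)
      have "g a s \<in> profiles (g a s (m s)) (m s) (k s) (h s)" for s
        using glue_profile[OF u[of s], of "a s"] a gm[of s "m s"] I[of s] by (simp add: g_def)
      moreover have "g a (\<not> s) (m (\<not> s)) = across s (g a s (m s))" for s
        using gm[of True "m True"] gm[of False "m False"] I[of True] I[of False] across by (cases s) auto
      ultimately have "g a \<in> turned_profiles" by (simp add: turned_profiles_def)
      moreover have "g a s (i s - 1) \<le> c s" for s
      proof -
        have "a s \<in> profiles (c s) (i s - 1) (k s) (h s)" using a by blast
        then have "mono (a s)" "a s (i s) = c s" using I[of s] by (simp_all add: profiles_def)
        then have "a s (i s - 1) \<le> c s" using monoD[of "a s" "i s - 1" "i s"] by simp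
        then show ?thesis using I[of s] by (simp add: g_def glue_def)
      qed
      ultimately show "g a \<in> tail_class i c u" using gm by (auto simp: tail_class_def)
    qed
    show "g' ` tail_class i c u \<subseteq> {a. \<forall>s. a s \<in> profiles (c s) (i s - 1) (k s) (h s)}"
    proof (rule image_subsetI, rule CollectI, rule allI)
      fix w s assume w: "w \<in> tail_class i c u"
      then have wt: "w \<in> turned_profiles" and wc: "w s (i s - 1) \<le> c s" by (auto simp: tail_class_def)
      note P = profiles_bounds[OF wt, where s = s]
      have "g' w s r \<le> g' w s (Suc r)" for r
      proof -
        consider "Suc r < i s" | "Suc r = i s" "r = i s - 1" | "i s \<le> r" by linarith
        then show ?thesis using P(2)[of r "Suc r"] wc by cases (auto simp: g'_def glue_def)
      qed
      then have "mono (g' w s)" by (rule incseq_SucI)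
      moreover have "h s r - 1 \<le> g' w s r \<and> g' w s r \<le> k s r" if "r \<in> {1..i s - 1}" for r
      proof -
        have "r < i s" "1 \<le> r" "r \<le> m s" using that I[of s] by auto
        then show ?thesis using P(3)[of r] P(4)[of r] by (simp add: g'_def glue_def)
      qed
      ultimately show "g' w s \<in> profiles (c s) (i s - 1) (k s) (h s)"
        using P(1) I[of s] by (auto simp: profiles_def g'_def glue_def)
    qed
  qed
qed

abbreviation weight :: "(bool \<Rightarrow> nat \<Rightarrow> int) \<Rightarrow> int poly" where
  "weight w \<equiv> monom 1 (test_number holds_on turned_bonds turned_profiles w)"

text \<open>The class is a product via \<open>glue\<close>. The set \<open>S0\<close> forces a matching into the class, and the maps
  \<open>N t\<close> give the changes for the lower bound.\<close>

lemma sum_weight_tail_class: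
  assumes u: "\<And>s. valid_tail s (i s) (c s) (u s)"
    and across: "u True (m True) = across False (u False (m False))"
    and S0: "finite S0" "S0 \<subseteq> turned_bonds" "card S0 \<le> n"
      "\<And>w e. w \<in> tail_class i c u \<Longrightarrow> e \<in> S0 \<Longrightarrow> holds_on e w"
      "\<And>w. w \<in> turned_profiles \<Longrightarrow> \<forall>e\<in>S0. holds_on e w \<Longrightarrow> w \<in> tail_class i c u"
    and N: "\<And>t w. t < n \<Longrightarrow> w \<in> tail_class i c u \<Longrightarrow> N t w \<in> turned_profiles \<and> N t w \<noteq> w"
      "\<And>t w s b. t < n \<Longrightarrow> w \<in> tail_class i c u \<Longrightarrow> b \<in> free_bonds (i s) (c s) \<Longrightarrow>
         (s, b) \<notin> lost holds_on turned_bonds w (N t w)"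
      "\<And>t t' w. t < t' \<Longrightarrow> t' < n \<Longrightarrow> w \<in> tail_class i c u \<Longrightarrow>
         lost holds_on turned_bonds w (N t w) \<inter> lost holds_on turned_bonds w (N t' w) = {}"
  shows "(\<Sum>w\<in>tail_class i c u. weight w) =
    test_polynomial holds UNIV (profiles (c False) (i False - 1) (k False) (h False)) *
    test_polynomial holds UNIV (profiles (c True) (i True - 1) (k True) (h True)) * monom 1 n"
proof -
  define W1 where "W1 s = profiles (c s) (i s - 1) (k s) (h s)" for s
  define g where "g = (\<lambda>a s. glue (i s) (a s) (\<lambda>r. u s (min r (m s))))"
  have bij: "bij_betw g {a. \<forall>s. a s \<in> W1 s} (tail_class i c u)"
    unfolding g_def W1_def by (rule tail_class_eq_glue[OF u across])
  have I: "1 \<le> i s" "i s \<le> m s" "c s \<le> u s (min (i s) (m s))" for s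
    using u[of s] by (auto simp: valid_tail_def min_def)
  define R where "R s = {s} \<times> free_bonds (i s) (c s)" for s :: bool
  have cl: "g a \<in> tail_class i c u" if "\<And>s. a s \<in> W1 s" for a
    using bij that by (auto simp: bij_betw_def)
  have tc: "w \<in> turned_profiles" if "w \<in> tail_class i c u" for w using that by (simp add: tail_class_def)
  have G: "b \<in> free_bonds (i s) (c s) \<Longrightarrow> holds b (glue (i s) v (\<lambda>r. u s (min r (m s)))) = holds b v"
    "b \<notin> free_bonds (i s) (c s) \<Longrightarrow> holds b (glue (i s) v (\<lambda>r. u s (min r (m s)))) = holds b (glue (i s) v' (\<lambda>r. u s (min r (m s))))"
    "b \<notin> free_bonds (i s) (c s) \<Longrightarrow> holds b v = holds b v'"
    if "v \<in> W1 s" "v' \<in> W1 s" for b v v' s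
    using holds_glue[of "i s" "c s" "\<lambda>r. u s (min r (m s))" v "k s" "h s" v' b] I[of s] that
    unfolding W1_def by blast+
  have number: "test_number holds_on turned_bonds turned_profiles (g a) =
     test_number holds UNIV (W1 False) (a False) + test_number holds UNIV (W1 True) (a True) + n"
    if a: "\<And>s. a s \<in> W1 s" for a
  proof (rule test_number_product[where ?H1.0 = holds and ?T1.0 = "\<lambda>_. UNIV" and ?W1.0 = W1 and g = g and R = R
        and ?S0.0 = S0 and N = "\<lambda>t. N t (g a)"])
    show "g a \<in> turned_profiles" if "\<And>s. a s \<in> W1 s" for a using cl[OF that] tc by blast
    show "a = b" if "\<And>s. a s \<in> W1 s" "\<And>s. b s \<in> W1 s" "g a = g b" for a b
      using bij that by (auto simp: bij_betw_def inj_on_def)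
    show "R s \<subseteq> turned_bonds" for s
      using I[of s] by (auto simp: R_def turned_bonds_def free_bonds_def bonds_def split: bond.splits)
    show "R False \<inter> R True = {}" by (auto simp: R_def)
    show "holds_on e (g (a(s := b))) = holds_on e (g a)"
      if "\<And>s. a s \<in> W1 s" "b \<in> W1 s" "e \<in> turned_bonds" "e \<notin> R s" for e s a b
    proof (cases "fst e = s")
      case True
      then have "snd e \<notin> free_bonds (i s) (c s)" using that(4) by (cases e) (auto simp: R_def)
      then show ?thesis
        using G(2)[OF that(2) that(1)[of s], of "snd e"] True by (simp add: holds_on_def g_def)
    next
      case False
      then show ?thesis by (simp add: holds_on_def g_def)
    qed
    show "\<exists>e1\<in>UNIV. \<forall>a. (\<forall>s. a s \<in> W1 s) \<longrightarrow> holds_on e (g a) = holds e1 (a s)" if "e \<in> R s" for e s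
    proof (intro bexI[of _ "snd e"] allI impI)
      fix a assume "\<forall>s. a s \<in> W1 s"
      then have "a s \<in> W1 s" by blast
      from G(1)[OF this this, of "snd e"] show "holds_on e (g a) = holds (snd e) (a s)"
        using that by (auto simp: R_def holds_on_def g_def)
    qed simp
    show "(\<forall>w\<in>W1 s. \<forall>w'\<in>W1 s. holds e1 w = holds e1 w') \<or>
       (\<exists>e\<in>turned_bonds. \<forall>a. (\<forall>s. a s \<in> W1 s) \<longrightarrow> holds_on e (g a) = holds e1 (a s))" for e1 s
    proof (cases "e1 \<in> free_bonds (i s) (c s)")
      case True
      then have "(s, e1) \<in> turned_bonds"
        using I[of s] by (auto simp: turned_bonds_def free_bonds_def bonds_def split: bond.splits)
      moreover have "holds_on (s, e1) (g a) = holds e1 (a s)" if "\<forall>s. a s \<in> W1 s" for a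
      proof -
        have "a s \<in> W1 s" using that by blast
        from G(1)[OF this this True] show ?thesis by (simp add: holds_on_def g_def)
      qed
      ultimately show ?thesis by blast
    next
      case False
      then show ?thesis using G(3)[OF _ _ False] by blast
    qed
    show "\<exists>S. identifies holds UNIV (W1 s) v S" if "v \<in> W1 s" for s v
      using identifies_profile that unfolding W1_def by blast
    show "\<exists>b. (\<forall>s. b s \<in> W1 s) \<and> w = g b"
      if "w \<in> turned_profiles" "\<forall>e\<in>S0. holds_on e w" for w
    proof -
      have "w \<in> g ` {a. \<forall>s. a s \<in> W1 s}"
        using S0(5)[OF that] bij by (simp add: bij_betw_def)
      then show ?thesis by blast
    qed
    show "holds_on e (g a)" if "e \<in> S0" for e using S0(4) cl[OF a] that by blast
    show "N t (g a) \<in> turned_profiles" "N t (g a) \<noteq> g a" if "t < n" for t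
      using N(1)[OF that cl[OF a]] by auto
    show "lost holds_on turned_bonds (g a) (N t (g a)) \<inter> R s = {}" if "t < n" for t s
      using N(2)[OF that cl[OF a]] by (auto simp: R_def)
    show "lost holds_on turned_bonds (g a) (N t (g a)) \<inter> lost holds_on turned_bonds (g a) (N t' (g a)) = {}"
      if "t < t'" "t' < n" for t t'
      using N(3)[OF that cl[OF a]] .
  qed (use a S0 in auto)
  let ?f = "\<lambda>s v. monom (1::int) (test_number holds UNIV (W1 s) v)"
  have "(\<Sum>w\<in>tail_class i c u. weight w) = (\<Sum>a\<in>{a. \<forall>s. a s \<in> W1 s}. weight (g a))"
    by (rule sum.reindex_bij_betw[OF bij, symmetric])
  also have "\<dots> = (\<Sum>a\<in>{a. \<forall>s. a s \<in> W1 s}. ?f False (a False) * ?f True (a True) * monom 1 n)"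
  proof (rule sum.cong[OF refl])
    fix a assume "a \<in> {a. \<forall>s. a s \<in> W1 s}"
    then have "\<And>s. a s \<in> W1 s" by blast
    from number[OF this] show "weight (g a) = ?f False (a False) * ?f True (a True) * monom 1 n"
      by (simp add: mult_monom)
  qed
  also have "\<dots> = (\<Sum>p\<in>W1 False \<times> W1 True. ?f False (fst p) * ?f True (snd p) * monom 1 n)"
  proof -
    have "bij_betw (\<lambda>p s. if s then snd p else fst p) (W1 False \<times> W1 True) {a. \<forall>s. a s \<in> W1 s}"
      by (rule bij_betw_byWitness[where f' = "\<lambda>a. (a False, a True)"]) (auto simp: fun_eq_iff)
    from sum.reindex_bij_betw[OF this, of "\<lambda>a. ?f False (a False) * ?f True (a True) * monom 1 n"]
    show ?thesis by simp
  qed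
  also have "\<dots> = (\<Sum>x\<in>W1 False. ?f False x) * (\<Sum>y\<in>W1 True. ?f True y) * monom 1 n"
    unfolding sum_product sum.cartesian_product
    by (simp add: split_def flip: sum_distrib_right)
  finally show ?thesis by (simp add: test_polynomial_def W1_def)
qed

text \<open>A move changes at most one row in each half; the step \<open>0\<close> leaves the half alone. The default value of a
  profile below its last row moves along with the last row.\<close>

definition moved :: "(bool \<Rightarrow> nat \<times> int) \<Rightarrow> (bool \<Rightarrow> nat \<Rightarrow> int) \<Rightarrow> bool \<Rightarrow> nat \<Rightarrow> int" where
  "moved mv w = (\<lambda>s r. if r = fst (mv s) \<or> fst (mv s) = m s \<and> m s \<le> r then w s r + snd (mv s) else w s r)"

text \<open>The shared row has to move in both halves or in neither.\<close>

definition last_shift :: "(bool \<Rightarrow> nat \<times> int) \<Rightarrow> bool \<Rightarrow> int" where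
  "last_shift mv s = (if fst (mv s) = m s then snd (mv s) else 0)"

definition legal_step :: "bool \<Rightarrow> nat \<Rightarrow> int \<Rightarrow> (nat \<Rightarrow> int) \<Rightarrow> nat \<Rightarrow> int \<Rightarrow> bool" where
  "legal_step s i c u \<rho> \<delta> \<longleftrightarrow> (\<delta> = 1 \<or> \<delta> = - 1) \<and> i \<le> \<rho> \<and> \<rho> \<le> m s \<and>
     h s \<rho> - 1 \<le> u \<rho> + \<delta> \<and> u \<rho> + \<delta> \<le> k s \<rho> \<and> (\<rho> < m s \<longrightarrow> u \<rho> + \<delta> \<le> u (Suc \<rho>)) \<and>
     (if \<rho> = i then c else u (\<rho> - 1)) \<le> u \<rho> + \<delta>"

definition legal_move :: "(bool \<Rightarrow> nat) \<Rightarrow> (bool \<Rightarrow> int) \<Rightarrow> (bool \<Rightarrow> nat \<Rightarrow> int) \<Rightarrow> (bool \<Rightarrow> nat \<times> int) \<Rightarrow> bool" where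
  "legal_move i c u mv \<longleftrightarrow>
     (\<forall>s. snd (mv s) = 0 \<or> legal_step s (i s) (c s) (u s) (fst (mv s)) (snd (mv s))) \<and>
     (\<exists>s. snd (mv s) \<noteq> 0) \<and> last_shift mv False = last_shift mv True"

text \<open>Lowering fails tests with a lower bound on \<open>v r\<close>, and raising fails tests with an upper bound,
  so steps in different rows share a failed test only in one situation: if \<open>v (Suc r) = v r + 1\<close>, then raising
  \<open>v r\<close> and lowering \<open>v (Suc r)\<close> both fail \<open>Inner r (v r)\<close>.\<close>

definition independent_steps :: "(nat \<Rightarrow> int) \<Rightarrow> nat \<times> int \<Rightarrow> nat \<times> int \<Rightarrow> bool" where
  "independent_steps u p p' \<longleftrightarrow> snd p = 0 \<or> snd p' = 0 \<or> fst p \<noteq> fst p' \<and>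
     \<not> (snd p = 1 \<and> snd p' = - 1 \<and> fst p' = Suc (fst p) \<and> u (fst p') = u (fst p) + 1) \<and>
     \<not> (snd p' = 1 \<and> snd p = - 1 \<and> fst p = Suc (fst p') \<and> u (fst p) = u (fst p') + 1)"

definition loses :: "(nat \<Rightarrow> int) \<Rightarrow> nat \<Rightarrow> int \<Rightarrow> bond \<Rightarrow> bool" where
  "loses v \<rho> \<delta> b \<longleftrightarrow> \<delta> \<noteq> 0 \<and> (b = Vertical \<rho> (v \<rho>) \<or>
     \<delta> = - 1 \<and> (b = Outer \<rho> (v \<rho> - 1) \<or> (\<exists>r. \<rho> = Suc r \<and> b = Inner r (v \<rho> - 1))) \<or>
     \<delta> = 1 \<and> (b = Inner \<rho> (v \<rho>) \<or> (\<exists>r. \<rho> = Suc r \<and> b = Outer r (v \<rho> + 1))))"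

lemma lost_by_step:
  assumes "holds b v" "\<not> holds b v'" "b \<in> bonds n"
    and "\<And>r. r \<le> n \<Longrightarrow> v' r = v r + (if r = \<rho> then \<delta> else 0)" and "\<delta> = 0 \<or> \<delta> = 1 \<or> \<delta> = - 1"
  shows "loses v \<rho> \<delta> b"
proof (cases b)
  case (Vertical r j)
  then show ?thesis using assms(1-3) assms(4)[of r] by (auto simp: loses_def bonds_def split: if_splits)
next
  case (Outer r j)
  then show ?thesis using assms(1-3,5) assms(4)[of r] assms(4)[of "Suc r"]
    by (auto simp: loses_def bonds_def split: if_splits)
next
  case (Inner r j)
  then show ?thesis using assms(1-3,5) assms(4)[of r] assms(4)[of "Suc r"]
    by (auto simp: loses_def bonds_def split: if_splits)
qed

lemma sum_weight_tail_class_moves: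
  assumes u: "\<And>s. valid_tail s (i s) (c s) (u s)"
    and across: "u True (m True) = across False (u False (m False))"
    and S0: "finite S0" "S0 \<subseteq> turned_bonds" "card S0 \<le> n"
      "\<And>w e. w \<in> tail_class i c u \<Longrightarrow> e \<in> S0 \<Longrightarrow> holds_on e w"
      "\<And>w. w \<in> turned_profiles \<Longrightarrow> \<forall>e\<in>S0. holds_on e w \<Longrightarrow> w \<in> tail_class i c u"
    and mv: "\<And>t. t < n \<Longrightarrow> legal_move i c u (mv t)"
      "\<And>t t' s. t < t' \<Longrightarrow> t' < n \<Longrightarrow> independent_steps (u s) (mv t s) (mv t' s)"
  shows "(\<Sum>w\<in>tail_class i c u. weight w) =
    test_polynomial holds UNIV (profiles (c False) (i False - 1) (k False) (h False)) *
    test_polynomial holds UNIV (profiles (c True) (i True - 1) (k True) (h True)) * monom 1 n"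
proof (rule sum_weight_tail_class[OF u across S0, where N = "\<lambda>t. moved (mv t)"])
  have I: "1 \<le> i s" "i s \<le> m s" "c s \<le> u s (i s)" for s using u[of s] by (auto simp: valid_tail_def)
  have st: "snd (mv t s) = 0 \<or> legal_step s (i s) (c s) (u s) (fst (mv t s)) (snd (mv t s))"
    and ls: "last_shift (mv t) (\<not> s) = last_shift (mv t) s" if "t < n" for t s
    using mv(1)[OF that] by (auto simp: legal_move_def) (cases s; simp)
  have mr: "moved (mv t) w s r = w s r + (if r = fst (mv t s) then snd (mv t s) else 0)"
    if "r \<le> m s" for t w s r
    using that by (simp add: moved_def)
  have tcu: "w s r = u s r" if "w \<in> tail_class i c u" "i s \<le> r" "r \<le> m s" for w s r
    using that by (simp add: tail_class_def)
  {
    fix t w assume t: "t < n" and w: "w \<in> tail_class i c u"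
    have wt: "w \<in> turned_profiles" and wc: "\<And>s. w s (i s - 1) \<le> c s" using w by (auto simp: tail_class_def)
    have "moved (mv t) w s \<in> profiles (moved (mv t) w s (m s)) (m s) (k s) (h s)" for s
    proof (cases "snd (mv t s) = 0")
      case True
      then have "moved (mv t) w s = w s" by (auto simp: moved_def fun_eq_iff)
      then show ?thesis using wt by (simp add: turned_profiles_def)
    next
      case False
      obtain \<rho> \<delta> where p: "mv t s = (\<rho>, \<delta>)" by force
      note P = profiles_bounds[OF wt, where s = s]
      have L: "legal_step s (i s) (c s) (u s) \<rho> \<delta>" using st[OF t, of s] False p by simp
      then have \<rho>: "i s \<le> \<rho>" "\<rho> \<le> m s" "\<delta> = 1 \<or> \<delta> = - 1" by (auto simp: legal_step_def)
      have M: "moved (mv t) w s r = (if r = \<rho> \<or> \<rho> = m s \<and> m s \<le> r then w s r + \<delta> else w s r)" for r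
        by (simp add: moved_def p)
      have U: "w s r = u s r" if "i s \<le> r" "r \<le> m s" for r using tcu[OF w that] .
      have prev: "w s (\<rho> - 1) \<le> w s \<rho> + \<delta>"
        using L wc[of s] U[of \<rho>] U[of "\<rho> - 1"] \<rho> by (auto simp: legal_step_def split: if_splits)
      have nxt: "w s \<rho> + \<delta> \<le> w s (Suc \<rho>)" if "\<rho> < m s"
        using L that U[of \<rho>] U[of "Suc \<rho>"] \<rho> by (auto simp: legal_step_def)
      have "moved (mv t) w s r \<le> moved (mv t) w s (Suc r)" for r
      proof -
        consider "r = \<rho>" "\<rho> < m s" | "Suc r = \<rho>" "r = \<rho> - 1" | "\<rho> = m s" "m s \<le> r" | "Suc r \<noteq> \<rho>" "r \<noteq> \<rho>" "\<rho> = m s \<longrightarrow> r < m s"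
          using \<rho>(2) by linarith
        then show ?thesis
        proof cases
          case 1 then show ?thesis using nxt by (simp add: M)
        next
          case 2 then show ?thesis using prev \<rho>(2) by (auto simp: M)
        next
          case 3 then show ?thesis using P(2)[of r "Suc r"] by (simp add: M)
        next
          case 4 then show ?thesis using P(2)[of r "Suc r"] by (auto simp: M)
        qed
      qed
      then have "mono (moved (mv t) w s)" by (rule incseq_SucI)
      moreover have "h s r - 1 \<le> moved (mv t) w s r \<and> moved (mv t) w s r \<le> k s r" if "r \<in> {1..m s}" for r
        using that P(3)[of r] P(4)[of r] U[of \<rho>] L \<rho> by (auto simp: mr p legal_step_def)
      moreover have "moved (mv t) w s r = moved (mv t) w s (m s)" if "r > m s" for r
        using P(8)[of r] that \<rho>(2) by (auto simp: M)
      moreover have "moved (mv t) w s 0 = 0" using P(1) \<rho> I[of s] by (auto simp: M)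
      ultimately show ?thesis by (auto simp: profiles_def)
    qed
    moreover have "moved (mv t) w (\<not> s) (m (\<not> s)) = across s (moved (mv t) w s (m s))" for s
      using ls[OF t, of s] profiles_bounds(7)[OF wt, of s]
      by (auto simp: mr last_shift_def across_def split: if_splits)
    ultimately have "moved (mv t) w \<in> turned_profiles" by (simp add: turned_profiles_def)
    moreover have "moved (mv t) w \<noteq> w"
    proof
      assume eq: "moved (mv t) w = w"
      obtain s where "snd (mv t s) \<noteq> 0" using mv(1)[OF t] by (auto simp: legal_move_def)
      moreover have "moved (mv t) w s (fst (mv t s)) = w s (fst (mv t s)) + snd (mv t s)"
        by (simp add: moved_def)
      ultimately show False using eq by simp
    qed
    ultimately show "moved (mv t) w \<in> turned_profiles \<and> moved (mv t) w \<noteq> w" ..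
  }
  have lostD: "loses (u s) (fst (mv t s)) (snd (mv t s)) b \<and> i s \<le> fst (mv t s) \<and> fst (mv t s) \<le> m s \<and>
      (fst (mv t s) = i s \<longrightarrow> c s \<le> u s (i s) + snd (mv t s))"
    if t: "t < n" and w: "w \<in> tail_class i c u" and b: "(s, b) \<in> lost holds_on turned_bonds w (moved (mv t) w)"
    for t w s b
  proof -
    have B: "holds b (w s)" "\<not> holds b (moved (mv t) w s)" "b \<in> bonds (m s)"
      using b by (auto simp: lost_def holds_on_def turned_bonds_def)
    have \<delta>: "snd (mv t s) = 0 \<or> snd (mv t s) = 1 \<or> snd (mv t s) = - 1"
      using st[OF t, of s] by (auto simp: legal_step_def)
    have *: "loses (w s) (fst (mv t s)) (snd (mv t s)) b"
      by (rule lost_by_step[OF B mr \<delta>])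
    then have L: "legal_step s (i s) (c s) (u s) (fst (mv t s)) (snd (mv t s))"
      using st[OF t, of s] by (auto simp: loses_def)
    have "w s (fst (mv t s)) = u s (fst (mv t s))"
      using tcu[OF w, of s "fst (mv t s)"] L by (auto simp: legal_step_def)
    moreover have "i s \<le> fst (mv t s) \<and> fst (mv t s) \<le> m s \<and>
      (fst (mv t s) = i s \<longrightarrow> c s \<le> u s (i s) + snd (mv t s))" using L by (auto simp: legal_step_def)
    ultimately show ?thesis using * by (simp add: loses_def)
  qed
  show "(s, b) \<notin> lost holds_on turned_bonds w (moved (mv t) w)"
    if "t < n" "w \<in> tail_class i c u" "b \<in> free_bonds (i s) (c s)" for t w s b
  proof
    assume "(s, b) \<in> lost holds_on turned_bonds w (moved (mv t) w)"
    from lostD[OF that(1,2) this] show False using that(3) I(3)[of s] by (auto simp: loses_def free_bonds_def)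
  qed
  show "lost holds_on turned_bonds w (moved (mv t) w) \<inter> lost holds_on turned_bonds w (moved (mv t') w) = {}"
    if t: "t < t'" "t' < n" and w: "w \<in> tail_class i c u" for t t' w
  proof (rule equals0I)
    fix e assume e: "e \<in> lost holds_on turned_bonds w (moved (mv t) w) \<inter> lost holds_on turned_bonds w (moved (mv t') w)"
    obtain s b where sb: "e = (s, b)" by force
    have "t < n" using t by simp
    note D = lostD[OF this w, of s b] lostD[OF t(2) w, of s b]
    have ind: "independent_steps (u s) (mv t s) (mv t' s)" by (rule mv(2)[OF t])
    have mono_u: "u s r \<le> u s (Suc r)" if "i s \<le> r" "Suc r \<le> m s" for r
      using u[of s] that by (simp add: valid_tail_def)
    obtain \<rho> \<delta> \<rho>' \<delta>' where p: "mv t s = (\<rho>, \<delta>)" "mv t' s = (\<rho>', \<delta>')" by force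
    have D1: "loses (u s) \<rho> \<delta> b" "i s \<le> \<rho>" "\<rho> \<le> m s"
      using D(1) e sb unfolding p fst_conv snd_conv by blast+
    have D2: "loses (u s) \<rho>' \<delta>' b" "i s \<le> \<rho>'" "\<rho>' \<le> m s"
      using D(2) e sb unfolding p fst_conv snd_conv by blast+
    have ind': "\<rho> \<noteq> \<rho>'" "\<not> (\<delta> = 1 \<and> \<delta>' = - 1 \<and> \<rho>' = Suc \<rho> \<and> u s \<rho>' = u s \<rho> + 1)"
      "\<not> (\<delta>' = 1 \<and> \<delta> = - 1 \<and> \<rho> = Suc \<rho>' \<and> u s \<rho> = u s \<rho>' + 1)"
      using ind D1(1) D2(1) unfolding loses_def independent_steps_def p fst_conv snd_conv by blast+
    show False
    proof (cases b)
      case (Vertical r j)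
      then show False using D1(1) D2(1) ind'(1) by (simp add: loses_def)
    next
      case (Outer r j)
      then have "\<delta> = - 1 \<and> \<rho> = r \<and> j = u s r - 1 \<or> \<delta> = 1 \<and> \<rho> = Suc r \<and> j = u s (Suc r) + 1"
        "\<delta>' = - 1 \<and> \<rho>' = r \<and> j = u s r - 1 \<or> \<delta>' = 1 \<and> \<rho>' = Suc r \<and> j = u s (Suc r) + 1"
        using D1(1) D2(1) by (auto simp: loses_def)
      then show False using ind'(1) D1 D2 mono_u[of r] by auto
    next
      case (Inner r j)
      then have "\<delta> = - 1 \<and> \<rho> = Suc r \<and> j = u s (Suc r) - 1 \<or> \<delta> = 1 \<and> \<rho> = r \<and> j = u s r"
        "\<delta>' = - 1 \<and> \<rho>' = Suc r \<and> j = u s (Suc r) - 1 \<or> \<delta>' = 1 \<and> \<rho>' = r \<and> j = u s r"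
        using D1(1) D2(1) by (auto simp: loses_def)
      then show False using ind' by auto
    qed
  qed
qed

end

section \<open>Classes with columns at the corner\<close>

text \<open>Used to sort matchings by the topmost row of a column.\<close>

lemma sum_by_first_occurrence:
  fixes v :: "'w \<Rightarrow> nat \<Rightarrow> int" and f :: "'w \<Rightarrow> 'p :: comm_monoid_add"
  assumes "finite A" and "\<And>w. w \<in> A \<Longrightarrow> mono (v w)" "\<And>w. w \<in> A \<Longrightarrow> v w b = z"
    and "1 \<le> a" and "\<And>w. w \<in> A \<Longrightarrow> v w (a - 1) < z"
  shows "sum f A = (\<Sum>i = a..b. sum f {w \<in> A. v w i = z \<and> v w (i - 1) \<le> z - 1})"
proof -
  define idx where "idx w = (LEAST r. v w r = z)" for w
  have at: "v w (idx w) = z" "idx w \<le> b" if "w \<in> A" for w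
    unfolding idx_def using assms(3)[OF that] by (auto intro: LeastI Least_le)
  have below: "v w r < z" if "w \<in> A" "r < idx w" for w r
    using monoD[OF assms(2)[OF that(1)], of r "idx w"] at(1)[OF that(1)] not_less_Least[of r "\<lambda>r. v w r = z"] that(2)
    by (auto simp: idx_def less_le)
  have ge: "a \<le> idx w" if w: "w \<in> A" for w
    using monoD[OF assms(2)[OF w], of "idx w" "a - 1"] at(1)[OF w] assms(5)[OF w] by force
  have "sum f A = (\<Sum>i = a..b. sum f {w \<in> A. idx w = i})"
    by (rule sum.group[symmetric]) (use assms(1) at ge in auto)
  also have "\<dots> = (\<Sum>i = a..b. sum f {w \<in> A. v w i = z \<and> v w (i - 1) \<le> z - 1})"
  proof (rule sum.cong[OF refl])
    fix i assume i: "i \<in> {a..b}"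
    have "idx w = i \<longleftrightarrow> v w i = z \<and> v w (i - 1) \<le> z - 1" if w: "w \<in> A" for w
    proof
      assume "idx w = i"
      then show "v w i = z \<and> v w (i - 1) \<le> z - 1"
        using at(1)[OF w] below[OF w, of "i - 1"] i assms(4) by auto
    next
      assume *: "v w i = z \<and> v w (i - 1) \<le> z - 1"
      then have "idx w \<le> i" using Least_le[of "\<lambda>r. v w r = z" i] by (simp add: idx_def)
      moreover have "\<not> idx w \<le> i - 1"
        using monoD[OF assms(2)[OF w], of "idx w" "i - 1"] at(1)[OF w] * by auto
      ultimately show "idx w = i" by linarith
    qed
    then have "{w \<in> A. idx w = i} = {w \<in> A. v w i = z \<and> v w (i - 1) \<le> z - 1}" by blast
    then show "sum f {w \<in> A. idx w = i} = sum f {w \<in> A. v w i = z \<and> v w (i - 1) \<le> z - 1}" by simp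
  qed
  finally show ?thesis .
qed

context turned_system
begin

abbreviation K :: "bool \<Rightarrow> int" where "K s \<equiv> k s (m s)"

definition capped :: "bool \<Rightarrow> int \<Rightarrow> nat \<Rightarrow> int poly" where
  "capped s c n = F n (\<lambda>r. min (k s r) c) (h s)"

lemma capped_eq_test_polynomial:
  assumes "valid_tail s i c u" "1 < i \<Longrightarrow> h s (i - 1) - 1 \<le> c"
  shows "test_polynomial holds UNIV (profiles c (i - 1) (k s) (h s)) = capped s c (i - 1)"
  unfolding capped_def
  by (rule F_capped_eq_test_polynomial[OF mono_CHS, symmetric]) (use assms in \<open>auto simp: valid_tail_def\<close>)

lemma h_pred_le: "1 < r \<Longrightarrow> r \<le> m s \<Longrightarrow> h s (r - 1) \<le> h s r"
  using h_mono[of "r - 1" r s] by fastforce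

lemma profile_mono: "w \<in> turned_profiles \<Longrightarrow> mono (w s)"
  by (auto simp: turned_profiles_def profiles_def)

lemma profile_le_K: "w \<in> turned_profiles \<Longrightarrow> r \<le> m s \<Longrightarrow> w s r \<le> K s"
  using profiles_bounds(2)[of w r "m s" s] profiles_bounds(4)[of w "m s" s] m_pos[of s] by fastforce

lemma profile_at_K: "w \<in> turned_profiles \<Longrightarrow> w (\<not> s) (m (\<not> s)) = K (\<not> s) \<longleftrightarrow> w s (m s) = K s"
  using profiles_bounds(7)[of w s] across_k[of s] across_inj[of s "w s (m s)" "K s"] by metis

text \<open>One test fixes the shared row, and since \<open>c < K\<close> its hexagon \<open>c + 1\<close> can be rotated.\<close>

lemma sum_last_row_below_K:
  assumes c: "l False - 1 \<le> c" "c < K False"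
  shows "(\<Sum>w\<in>{w \<in> turned_profiles. w False (m False) = c}. weight w) =
    capped False c (m False - 1) * capped True (across False c) (m True - 1) * monom 1 1"
proof -
  define cc where "cc s = (if s then across False c else c)" for s
  have cc: "l s - 1 \<le> cc s" "cc s < K s" "0 \<le> cc s" for s
    using c same_length[of False] h_pos[of "m s" s] m_pos[of s] by (cases s; simp add: cc_def across_def)+
  have tail: "valid_tail s (m s) (cc s) (\<lambda>_. cc s)" for s
    using cc[of s] m_pos[of s] by (auto simp: valid_tail_def)
  have cl: "tail_class m cc (\<lambda>s _. cc s) = {w \<in> turned_profiles. w False (m False) = c}"
  proof -
    have "(\<forall>s. (\<forall>r\<in>{m s..m s}. w s r = cc s) \<and> w s (m s - 1) \<le> cc s) \<longleftrightarrow> w False (m False) = c"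
      if w: "w \<in> turned_profiles" for w
    proof -
      have mon: "w s (m s - 1) \<le> w s (m s)" for s
        using monoD[OF profile_mono[OF w, of s], of "m s - 1" "m s"] by simp
      have "w True (m True) = across False (w False (m False))"
        using profiles_bounds(7)[OF w, of False] by simp
      then have "w False (m False) = c \<longleftrightarrow> (\<forall>s. w s (m s) = cc s)"
        unfolding all_bool_eq by (auto simp: cc_def)
      then show ?thesis using mon by (metis atLeastAtMost_singleton singletonD singletonI)
    qed
    then show ?thesis unfolding tail_class_def by blast
  qed
  have S: "(\<Sum>w\<in>tail_class m cc (\<lambda>s _. cc s). weight w) =
    test_polynomial holds UNIV (profiles (cc False) (m False - 1) (k False) (h False)) *
    test_polynomial holds UNIV (profiles (cc True) (m True - 1) (k True) (h True)) * monom 1 1"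
  proof (rule sum_weight_tail_class_moves[where ?S0.0 = "{(False, Vertical (m False) c)}" and mv = "\<lambda>_ s. (m s, 1)"])
    show "legal_move m cc (\<lambda>s _. cc s) (\<lambda>s. (m s, 1))"
    proof -
      have "legal_step s (m s) (cc s) (\<lambda>_. cc s) (m s) 1" for s
        using cc[of s] by (simp add: legal_step_def)
      then show ?thesis by (simp add: legal_move_def last_shift_def)
    qed
  qed (use tail cl in \<open>auto simp: cc_def turned_bonds_def bonds_def holds_on_def\<close>)
  have E: "test_polynomial holds UNIV (profiles (cc s) (m s - 1) (k s) (h s)) = capped s (cc s) (m s - 1)" for s
    by (rule capped_eq_test_polynomial[OF tail]) (use h_pred_le[of "m s" s] cc(1)[of s] in simp)
  show ?thesis using S unfolding E cl by (simp add: cc_def)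
qed

lemma l_le_K: "l s \<le> K s" and K_pos: "1 \<le> K s"
  using h_pos[of "m s" s] h_le_k[of "m s" s] m_pos[of s] by auto

lemma h_le_K: "1 \<le> r \<Longrightarrow> r \<le> m s \<Longrightarrow> h s r \<le> K s"
  using h_mono[of r "m s" s] l_le_K[of s] by simp

definition top_profiles :: "(bool \<Rightarrow> nat \<Rightarrow> int) set" where
  "top_profiles = {w \<in> turned_profiles. \<forall>s. w s (m s) = K s}"

lemma top_sub: "w \<in> top_profiles \<Longrightarrow> w \<in> turned_profiles"
  by (simp add: top_profiles_def)

lemma top_iff: "w \<in> turned_profiles \<Longrightarrow> w \<in> top_profiles \<longleftrightarrow> w s (m s) = K s"
proof -
  assume w: "w \<in> turned_profiles"
  have "w t (m t) = K t" if "w s (m s) = K s" for t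
    using profile_at_K[OF w, of s] that by (cases "t = s") auto
  then show ?thesis using w by (auto simp: top_profiles_def)
qed

lemma profile_stays_K:
  assumes w: "w \<in> turned_profiles" and "w s i = K s" "i \<le> m s"
  shows "w \<in> top_profiles" and "i \<le> r \<Longrightarrow> r \<le> m s \<Longrightarrow> w s r = K s"
proof -
  show *: "w s r = K s" if "i \<le> r" "r \<le> m s" for r
    using profiles_bounds(2)[OF w that(1), of s] profile_le_K[OF w that(2)] assms(2) by simp
  show "w \<in> top_profiles" using *[of "m s"] top_iff[OF w, of s] assms(3) by simp
qed

lemma column_top: "1 \<le> i \<Longrightarrow> K s \<le> k s i \<Longrightarrow> i \<le> r \<Longrightarrow> r \<le> m s \<Longrightarrow> k s r = K s"
  using k_mono[of i r s] k_mono[of r "m s" s] by simp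

lemma valid_tail_column:
  assumes "1 \<le> i" "i \<le> m s" "K s \<le> k s i"
  shows "valid_tail s i (K s - 1) (\<lambda>_. K s)"
proof -
  have "h s r - 1 \<le> K s \<and> K s \<le> k s r" if "r \<in> {i..m s}" for r
    using h_le_K[of r s] column_top[of i s r] assms that by simp
  then show ?thesis using assms K_pos[of s] by (simp add: valid_tail_def)
qed

lemma capped_column:
  assumes "1 \<le> i" "i \<le> m s" "K s \<le> k s i"
  shows "test_polynomial holds UNIV (profiles (K s - 1) (i - 1) (k s) (h s)) = capped s (K s - 1) (i - 1)"
  by (rule capped_eq_test_polynomial[OF valid_tail_column[OF assms]])
     (use h_pred_le[of i s] h_le_K[of i s] assms in simp)

lemma corner_class_eq:
  assumes "\<And>s. 1 \<le> i s" "\<And>s. i s \<le> m s"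
  shows "tail_class i (\<lambda>s. K s - 1) (\<lambda>s _. K s) =
    {w \<in> turned_profiles. \<forall>s. w s (i s) = K s \<and> w s (i s - 1) \<le> K s - 1}"
proof -
  have "w s r = K s" if "w \<in> turned_profiles" "w s (i s) = K s" "i s \<le> r" "r \<le> m s" for w s r
    using profile_stays_K(2)[OF that(1,2) assms(2) that(3,4)] .
  then show ?thesis unfolding tail_class_def using assms by auto
qed

text \<open>If half \<open>s\<close> cannot have a column of height two, then the single test \<open>Inner (i - 1) (K - 1)\<close> at the
  top of the column in the other half fixes everything: it says \<open>v (i - 1) < K \<le> v i\<close>, which puts the shared row at \<open>K\<close>. A vertical edge at \<open>i\<close>
  would not bound \<open>v (i - 1)\<close>. For the lower bound both columns are lowered together, since the shared row cannot
  be lowered while the next row of a longer column stays at \<open>K\<close>.\<close>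

lemma sum_corner_class_narrow:
  assumes i: "\<And>s. 1 \<le> i s" "\<And>s. i s \<le> m s" "\<And>s. K s \<le> k s (i s)"
    and s: "i s = m s" "k s (m s - 1) < K s" "2 \<le> m s"
  shows "(\<Sum>w\<in>{w \<in> turned_profiles. \<forall>s. w s (i s) = K s \<and> w s (i s - 1) \<le> K s - 1}. weight w) =
    capped False (K False - 1) (i False - 1) * capped True (K True - 1) (i True - 1) * monom 1 1"
proof -
  let ?c = "\<lambda>s. K s - 1" and ?u = "\<lambda>s (_::nat). K s"
  have hr: "h s r \<le> K s" if "1 \<le> r" "r \<le> m s" for r s using h_le_K that .
  have kr: "k s r = K s" if "i s \<le> r" "r \<le> m s" for s r using column_top[OF i(1,3)] that .
  have tail: "valid_tail s (i s) (?c s) (?u s)" for s by (rule valid_tail_column[OF i])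
  have const: "w s r = K s" if "w \<in> turned_profiles" "w s (i s) = K s" "i s \<le> r" "r \<le> m s" for w s r
    using profile_stays_K(2)[OF that(1,2) i(2) that(3,4)] .
  note cl = corner_class_eq[OF i(1,2)]
  \<comment> \<open>Both columns are lowered, including the shared row.\<close>
  let ?N = "\<lambda>t w s r. if i s \<le> r then w s r - 1 else w s r"
  have S: "(\<Sum>w\<in>tail_class i ?c ?u. weight w) =
    test_polynomial holds UNIV (profiles (?c False) (i False - 1) (k False) (h False)) *
    test_polynomial holds UNIV (profiles (?c True) (i True - 1) (k True) (h True)) * monom 1 1"
  proof (rule sum_weight_tail_class[where ?S0.0 = "{(\<not> s, Inner (i (\<not> s) - 1) (K (\<not> s) - 1))}" and N = ?N])
    show "K True = across False (K False)" using across_k[of False] by simp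
    show "{(\<not> s, Inner (i (\<not> s) - 1) (K (\<not> s) - 1))} \<subseteq> turned_bonds"
      using i(1,2)[of "\<not> s"] by (auto simp: turned_bonds_def bonds_def)
    show "holds_on e w" if "w \<in> tail_class i ?c ?u" "e \<in> {(\<not> s, Inner (i (\<not> s) - 1) (K (\<not> s) - 1))}" for w e
      using that i(1)[of "\<not> s"] unfolding cl by (auto simp: holds_on_def)
    show "w \<in> tail_class i ?c ?u"
      if w: "w \<in> turned_profiles" and "\<forall>e\<in>{(\<not> s, Inner (i (\<not> s) - 1) (K (\<not> s) - 1))}. holds_on e w" for w
    proof -
      have a: "w (\<not> s) (i (\<not> s) - 1) \<le> K (\<not> s) - 1" "K (\<not> s) \<le> w (\<not> s) (i (\<not> s))"
        using that(2) i(1)[of "\<not> s"] by (auto simp: holds_on_def)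
      then have b: "w (\<not> s) (i (\<not> s)) = K (\<not> s)" using profile_le_K[OF w i(2)[of "\<not> s"]] by simp
      then have "w (\<not> s) (m (\<not> s)) = K (\<not> s)" using const[OF w b] i(2) by blast
      then have "w s (m s) = K s" using profile_at_K[OF w] by blast
      moreover have "w s (m s - 1) \<le> K s - 1"
      proof -
        have "1 \<le> m s - 1" using s(3) by simp
        then show ?thesis using profiles_bounds(4)[OF w, of "m s - 1" s] s(2) by simp
      qed
      ultimately have "w t (i t) = K t \<and> w t (i t - 1) \<le> K t - 1" for t
        using a b s by (cases "t = s") auto
      then show ?thesis unfolding cl using w by blast
    qed
    fix w t assume "w \<in> tail_class i ?c ?u"
    then have w: "w \<in> turned_profiles" and wi: "\<And>s. w s (i s) = K s" "\<And>s. w s (i s - 1) \<le> K s - 1"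
      unfolding cl by auto
    have ge: "w s r = K s" if "i s \<le> r" for s r
      using const[OF w wi(1)] profiles_bounds(8)[OF w, of s r] that i(2)[of s] by (cases "r \<le> m s") auto
    have "?N t w s \<in> profiles (?N t w s (m s)) (m s) (k s) (h s)" for s
    proof -
      have "?N t w s r \<le> ?N t w s (Suc r)" for r
      proof -
        consider "Suc r < i s" | "Suc r = i s" "r = i s - 1" | "i s \<le> r" by linarith
        then show ?thesis using profiles_bounds(2)[OF w, of r "Suc r" s] wi[of s] by cases auto
      qed
      then have "mono (?N t w s)" by (rule incseq_SucI)
      moreover have "h s r - 1 \<le> ?N t w s r \<and> ?N t w s r \<le> k s r" if "r \<in> {1..m s}" for r
        using that profiles_bounds(3,4)[OF w, of r s] ge[of s r] hr[of r s] kr[of s r] by auto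
      ultimately show ?thesis
        using profiles_bounds(1)[OF w, of s] i(1,2)[of s] ge[of s] by (auto simp: profiles_def)
    qed
    moreover have "?N t w (\<not> s) (m (\<not> s)) = across s (?N t w s (m s))" for s
      using profiles_bounds(7)[OF w, of s] i(2) by (simp add: across_def)
    moreover have "?N t w \<noteq> w"
    proof
      assume "?N t w = w"
      from fun_cong[OF fun_cong[OF this, of True], of "i True"] show False by simp
    qed
    ultimately show "?N t w \<in> turned_profiles \<and> ?N t w \<noteq> w" by (simp add: turned_profiles_def)
    fix s b assume b: "b \<in> free_bonds (i s) (?c s)"
    show "(s, b) \<notin> lost holds_on turned_bonds w (?N t w)"
      using b ge[of s] wi[of s] by (cases b) (auto simp: free_bonds_def lost_def holds_on_def)
  qed (use tail in auto)
  show ?thesis using S unfolding capped_column[OF i] cl .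
qed


text \<open>The topmost row of a column of height at least two can be lowered alone, so the other
  half is left free, including its own column.\<close>

lemma sum_one_column_class:
  assumes i: "1 \<le> i" "i < m s" "K s \<le> k s i"
  shows "(\<Sum>w\<in>{w \<in> turned_profiles. w s i = K s \<and> w s (i - 1) \<le> K s - 1}. weight w) =
    capped s (K s - 1) (i - 1) * capped (\<not> s) (K (\<not> s)) (m (\<not> s) - 1) * monom 1 1"
proof -
  define ii where "ii t = (if t = s then i else m t)" for t
  define cc where "cc t = (if t = s then K s - 1 else K t)" for t
  have tail: "valid_tail t (ii t) (cc t) (\<lambda>_. K t)" for t
  proof (cases "t = s")
    case True
    then show ?thesis using valid_tail_column[of i s] i by (simp add: ii_def cc_def)
  next
    case False
    then show ?thesis using m_pos[of t] l_le_K[of t] K_pos[of t] by (simp add: valid_tail_def ii_def cc_def)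
  qed
  have const: "w s r = K s" if "w \<in> turned_profiles" "w s i = K s" "i \<le> r" "r \<le> m s" for w r
    using profile_stays_K(2)[OF that(1,2) _ that(3,4)] i(2) by simp
  have cl: "tail_class ii cc (\<lambda>t _. K t) = {w \<in> turned_profiles. w s i = K s \<and> w s (i - 1) \<le> K s - 1}"
  proof -
    have "(\<forall>t. (\<forall>r\<in>{ii t..m t}. w t r = K t) \<and> w t (ii t - 1) \<le> cc t) \<longleftrightarrow> w s i = K s \<and> w s (i - 1) \<le> K s - 1"
      if w: "w \<in> turned_profiles" for w
    proof
      assume "\<forall>t. (\<forall>r\<in>{ii t..m t}. w t r = K t) \<and> w t (ii t - 1) \<le> cc t"
      from spec[OF this, of s] show "w s i = K s \<and> w s (i - 1) \<le> K s - 1"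
        using i by (simp add: ii_def cc_def)
    next
      assume *: "w s i = K s \<and> w s (i - 1) \<le> K s - 1"
      then have "w s (m s) = K s" using const[OF w] i by simp
      then have "w (\<not> s) (m (\<not> s)) = K (\<not> s)" using profile_at_K[OF w] by blast
      moreover have "w (\<not> s) (m (\<not> s) - 1) \<le> K (\<not> s)" using profile_le_K[OF w] by simp
      ultimately have "(\<forall>r\<in>{ii t..m t}. w t r = K t) \<and> w t (ii t - 1) \<le> cc t" for t
        using * const[OF w] by (cases "t = s") (auto simp: ii_def cc_def)
      then show "\<forall>t. (\<forall>r\<in>{ii t..m t}. w t r = K t) \<and> w t (ii t - 1) \<le> cc t" by blast
    qed
    then show ?thesis unfolding tail_class_def by blast
  qed
  have S: "(\<Sum>w\<in>tail_class ii cc (\<lambda>t _. K t). weight w) =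
    test_polynomial holds UNIV (profiles (cc False) (ii False - 1) (k False) (h False)) *
    test_polynomial holds UNIV (profiles (cc True) (ii True - 1) (k True) (h True)) * monom 1 1"
  proof (rule sum_weight_tail_class_moves[where ?S0.0 = "{(s, Inner (i - 1) (K s - 1))}"
        and mv = "\<lambda>_ t. if t = s then (i, - 1) else (0, 0)"])
    show "K True = across False (K False)" using across_k[of False] by simp
    show "legal_move ii cc (\<lambda>t _. K t) (\<lambda>t. if t = s then (i, - 1) else (0, 0))"
    proof -
      have "legal_step s (ii s) (cc s) (\<lambda>_. K s) i (- 1)"
        using i h_mono[of i "m s" s] l_le_K[of s] by (auto simp: legal_step_def ii_def cc_def)
      moreover have "last_shift (\<lambda>t. if t = s then (i, - 1) else (0, 0)) t = 0" for t
        using i m_pos[of t] by (simp add: last_shift_def)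
      ultimately show ?thesis by (auto simp: legal_move_def)
    qed
    show "{(s, Inner (i - 1) (K s - 1))} \<subseteq> turned_bonds"
      using i by (auto simp: turned_bonds_def bonds_def)
    show "holds_on e w" if "w \<in> tail_class ii cc (\<lambda>t _. K t)" "e \<in> {(s, Inner (i - 1) (K s - 1))}" for w e
      using that i unfolding cl by (auto simp: holds_on_def)
    show "w \<in> tail_class ii cc (\<lambda>t _. K t)"
      if w: "w \<in> turned_profiles" and e: "\<forall>e\<in>{(s, Inner (i - 1) (K s - 1))}. holds_on e w" for w
      using e i w profile_le_K[OF w, of i s] unfolding cl by (auto simp: holds_on_def)
  qed (use tail in auto)
  have E: "test_polynomial holds UNIV (profiles (cc t) (ii t - 1) (k t) (h t)) = capped t (cc t) (ii t - 1)" for t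
  proof (rule capped_eq_test_polynomial[OF tail])
    show "h t (ii t - 1) - 1 \<le> cc t" if "1 < ii t"
    proof -
      have "1 \<le> ii t - 1" "ii t - 1 \<le> m t" using that i by (auto simp: ii_def)
      from h_le_K[OF this] show ?thesis by (auto simp: cc_def)
    qed
  qed
  show ?thesis using S unfolding E cl by (cases s) (simp_all add: ii_def cc_def mult.commute)
qed

text \<open>Each column has its own test at its top, and its own hexagon to rotate there.\<close>

lemma sum_two_column_class:
  assumes i: "\<And>s. 1 \<le> i s" "\<And>s. i s < m s" "\<And>s. K s \<le> k s (i s)"
  shows "(\<Sum>w\<in>{w \<in> turned_profiles. \<forall>s. w s (i s) = K s \<and> w s (i s - 1) \<le> K s - 1}. weight w) =
    capped False (K False - 1) (i False - 1) * capped True (K True - 1) (i True - 1) * monom 1 2"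
proof -
  let ?c = "\<lambda>s. K s - 1" and ?u = "\<lambda>s (_::nat). K s"
  have le: "i s \<le> m s" for s using i(2)[of s] by simp
  have tail: "valid_tail s (i s) (?c s) (?u s)" for s by (rule valid_tail_column[OF i(1) le i(3)])
  note cl = corner_class_eq[OF i(1) le]
  let ?S = "{(s, Inner (i s - 1) (K s - 1)) | s. True}"
  have S: "?S = {(False, Inner (i False - 1) (K False - 1)), (True, Inner (i True - 1) (K True - 1))}"
  proof (rule set_eqI)
    fix e show "e \<in> ?S \<longleftrightarrow> e \<in> {(False, Inner (i False - 1) (K False - 1)), (True, Inner (i True - 1) (K True - 1))}"
      by (cases e; cases "fst e") auto
  qed
  have S: "(\<Sum>w\<in>tail_class i ?c ?u. weight w) =
    test_polynomial holds UNIV (profiles (?c False) (i False - 1) (k False) (h False)) *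
    test_polynomial holds UNIV (profiles (?c True) (i True - 1) (k True) (h True)) * monom 1 2"
  proof (rule sum_weight_tail_class_moves[where ?S0.0 = ?S
        and mv = "\<lambda>t s. if s = (t = 1) then (i s, - 1) else (0, 0)"])
    show "K True = across False (K False)" using across_k[of False] by simp
    show "finite ?S" "card ?S \<le> 2" unfolding S by auto
    show "?S \<subseteq> turned_bonds" using i(1,2) unfolding turned_bonds_def bonds_def by (auto simp: Suc_le_eq less_imp_diff_less)
    show "holds_on e w" if cw: "w \<in> tail_class i ?c ?u" and eS: "e \<in> ?S" for w e
    proof -
      obtain s where "e = (s, Inner (i s - 1) (K s - 1))" using eS by blast
      then show ?thesis using cw i(1)[of s] unfolding cl by (simp add: holds_on_def)
    qed
    show "w \<in> tail_class i ?c ?u" if w: "w \<in> turned_profiles" and e: "\<forall>e\<in>?S. holds_on e w" for w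
    proof -
      have "w s (i s) = K s \<and> w s (i s - 1) \<le> K s - 1" for s
      proof -
        have "holds_on (s, Inner (i s - 1) (K s - 1)) w" using e by blast
        then show ?thesis using i(1,2)[of s] profile_le_K[OF w, of "i s" s] by (simp add: holds_on_def)
      qed
      then show ?thesis unfolding cl using w by blast
    qed
    show "legal_move i ?c ?u (\<lambda>s. if s = (t = 1) then (i s, - 1) else (0, 0))" for t
    proof -
      have "legal_step s (i s) (?c s) (?u s) (i s) (- 1)" for s
        using i(1,2,3)[of s] h_mono[of "i s" "m s" s] l_le_K[of s] by (auto simp: legal_step_def)
      moreover have "last_shift (\<lambda>s. if s = (t = 1) then (i s, - 1) else (0, 0)) s = 0" for s
      proof -
        have "i s \<noteq> m s" "0 \<noteq> m s" for s using i(2)[of s] m_pos[of s] by auto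
        then show ?thesis by (simp add: last_shift_def)
      qed
      ultimately show ?thesis by (auto simp: legal_move_def)
    qed
    show "independent_steps (?u s) (if s = (t = 1) then (i s, - 1) else (0, 0)) (if s = (t' = 1) then (i s, - 1) else (0, 0))"
      if "t < t'" "t' < 2" for t t' :: nat and s
      using that by (cases s) (auto simp: independent_steps_def)
  qed (rule tail)
  show ?thesis using S unfolding capped_column[OF i(1) le i(3)] cl .
qed

end

section \<open>Classes with a staircase at the corner\<close>

context turned_system
begin

text \<open>The staircase \<open>v (m - t) = K - t\<close>.\<close>

definition slope :: "bool \<Rightarrow> nat \<Rightarrow> int" where
  "slope s r = K s - (int (m s) - int r)"

lemma slope_Suc: "slope s (Suc r) = slope s r + 1" and slope_m[simp]: "slope s (m s) = K s"
  by (auto simp: slope_def)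

lemma slope_pred: "1 \<le> r \<Longrightarrow> slope s (r - 1) = slope s r - 1"
  by (auto simp: slope_def)

lemma last_row_of_penultimate:
  assumes w: "w \<in> turned_profiles" and "holds_on (s, Inner (m s - 1) (K s - 1)) w"
  shows "w s (m s) = K s" "w s (m s - 1) \<le> K s - 1"
  using assms(2) profile_le_K[OF w, of "m s" s] m_pos[of s] by (auto simp: holds_on_def)

text \<open>The staircase occupies the rows below \<open>a\<close>. Vertical edges fix these rows and row \<open>a\<close>, and the inner bond of the other
  half fixes the shared row together with the bound in that half. All steps of the staircase can be lowered; row \<open>a\<close> is
  raised if the staircase ends there with a drop (\<open>\<delta> = 1\<close>), and lowered if the bound \<open>c\<close> leaves room
  for that (\<open>\<delta> = - 1\<close>), as it does when row \<open>a\<close> itself is the last step.\<close>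

lemma sum_staircase_class:
  fixes c \<delta> :: int and u :: "nat \<Rightarrow> int"
  assumes a: "1 \<le> a" "a < m s"
    and u: "\<And>r. a < r \<Longrightarrow> r \<le> m s \<Longrightarrow> u r = slope s r"
    and cell: "\<And>r. a < r \<Longrightarrow> r \<le> m s \<Longrightarrow> h s r \<le> slope s r \<and> slope s r \<le> k s r"
    and first: "0 \<le> c" "c \<le> u a" "h s a - 1 \<le> u a" "u a \<le> k s a" "u a \<le> slope s a"
      "1 < a \<Longrightarrow> h s (a - 1) - 1 \<le> c"
    and \<delta>: "\<delta> = 1 \<and> u a + 2 \<le> slope s (Suc a) \<and> u a + 1 \<le> k s a \<or>
      \<delta> = - 1 \<and> c \<le> u a - 1 \<and> h s a \<le> u a"
    and cap: "\<And>w. w \<in> turned_profiles \<Longrightarrow> w s a = u a \<Longrightarrow> w s (a - 1) \<le> c"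
  shows "(\<Sum>w\<in>{w \<in> turned_profiles. (\<forall>r\<in>{a..m s}. w s r = u r) \<and> w (\<not> s) (m (\<not> s) - 1) \<le> K (\<not> s) - 1}. weight w) =
    capped s c (a - 1) * capped (\<not> s) (K (\<not> s) - 1) (m (\<not> s) - 1) * monom 1 (m s - a + 1)"
proof -
  define ii where "ii t = (if t = s then a else m t)" for t
  define cc where "cc t = (if t = s then c else K t - 1)" for t
  define uu where "uu t = (if t = s then u else (\<lambda>_. K t))" for t
  \<comment> \<open>Move \<open>q\<close> changes row \<open>a + q\<close>; the last one is a move of the shared row.\<close>
  define mv where "mv q t = (if t = s then (a + q, if q = 0 then \<delta> else - 1)
      else if a + q = m s then (m t, - 1) else (0, 0))" for q t
  define S where "S = (\<lambda>r. (s, Vertical r (u r))) ` {a..<m s} \<union> {(\<not> s, Inner (m (\<not> s) - 1) (K (\<not> s) - 1))}"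
  have um: "u (m s) = K s" using u[of "m s"] a by simp
  have tail: "valid_tail t (ii t) (cc t) (uu t)" for t
  proof (cases "t = s")
    case True
    have "h s r - 1 \<le> u r \<and> u r \<le> k s r" if "r \<in> {a..m s}" for r
      using first cell[of r] u[of r] that by (cases "r = a") auto
    moreover have "u r \<le> u (Suc r)" if "r \<in> {a..<m s}" for r
      using first(5) u[of r] u[of "Suc r"] that slope_Suc[of s r] by (cases "r = a") auto
    ultimately show ?thesis using True a first by (simp add: valid_tail_def ii_def cc_def uu_def)
  next
    case False
    then show ?thesis using m_pos[of t] l_le_K[of t] K_pos[of t] by (simp add: valid_tail_def ii_def cc_def uu_def)
  qed
  have cl: "tail_class ii cc uu = {w \<in> turned_profiles. (\<forall>r\<in>{a..m s}. w s r = u r) \<and> w (\<not> s) (m (\<not> s) - 1) \<le> K (\<not> s) - 1}"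
  proof -
    have "(\<forall>t. (\<forall>r\<in>{ii t..m t}. w t r = uu t r) \<and> w t (ii t - 1) \<le> cc t) \<longleftrightarrow>
       (\<forall>r\<in>{a..m s}. w s r = u r) \<and> w (\<not> s) (m (\<not> s) - 1) \<le> K (\<not> s) - 1"
      if w: "w \<in> turned_profiles" for w
    proof
      assume *: "\<forall>t. (\<forall>r\<in>{ii t..m t}. w t r = uu t r) \<and> w t (ii t - 1) \<le> cc t"
      show "(\<forall>r\<in>{a..m s}. w s r = u r) \<and> w (\<not> s) (m (\<not> s) - 1) \<le> K (\<not> s) - 1"
        using spec[OF *, of s] spec[OF *, of "\<not> s"] by (simp add: ii_def cc_def uu_def)
    next
      assume *: "(\<forall>r\<in>{a..m s}. w s r = u r) \<and> w (\<not> s) (m (\<not> s) - 1) \<le> K (\<not> s) - 1"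
      then have "w s (m s) = K s" "w s a = u a" using um a by auto
      then have "w (\<not> s) (m (\<not> s)) = K (\<not> s)" "w s (a - 1) \<le> c"
        using profile_at_K[OF w] cap[OF w] by blast+
      then have "(\<forall>r\<in>{ii t..m t}. w t r = uu t r) \<and> w t (ii t - 1) \<le> cc t" for t
        using * by (cases "t = s") (auto simp: ii_def cc_def uu_def)
      then show "\<forall>t. (\<forall>r\<in>{ii t..m t}. w t r = uu t r) \<and> w t (ii t - 1) \<le> cc t" by blast
    qed
    then show ?thesis unfolding tail_class_def by blast
  qed
  have S: "(\<Sum>w\<in>tail_class ii cc uu. weight w) =
    test_polynomial holds UNIV (profiles (cc False) (ii False - 1) (k False) (h False)) *
    test_polynomial holds UNIV (profiles (cc True) (ii True - 1) (k True) (h True)) * monom 1 (m s - a + 1)"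
  proof (rule sum_weight_tail_class_moves[where ?S0.0 = S and mv = mv])
    show "uu True (m True) = across False (uu False (m False))"
      using across_k[of False] um by (cases s) (auto simp: uu_def)
    show "finite S" by (simp add: S_def)
    have "card S \<le> card ((\<lambda>r. (s, Vertical r (u r))) ` {a..<m s}) + 1"
      unfolding S_def by (rule order.trans[OF card_Un_le]) simp
    also have "\<dots> \<le> m s - a + 1" using card_image_le[of "{a..<m s}" "\<lambda>r. (s, Vertical r (u r))"] by simp
    finally show "card S \<le> m s - a + 1" .
    show "S \<subseteq> turned_bonds" using m_pos[of "\<not> s"] by (auto simp: S_def turned_bonds_def bonds_def)
    show "holds_on e w" if cw: "w \<in> tail_class ii cc uu" and eS: "e \<in> S" for w e
    proof -
      have w: "w \<in> turned_profiles" and *: "\<forall>r\<in>{a..m s}. w s r = u r" "w (\<not> s) (m (\<not> s) - 1) \<le> K (\<not> s) - 1"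
        using cw unfolding cl by auto
      then have "w (\<not> s) (m (\<not> s)) = K (\<not> s)" using profile_at_K[OF w, of s] um a by simp
      then show ?thesis using eS * m_pos[of "\<not> s"] by (auto simp: S_def holds_on_def)
    qed
    show "w \<in> tail_class ii cc uu" if w: "w \<in> turned_profiles" and e: "\<forall>e\<in>S. holds_on e w" for w
    proof -
      have o: "holds_on (\<not> s, Inner (m (\<not> s) - 1) (K (\<not> s) - 1)) w" using e by (simp add: S_def)
      have "w s r = u r" if "r \<in> {a..m s}" for r
      proof (cases "r = m s")
        case True
        then show ?thesis using last_row_of_penultimate[OF w o] profile_at_K[OF w, of s] um by simp
      next
        case False
        then have "(s, Vertical r (u r)) \<in> S" using that by (auto simp: S_def)
        then show ?thesis using e by (auto simp: holds_on_def)
      qed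
      then show ?thesis unfolding cl using w last_row_of_penultimate[OF w o] by blast
    qed
    show "legal_move ii cc uu (mv q)" if q: "q < m s - a + 1" for q
    proof -
      have "legal_step s a c u (a + q) (if q = 0 then \<delta> else - 1)"
      proof (cases "q = 0")
        case True
        have "u (Suc a) = slope s (Suc a)" using u[of "Suc a"] a by simp
        then show ?thesis using True a first \<delta> slope_Suc[of s a] by (auto simp: legal_step_def)
      next
        case False
        have r: "a < a + q" "a + q \<le> m s" using q False by auto
        have "u (a + q - 1) \<le> slope s (a + q - 1)" "slope s (a + q - 1) = slope s (a + q) - 1"
          using first(5) u[of "a + q - 1"] r slope_pred[of "a + q" s] by (cases "q = 1"; simp)+
        moreover have "a + q < m s \<Longrightarrow> slope s (a + q) - 1 \<le> u (Suc (a + q))"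
          using u[of "Suc (a + q)"] slope_Suc[of s "a + q"] by simp
        ultimately show ?thesis using False cell[OF r] u[OF r] r(2) by (auto simp: legal_step_def)
      qed
      moreover have "legal_step (\<not> s) (m (\<not> s)) (K (\<not> s) - 1) (\<lambda>_. K (\<not> s)) (m (\<not> s)) (- 1)"
        using l_le_K[of "\<not> s"] by (simp add: legal_step_def)
      ultimately have "snd (mv q t) = 0 \<or> legal_step t (ii t) (cc t) (uu t) (fst (mv q t)) (snd (mv q t))" for t
        by (cases "t = s") (auto simp: mv_def ii_def cc_def uu_def)
      moreover have "last_shift (mv q) False = last_shift (mv q) True"
        using a m_pos[of "\<not> s"] by (cases s) (auto simp: last_shift_def mv_def)
      moreover have "snd (mv q s) \<noteq> 0" using \<delta> by (auto simp: mv_def)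
      ultimately show ?thesis unfolding legal_move_def by blast
    qed
    show "independent_steps (uu t) (mv q t) (mv q' t)" if "q < q'" "q' < m s - a + 1" for q q' t
    proof (cases "t = s")
      case True
      have "u (Suc a) = slope s (Suc a)" using u[of "Suc a"] a by simp
      then show ?thesis using that True \<delta> by (auto simp: independent_steps_def mv_def uu_def)
    next
      case False
      then show ?thesis using that by (auto simp: independent_steps_def mv_def)
    qed
  qed (rule tail)
  have E: "test_polynomial holds UNIV (profiles (cc t) (ii t - 1) (k t) (h t)) = capped t (cc t) (ii t - 1)" for t
    by (rule capped_eq_test_polynomial[OF tail])
       (use first(6) h_pred_le[of "m t" t] l_le_K[of t] in \<open>auto simp: ii_def cc_def split: if_splits\<close>)
  show ?thesis using S unfolding E cl by (cases s) (simp_all add: ii_def cc_def mult.commute)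
qed

lemma valid_tail_two_rows:
  assumes "2 \<le> m t" "h t (m t - 1) - 1 \<le> j" "j \<le> K t - 1" "K t \<le> k t (m t - 1)"
  shows "valid_tail t (m t - 1) j (\<lambda>r. if r = m t - 1 then j else K t)"
proof -
  have "0 \<le> j" using h_pos[of "m t - 1" t] assms by fastforce
  moreover have "{m t - Suc 0..m t} = {m t - Suc 0, m t}" "{m t - Suc 0..<m t} = {m t - Suc 0}"
    using m_pos[of t] by auto
  moreover have "m t \<noteq> m t - Suc 0" "Suc 0 \<le> m t - Suc 0" using assms(1) by auto
  ultimately show ?thesis using assms l_le_K[of t] by (simp add: valid_tail_def)
qed

text \<open>The staircase meets a column of rows \<open>i\<close> to \<open>b\<close>, or, for \<open>i = b\<close>, row \<open>b\<close> is at its least possible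
  value. Here the inner bonds along the staircase are used: each one bounds one step from above and the next from below, so that
  \<open>m - b\<close> of them fix the staircase once \<open>v b\<close> is bounded from below. The steps are raised instead of lowered. This leaves the shared row
  alone, so that in the other half the row next to it, whose value \<open>j\<close> is fixed by one more test, can be raised too.\<close>

lemma sum_staircase_column_class:
  fixes c j :: int and u :: "nat \<Rightarrow> int"
  assumes b: "b < m s"
    and u: "\<And>r. b \<le> r \<Longrightarrow> r \<le> m s \<Longrightarrow> u r = slope s r" "\<And>r. i \<le> r \<Longrightarrow> r \<le> b \<Longrightarrow> u r = slope s b"
    and i: "1 \<le> i" "i \<le> b" 
    and cell: "\<And>r. b \<le> r \<Longrightarrow> r < m s \<Longrightarrow> h s r - 1 \<le> slope s r \<and> slope s r + 1 \<le> k s r"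
    and col: "slope s b \<le> k s i" 
    and c: "0 \<le> c" "i < b \<and> h s b \<le> slope s b \<and> c = slope s b - 1 \<or> i = b \<and> h s b - 1 = slope s b \<and> c = slope s b"
       "1 < i \<Longrightarrow> h s (i - 1) - 1 \<le> c"
    and j: "2 \<le> m (\<not> s)" "h (\<not> s) (m (\<not> s) - 1) - 1 \<le> j" "j \<le> K (\<not> s) - 1" "K (\<not> s) \<le> k (\<not> s) (m (\<not> s) - 1)"
  shows "(\<Sum>w\<in>{w \<in> turned_profiles. (\<forall>r\<in>{i..m s}. w s r = u r) \<and> w s (i - 1) \<le> c \<and> w (\<not> s) (m (\<not> s) - 1) = j}. weight w) =
    capped s c (i - 1) * capped (\<not> s) j (m (\<not> s) - 2) * monom 1 (m s - b + 1 + (if i < b then 1 else 0))"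
proof -
  define n where "n = m s - b + 1 + (if i < b then 1 else 0)"
  define ii where "ii t = (if t = s then i else m t - 1)" for t
  define cc where "cc t = (if t = s then c else j)" for t
  define uu where "uu t = (if t = s then u else (\<lambda>r. if r = m t - 1 then j else K t))" for t
  \<comment> \<open>Move 0 belongs to the other half, the moves up to \<open>m s - b\<close> raise the staircase, and the
    number \<open>m s - b + 1\<close> occurs only if there is a column, whose top it lowers.\<close>
  define mv :: "nat \<Rightarrow> bool \<Rightarrow> nat \<times> int"
    where "mv q t = (if q = 0 then if t = s then (0, 0) else (m t - 1, 1)
      else if t = s then if q = m s - b + 1 then (i, - 1) else (b + q - 1, 1) else (0, 0))" for q t
  define S where "S = (\<lambda>r. (s, Inner r (slope s r))) ` {b..<m s} \<union> {(\<not> s, Vertical (m (\<not> s) - 1) j)} \<union>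
      (if i < b then {(s, Inner (i - 1) (slope s b - 1))} else {})"
  have um: "u (m s) = K s" using u(1)[of "m s"] b by simp
  have hb: "h s r \<le> h s b" if "1 \<le> r" "r \<le> b" for r using h_mono[of r b s] that b by simp
  have ub: "h s r - 1 \<le> u r \<and> u r \<le> k s r" if "i \<le> r" "r \<le> m s" for r
  proof (cases "r < b")
    case True
    then show ?thesis using u(2)[of r] k_mono[of i r s] col hb[of r] i that c(2) by auto
  next
    case False
    then show ?thesis using u(1)[of r] cell[of r] that h_le_K[of "m s" s] l_le_K[of s] by (cases "r = m s") auto
  qed
  have umono: "u r \<le> u (Suc r)" if "i \<le> r" "r < m s" for r
  proof (cases "r < b")
    case True
    then show ?thesis using u(2)[of r] u(2)[of "Suc r"] that by simp
  next
    case False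
    then show ?thesis using u(1)[of r] u(1)[of "Suc r"] that slope_Suc[of s r] by simp
  qed
  have ci: "c \<le> u i" using c(2) u(2)[of i] i by auto
  have tail: "valid_tail t (ii t) (cc t) (uu t)" for t
  proof (cases "t = s")
    case True
    then show ?thesis using ub umono i b c(1) ci by (auto simp: valid_tail_def ii_def cc_def uu_def)
  next
    case False
    then have t: "t = (\<not> s)" by auto
    then show ?thesis
      using False valid_tail_two_rows[of "\<not> s" j] j t by (simp add: ii_def cc_def uu_def)
  qed
  have cl: "tail_class ii cc uu = {w \<in> turned_profiles. (\<forall>r\<in>{i..m s}. w s r = u r) \<and> w s (i - 1) \<le> c \<and> w (\<not> s) (m (\<not> s) - 1) = j}"
  proof -
    have "(\<forall>t. (\<forall>r\<in>{ii t..m t}. w t r = uu t r) \<and> w t (ii t - 1) \<le> cc t) \<longleftrightarrow>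
       (\<forall>r\<in>{i..m s}. w s r = u r) \<and> w s (i - 1) \<le> c \<and> w (\<not> s) (m (\<not> s) - 1) = j"
      if w: "w \<in> turned_profiles" for w
    proof
      assume *: "\<forall>t. (\<forall>r\<in>{ii t..m t}. w t r = uu t r) \<and> w t (ii t - 1) \<le> cc t"
      show "(\<forall>r\<in>{i..m s}. w s r = u r) \<and> w s (i - 1) \<le> c \<and> w (\<not> s) (m (\<not> s) - 1) = j"
        using spec[OF *, of s] spec[OF *, of "\<not> s"] by (simp add: ii_def cc_def uu_def)
    next
      assume *: "(\<forall>r\<in>{i..m s}. w s r = u r) \<and> w s (i - 1) \<le> c \<and> w (\<not> s) (m (\<not> s) - 1) = j"
      then have "w s (m s) = K s" using um i b by auto
      then have wK: "w (\<not> s) (m (\<not> s)) = K (\<not> s)" using profile_at_K[OF w] by blast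
      have "w (\<not> s) (m (\<not> s) - 1 - 1) \<le> w (\<not> s) (m (\<not> s) - 1)"
        using monoD[OF profile_mono[OF w]] by simp
      moreover have "w (\<not> s) r = (if r = m (\<not> s) - 1 then j else K (\<not> s))"
        if "r \<in> {m (\<not> s) - 1..m (\<not> s)}" for r
      proof -
        have "r = m (\<not> s) - 1 \<or> r = m (\<not> s) \<and> r \<noteq> m (\<not> s) - 1" using that j(1) by auto
        then show ?thesis using * wK by auto
      qed
      ultimately have o: "(\<forall>r\<in>{ii (\<not> s)..m (\<not> s)}. w (\<not> s) r = uu (\<not> s) r) \<and> w (\<not> s) (ii (\<not> s) - 1) \<le> cc (\<not> s)"
        using * by (simp add: ii_def cc_def uu_def)
      have "(\<forall>r\<in>{ii t..m t}. w t r = uu t r) \<and> w t (ii t - 1) \<le> cc t" for t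
      proof (cases "t = s")
        case True then show ?thesis using * by (simp add: ii_def cc_def uu_def)
      next
        case False
        then have "t = (\<not> s)" by auto
        then show ?thesis using o by blast
      qed
      then show "\<forall>t. (\<forall>r\<in>{ii t..m t}. w t r = uu t r) \<and> w t (ii t - 1) \<le> cc t" by blast
    qed
    then show ?thesis unfolding tail_class_def by blast
  qed
  have Sm: "(\<Sum>w\<in>tail_class ii cc uu. weight w) =
    test_polynomial holds UNIV (profiles (cc False) (ii False - 1) (k False) (h False)) *
    test_polynomial holds UNIV (profiles (cc True) (ii True - 1) (k True) (h True)) * monom 1 n"
  proof (rule sum_weight_tail_class_moves[where ?S0.0 = S and mv = mv])
    show "uu True (m True) = across False (uu False (m False))"
      using across_k[of False] um j(1) by (cases s) (auto simp: uu_def)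
    show "finite S" by (simp add: S_def)
    have "card S \<le> card ((\<lambda>r. (s, Inner r (slope s r))) ` {b..<m s}) + 1 + (if i < b then 1 else 0)"
      unfolding S_def by (intro order.trans[OF card_Un_le] add_mono) auto
    also have "\<dots> \<le> n" using card_image_le[of "{b..<m s}" "\<lambda>r. (s, Inner r (slope s r))"] by (simp add: n_def)
    finally show "card S \<le> n" .
    show "S \<subseteq> turned_bonds" using i b by (auto simp: S_def turned_bonds_def bonds_def)
    show "holds_on e w" if cw: "w \<in> tail_class ii cc uu" and eS: "e \<in> S" for w e
    proof -
      have w: "\<And>r. i \<le> r \<Longrightarrow> r \<le> m s \<Longrightarrow> w s r = u r" "w s (i - 1) \<le> c" "w (\<not> s) (m (\<not> s) - 1) = j"
        using cw unfolding cl by auto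
      consider r where "e = (s, Inner r (slope s r))" "b \<le> r" "r < m s" | "e = (\<not> s, Vertical (m (\<not> s) - 1) j)"
        | "e = (s, Inner (i - 1) (slope s b - 1))" "i < b" using eS by (auto simp: S_def split: if_splits)
      then show ?thesis
      proof cases
        case 1
        then show ?thesis using w(1)[of r] w(1)[of "Suc r"] u(1)[of r] u(1)[of "Suc r"] i slope_Suc[of s r]
          by (simp add: holds_on_def)
      next
        case 2 then show ?thesis using w(3) by (simp add: holds_on_def)
      next
        case 3 then show ?thesis using w(1)[of i] w(2) u(2)[of i] i b c(2) by (auto simp: holds_on_def)
      qed
    qed
    show "w \<in> tail_class ii cc uu" if w: "w \<in> turned_profiles" and e: "\<forall>e\<in>S. holds_on e w" for w
    proof -
      have In: "w s r \<le> slope s r \<and> slope s r < w s (Suc r)" if "b \<le> r" "r < m s" for r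
      proof -
        have "(s, Inner r (slope s r)) \<in> S" using that by (simp add: S_def)
        then show ?thesis using e by (auto simp: holds_on_def)
      qed
      have eq: "w s r = slope s r" if "b < r" "r \<le> m s" for r
      proof -
        have "slope s (r - 1) < w s r" using In[of "r - 1"] that by simp
        moreover have "w s r \<le> slope s r" using In[of r] profile_le_K[OF w, of "m s" s] that by (cases "r = m s") auto
        ultimately show ?thesis using slope_pred[of r s] that by simp
      qed
      have low: "slope s b \<le> w s i \<and> w s (i - 1) \<le> c"
      proof (cases "i < b")
        case True
        then have "holds_on (s, Inner (i - 1) (slope s b - 1)) w" using e by (simp add: S_def)
        then show ?thesis using i c(2) True by (auto simp: holds_on_def)
      next
        case False
        have "w s (i - 1) \<le> w s b" using monoD[OF profile_mono[OF w]] i by simp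
        then show ?thesis using False c(2) i b profiles_bounds(3)[OF w, of b s] In[of b] by auto
      qed
      have "w s r = u r" if r: "r \<in> {i..m s}" for r
      proof (cases "r \<le> b")
        case True
        have "w s i \<le> w s r" "w s r \<le> w s b" using monoD[OF profile_mono[OF w]] r True by auto
        then show ?thesis using low In[of b] b u(2)[of r] r True by simp
      next
        case False
        then show ?thesis using eq[of r] u(1)[of r] r by simp
      qed
      moreover have "w (\<not> s) (m (\<not> s) - 1) = j" using e by (simp add: S_def holds_on_def)
      ultimately show ?thesis unfolding cl using w low by blast
    qed
    show "legal_move ii cc uu (mv q)" if q: "q < n" for q
    proof -
      have 0: "legal_step (\<not> s) (m (\<not> s) - 1) j (uu (\<not> s)) (m (\<not> s) - 1) 1"
        using j by (auto simp: legal_step_def uu_def)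
      have 1: "legal_step s i c u i (- 1)" if "i < b"
        using that u(2)[of i] u(2)[of "Suc i"] i b c(2) hb[of i] ub[of i] by (auto simp: legal_step_def)
      have 2: "legal_step s i c u (b + q - 1) 1" if q: "q \<noteq> 0" "q \<noteq> m s - b + 1"
      proof -
        define r where "r = b + q - 1"
        have r: "b \<le> r" "r < m s" using q \<open>q < n\<close> by (auto simp: r_def n_def split: if_splits)
        have "(if r = i then c else u (r - 1)) \<le> u r + 1"
        proof (cases "r = i")
          case True then show ?thesis using ci by simp
        next
          case False
          then have "i \<le> r - 1" "r - 1 < m s" "Suc (r - 1) = r" using r i by linarith+
          then show ?thesis using umono[of "r - 1"] False by simp
        qed
        then show ?thesis using cell[OF r] u(1)[of r] u(1)[of "Suc r"] slope_Suc[of s r] r i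
          unfolding r_def[symmetric] by (auto simp: legal_step_def)
      qed
      have "snd (mv q t) = 0 \<or> legal_step t (ii t) (cc t) (uu t) (fst (mv q t)) (snd (mv q t))" for t
      proof (cases "t = s")
        case True
        have "i < b" if "q = m s - b + 1" using that q by (simp add: n_def split: if_splits)
        then show ?thesis using True 1 2 by (auto simp: mv_def ii_def cc_def uu_def)
      next
        case False
        then show ?thesis using 0 by (auto simp: mv_def ii_def cc_def)
      qed
      moreover have "last_shift (mv q) t = 0" for t
      proof -
        have "fst (mv q t) \<noteq> m t"
        proof (cases "t = s")
          case True
          have "b + q - 1 < m s" if "q \<noteq> 0" "q \<noteq> m s - b + 1"
            using that q b by (auto simp: n_def split: if_splits)
          then show ?thesis using True i b m_pos[of s] by (auto simp: mv_def)
        next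
          case False
          then have "t = (\<not> s)" by auto
          then show ?thesis using j(1) by (auto simp: mv_def)
        qed
        then show ?thesis by (simp add: last_shift_def)
      qed
      moreover have "\<exists>t. snd (mv q t) \<noteq> 0"
        by (rule exI[of _ "if q = 0 then \<not> s else s"]) (simp add: mv_def)
      ultimately show ?thesis unfolding legal_move_def by simp
    qed
    show "independent_steps (uu t) (mv q t) (mv q' t)" if q: "q < q'" "q' < n" for q q' t
    proof (cases "t = s")
      case True
      then show ?thesis using q i b by (auto simp: independent_steps_def mv_def n_def split: if_splits)
    next
      case False
      then show ?thesis using q by (auto simp: independent_steps_def mv_def)
    qed
  qed (rule tail)
  have E: "test_polynomial holds UNIV (profiles (cc t) (ii t - 1) (k t) (h t)) = capped t (cc t) (ii t - 1)" for t
  proof (rule capped_eq_test_polynomial[OF tail])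
    show "h t (ii t - 1) - 1 \<le> cc t" if "1 < ii t"
    proof (cases "t = s")
      case True then show ?thesis using that c(3) by (simp add: ii_def cc_def)
    next
      case False
      then have "t = (\<not> s)" by auto
      then show ?thesis using False that h_pred_le[of "m t - 1" t] j(2) by (simp add: ii_def cc_def)
    qed
  qed
  have "m (\<not> s) - 1 - 1 = m (\<not> s) - 2" by simp
  then show ?thesis using Sm unfolding E cl n_def by (cases s) (simp_all add: ii_def cc_def mult.commute)
qed

end

section \<open>Summation over the classes\<close>

context turned_system
begin

abbreviation total :: "(bool \<Rightarrow> nat \<Rightarrow> int) set \<Rightarrow> int poly" where
  "total A \<equiv> (\<Sum>w\<in>A. weight w)"

lemma total_turned_profiles:
  "total turned_profiles = (\<Sum>c = l False - 1..K False - 1.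
     capped False c (m False - 1) * capped True (across False c) (m True - 1) * monom 1 1) + total top_profiles"
proof -
  have fin: "finite turned_profiles" by (rule finite_turned_profiles)
  have img: "(\<lambda>w. w False (m False)) ` turned_profiles \<subseteq> {l False - 1..K False}"
    using profiles_bounds(3,4) m_pos by fastforce
  have "total turned_profiles = (\<Sum>c\<in>{l False - 1..K False}. total {w \<in> turned_profiles. w False (m False) = c})"
    by (rule sum.group[symmetric, OF fin _ img]) simp
  also have "{l False - 1..K False} = insert (K False) {l False - 1..K False - 1}"
    using l_le_K[of False] by auto
  also have "(\<Sum>c\<in>insert (K False) {l False - 1..K False - 1}. total {w \<in> turned_profiles. w False (m False) = c}) =
     total {w \<in> turned_profiles. w False (m False) = K False} +
     (\<Sum>c = l False - 1..K False - 1. total {w \<in> turned_profiles. w False (m False) = c})"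
    by simp
  also have "{w \<in> turned_profiles. w False (m False) = K False} = top_profiles"
    using top_iff[of _ False] top_sub by auto
  also have "(\<Sum>c = l False - 1..K False - 1. total {w \<in> turned_profiles. w False (m False) = c}) =
     (\<Sum>c = l False - 1..K False - 1. capped False c (m False - 1) * capped True (across False c) (m True - 1) * monom 1 1)"
    by (rule sum.cong[OF refl]) (rule sum_last_row_below_K, auto)
  finally show ?thesis by (simp add: add.commute)
qed

definition first_row :: "bool \<Rightarrow> int \<Rightarrow> nat" where
  "first_row s z = (LEAST r. cell_exists (m s) (k s) (h s) r z)"

lemma first_row:
  assumes "1 \<le> b" "b \<le> m s" "h s b \<le> z" "z \<le> k s b"
  shows "1 \<le> first_row s z" "first_row s z \<le> b"
    "first_row s z \<le> r \<Longrightarrow> r \<le> b \<Longrightarrow> z \<le> k s r"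
    "1 \<le> r \<Longrightarrow> r < first_row s z \<Longrightarrow> k s r < z"
proof -
  let ?P = "\<lambda>r. cell_exists (m s) (k s) (h s) r z"
  have P: "?P b" using assms by (simp add: cell_exists_def)
  have f: "?P (first_row s z)" unfolding first_row_def by (rule LeastI[of ?P, OF P])
  show le: "first_row s z \<le> b" unfolding first_row_def by (rule Least_le[of ?P, OF P])
  show "1 \<le> first_row s z" using f by (simp add: cell_exists_def)
  show "z \<le> k s r" if "first_row s z \<le> r" "r \<le> b" for r
    using k_mono[of "first_row s z" r s] f that assms(2) by (auto simp: cell_exists_def)
  show "k s r < z" if "1 \<le> r" "r < first_row s z" for r
  proof -
    have "\<not> ?P r" using not_less_Least[of r ?P] that(2) by (simp add: first_row_def)
    moreover have "h s r \<le> z" using h_mono[of r b s] that le assms by simp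
    ultimately show ?thesis using that le assms(2) by (auto simp: cell_exists_def)
  qed
qed

lemma profile_below_first_row:
  assumes w: "w \<in> turned_profiles" and b: "1 \<le> b" "b \<le> m s" "h s b \<le> z" "z \<le> k s b"
  shows "w s (first_row s z - 1) < z"
proof (cases "first_row s z - 1 = 0")
  case True
  then show ?thesis using profiles_bounds(1)[OF w, of s] h_pos[of b s] b by simp
next
  case False
  then have r: "1 \<le> first_row s z - 1" "first_row s z - 1 < first_row s z" "first_row s z - 1 \<le> m s"
    using first_row(1,2)[OF b] b(2) by linarith+
  show ?thesis using profiles_bounds(4)[OF w r(1,3)] first_row(4)[OF b r(1,2)] by simp
qed

lemma total_by_first_row:
  assumes A: "A \<subseteq> turned_profiles" "\<And>w. w \<in> A \<Longrightarrow> w s b = z"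
    and b: "1 \<le> b" "b \<le> m s" "h s b \<le> z" "z \<le> k s b"
  shows "total A = (\<Sum>i = first_row s z..b. total {w \<in> A. w s i = z \<and> w s (i - 1) \<le> z - 1})"
  by (rule sum_by_first_occurrence[where v = "\<lambda>w. w s"])
     (use A b first_row(1)[OF b] profile_mono profile_below_first_row[OF _ b]
       finite_subset[OF A(1) finite_turned_profiles] in blast)+

lemma top_row: "1 \<le> m s" "m s \<le> m s" "h s (m s) \<le> K s" "K s \<le> k s (m s)"
  using m_pos l_le_K by auto

lemma total_top_by_corners:
  fixes b :: "bool \<Rightarrow> nat"
  assumes b: "\<And>s. 1 \<le> b s" "\<And>s. b s \<le> m s" "\<And>s. k s (b s) = K s"
  shows "total {w \<in> turned_profiles. \<forall>s. w s (b s) = K s} =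
    (\<Sum>i = first_row False (K False)..b False. \<Sum>j = first_row True (K True)..b True.
      total {w \<in> turned_profiles. \<forall>s. w s (if s then j else i) = K s \<and> w s ((if s then j else i) - 1) \<le> K s - 1})" (is "_ = ?rhs")
proof -
  let ?A = "{w \<in> turned_profiles. \<forall>s. w s (b s) = K s}"
  have B: "1 \<le> b s" "b s \<le> m s" "h s (b s) \<le> K s" "K s \<le> k s (b s)" for s
    using b[of s] h_le_K[of "b s" s] by auto
  have "total ?A = (\<Sum>i = first_row False (K False)..b False.
      total {w \<in> ?A. w False i = K False \<and> w False (i - 1) \<le> K False - 1})"
    by (rule total_by_first_row[OF _ _ B]) auto
  also have "\<dots> = (\<Sum>i = first_row False (K False)..b False. \<Sum>j = first_row True (K True)..b True.
      total {w \<in> {w \<in> ?A. w False i = K False \<and> w False (i - 1) \<le> K False - 1}.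
        w True j = K True \<and> w True (j - 1) \<le> K True - 1})"
    by (rule sum.cong[OF refl], rule total_by_first_row[OF _ _ B]) auto
  also have "\<dots> = ?rhs"
  proof (intro sum.cong refl)
    fix i j assume ij: "i \<in> {first_row False (K False)..b False}" "j \<in> {first_row True (K True)..b True}"
    have "w False (b False) = K False" if "w \<in> turned_profiles" "w False i = K False" for w
      using profile_stays_K(2)[OF that, of "b False"] ij(1) b(2)[of False] by simp
    moreover have "w True (b True) = K True" if "w \<in> turned_profiles" "w True j = K True" for w
      using profile_stays_K(2)[OF that, of "b True"] ij(2) b(2)[of True] by simp
    ultimately show "{w \<in> {w \<in> ?A. w False i = K False \<and> w False (i - 1) \<le> K False - 1}.
        w True j = K True \<and> w True (j - 1) \<le> K True - 1} =
      {w \<in> turned_profiles. \<forall>s. w s (if s then j else i) = K s \<and> w s ((if s then j else i) - 1) \<le> K s - 1}"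
      unfolding all_bool_eq by auto
  qed
  finally show ?thesis .
qed

lemma total_top_narrow:
  assumes m2: "\<And>s. 2 \<le> m s"
    and narrow: "k False (m False - 1) + k True (m True - 1) < K False + K True"
  shows "total top_profiles = (\<Sum>i = first_row False (K False)..m False. \<Sum>j = first_row True (K True)..m True.
      capped False (K False - 1) (i - 1) * capped True (K True - 1) (j - 1) * monom 1 1)" (is "_ = ?rhs")
proof -
  have kle: "k s (m s - 1) \<le> K s" for s using k_mono[of "m s - 1" "m s" s] m2[of s] by simp
  have "\<exists>s. k s (m s - 1) < K s"
  proof (rule ccontr)
    assume "\<not> ?thesis"
    then have "K False \<le> k False (m False - 1)" "K True \<le> k True (m True - 1)" by (simp_all add: not_less)
    then show False using narrow by simp
  qed
  then obtain s where s: "k s (m s - 1) < K s" by blast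
  have first: "first_row s (K s) = m s"
  proof (rule ccontr)
    assume "first_row s (K s) \<noteq> m s"
    then have "first_row s (K s) \<le> m s - 1" using first_row(2)[OF top_row, of s] by simp
    then show False using first_row(3)[OF top_row, of s "m s - 1"] s by simp
  qed
  have "total top_profiles = (\<Sum>i = first_row False (K False)..m False. \<Sum>j = first_row True (K True)..m True.
      total {w \<in> turned_profiles. \<forall>s. w s (if s then j else i) = K s \<and> w s ((if s then j else i) - 1) \<le> K s - 1})"
    unfolding top_profiles_def by (rule total_top_by_corners) (use m_pos in auto)
  also have "\<dots> = ?rhs"
  proof (intro sum.cong refl)
    fix i j assume ij: "i \<in> {first_row False (K False)..m False}" "j \<in> {first_row True (K True)..m True}"
    let ?i = "\<lambda>t. if t then j else i"
    have R: "first_row t (K t) \<le> ?i t" "?i t \<le> m t" for t using ij by (cases t; simp)+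
    have "total {w \<in> turned_profiles. \<forall>s. w s (?i s) = K s \<and> w s (?i s - 1) \<le> K s - 1} =
      capped False (K False - 1) (?i False - 1) * capped True (K True - 1) (?i True - 1) * monom 1 1"
    proof (rule sum_corner_class_narrow)
      show "1 \<le> ?i t" for t using R(1)[of t] first_row(1)[OF top_row, of t] by simp
      show "?i t \<le> m t" for t by (rule R(2))
      show "K t \<le> k t (?i t)" for t using first_row(3)[OF top_row R] .
      show "?i s = m s" using R[of s] first by simp
      show "k s (m s - 1) < K s" "2 \<le> m s" using s m2 by auto
    qed
    then show "total {w \<in> turned_profiles. \<forall>s. w s (?i s) = K s \<and> w s (?i s - 1) \<le> K s - 1} =
      capped False (K False - 1) (i - 1) * capped True (K True - 1) (j - 1) * monom 1 1" by simp
  qed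
  finally show ?thesis .
qed

definition staircase_profiles :: "nat \<Rightarrow> (bool \<Rightarrow> nat \<Rightarrow> int) set" where
  "staircase_profiles b = {w \<in> turned_profiles.
     (\<forall>r\<in>{b..m False}. w False r = slope False r) \<and> w True (m True - 1) \<le> K True - 1}"

text \<open>Contributions of the matchings that leave the staircase after \<open>w\<close> steps. For \<open>w = 0\<close> only drops
  occur, because a repeated value \<open>K\<close> is a column at the shared row.\<close>

definition stay_sum :: "nat \<Rightarrow> int poly" where
  "stay_sum w = (\<Sum>i = first_row False (K False - int w)..m False - w - 1. \<Sum>j = h True (m True - 1) - 1..K True - 1.
     capped False (K False - int w - 1) (i - 1) * capped True j (m True - 2) * monom 1 (w + 2))"

definition drop_sum :: "nat \<Rightarrow> int poly" where
  "drop_sum w = (\<Sum>i = h False (m False - w - 1) - 1..K False - int w - 2.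
     capped False i (m False - w - 2) * capped True (K True - 1) (m True - 1) * monom 1 (w + 2))"

lemma slope_diff: "w \<le> m False \<Longrightarrow> slope False (m False - w) = K False - int w"
  by (simp add: slope_def of_nat_diff)

context
  assumes m2: "\<And>s. 2 \<le> m s" and wide: "\<And>s. k s (m s - 1) = K s"
begin

lemma penult_row: "1 \<le> m s - 1" "m s - 1 \<le> m s" "h s (m s - 1) \<le> K s" "K s \<le> k s (m s - 1)"
  using m2[of s] h_le_K[of "m s - 1" s] wide[of s] by auto

lemma total_column:
  "total {w \<in> turned_profiles. w s (m s - 1) = K s} =
    (\<Sum>i = first_row s (K s)..m s - 1. capped s (K s - 1) (i - 1) * capped (\<not> s) (K (\<not> s)) (m (\<not> s) - 1) * monom 1 1)" (is "_ = ?rhs")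
proof -
  let ?A = "{w \<in> turned_profiles. w s (m s - 1) = K s}"
  have "total ?A = (\<Sum>i = first_row s (K s)..m s - 1. total {w \<in> ?A. w s i = K s \<and> w s (i - 1) \<le> K s - 1})"
    by (rule total_by_first_row[OF _ _ penult_row]) auto
  also have "\<dots> = ?rhs"
  proof (rule sum.cong[OF refl])
    fix i assume i: "i \<in> {first_row s (K s)..m s - 1}"
    have I: "1 \<le> i" "i < m s" "K s \<le> k s i"
      using i first_row(1)[OF penult_row, of s] first_row(3)[OF penult_row, of s i] m2[of s] by auto
    have "{w \<in> ?A. w s i = K s \<and> w s (i - 1) \<le> K s - 1} = {w \<in> turned_profiles. w s i = K s \<and> w s (i - 1) \<le> K s - 1}"
      using profile_stays_K(2)[of _ s i "m s - 1"] i I(2) by auto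
    then show "total {w \<in> ?A. w s i = K s \<and> w s (i - 1) \<le> K s - 1} =
       capped s (K s - 1) (i - 1) * capped (\<not> s) (K (\<not> s)) (m (\<not> s) - 1) * monom 1 1"
      using sum_one_column_class[OF I] by simp
  qed
  finally show ?thesis .
qed

lemma total_two_columns:
  "total {w \<in> turned_profiles. \<forall>s. w s (m s - 1) = K s} =
    (\<Sum>i = first_row False (K False)..m False - 1. \<Sum>j = first_row True (K True)..m True - 1.
      capped False (K False - 1) (i - 1) * capped True (K True - 1) (j - 1) * monom 1 2)" (is "_ = ?rhs")
proof -
  have "total {w \<in> turned_profiles. \<forall>s. w s (m s - 1) = K s} =
    (\<Sum>i = first_row False (K False)..m False - 1. \<Sum>j = first_row True (K True)..m True - 1.
      total {w \<in> turned_profiles. \<forall>s. w s (if s then j else i) = K s \<and> w s ((if s then j else i) - 1) \<le> K s - 1})"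
    by (rule total_top_by_corners) (use penult_row wide in auto)
  also have "\<dots> = ?rhs"
  proof (intro sum.cong refl)
    fix i j assume ij: "i \<in> {first_row False (K False)..m False - 1}" "j \<in> {first_row True (K True)..m True - 1}"
    let ?i = "\<lambda>t. if t then j else i"
    have R: "first_row t (K t) \<le> ?i t" "?i t \<le> m t - 1" for t using ij by (cases t; simp)+
    have "total {w \<in> turned_profiles. \<forall>s. w s (?i s) = K s \<and> w s (?i s - 1) \<le> K s - 1} =
      capped False (K False - 1) (?i False - 1) * capped True (K True - 1) (?i True - 1) * monom 1 2"
    proof (rule sum_two_column_class)
      show "1 \<le> ?i t" for t using R(1)[of t] first_row(1)[OF penult_row, of t] by simp
      show "?i t < m t" for t using R(2)[of t] m2[of t] by linarith
      show "K t \<le> k t (?i t)" for t using first_row(3)[OF penult_row R] .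
    qed
    then show "total {w \<in> turned_profiles. \<forall>s. w s (?i s) = K s \<and> w s (?i s - 1) \<le> K s - 1} =
      capped False (K False - 1) (i - 1) * capped True (K True - 1) (j - 1) * monom 1 2" by simp
  qed
  finally show ?thesis .
qed

text \<open>Inclusion and exclusion over the halves that have a column of height at least two.\<close>

lemma total_top_split:
  "total top_profiles = total {w \<in> turned_profiles. w False (m False - 1) = K False}
     + total {w \<in> turned_profiles. w True (m True - 1) = K True}
     - total {w \<in> turned_profiles. \<forall>s. w s (m s - 1) = K s}
     + total {w \<in> staircase_profiles (m False). w False (m False - 1) \<le> K False - 1}"
proof -
  let ?A = "\<lambda>s. {w \<in> turned_profiles. w s (m s - 1) = K s}"
  let ?D = "{w \<in> staircase_profiles (m False). w False (m False - 1) \<le> K False - 1}"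
  have fin: "finite (?A s)" "finite ?D" for s
    using finite_turned_profiles by (auto simp: staircase_profiles_def)
  have "w \<in> top_profiles \<longleftrightarrow> w \<in> (?A False \<union> ?A True) \<union> ?D" for w
  proof (cases "w \<in> turned_profiles")
    case w: True
    have 1: "w s (m s - 1) \<le> K s" for s using profile_le_K[OF w] by simp
    have 2: "w \<in> top_profiles" if "w s (m s - 1) = K s" for s
      using profile_stays_K(1)[OF w that] by simp
    show ?thesis
    proof (cases "\<exists>s. w s (m s - 1) = K s")
      case True
      then have "w \<in> ?A False \<union> ?A True" unfolding ex_bool_eq using w by auto
      then show ?thesis using 2 True by blast
    next
      case False
      then have 3: "w False (m False - 1) \<le> K False - 1" "w True (m True - 1) \<le> K True - 1"
      proof -
        have "w False (m False - 1) \<noteq> K False" "w True (m True - 1) \<noteq> K True" using False by blast+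
        then show "w False (m False - 1) \<le> K False - 1" "w True (m True - 1) \<le> K True - 1"
          using 1[of False] 1[of True] by linarith+
      qed
      then show ?thesis using w top_iff[OF w, of False] by (auto simp: staircase_profiles_def)
    qed
  qed (auto simp: top_profiles_def staircase_profiles_def)
  then have "top_profiles = (?A False \<union> ?A True) \<union> ?D" by blast
  moreover have "(?A False \<union> ?A True) \<inter> ?D = {}" by (auto simp: staircase_profiles_def)
  ultimately have "total top_profiles = total (?A False \<union> ?A True) + total ?D"
    using fin by (simp add: sum.union_disjoint)
  also have "total (?A False \<union> ?A True) = total (?A False) + total (?A True) - total (?A False \<inter> ?A True)"
    using sum.union_inter[OF fin(1)[of False] fin(1)[of True], of weight]
    by (simp only: eq_diff_eq)
  also have "?A False \<inter> ?A True = {w \<in> turned_profiles. \<forall>s. w s (m s - 1) = K s}"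
    unfolding all_bool_eq by auto
  finally show ?thesis .
qed

lemma finite_staircase: "finite (staircase_profiles b)"
  using finite_turned_profiles by (simp add: staircase_profiles_def)

lemma staircase_pred:
  assumes "2 \<le> b" "b \<le> m False"
  shows "{w \<in> staircase_profiles b. w False (b - 1) = slope False b - 1} = staircase_profiles (b - 1)"
proof -
  have "{b - 1..m False} = insert (b - 1) {b..m False}" using assms by auto
  then show ?thesis using slope_pred[of b False] assms by (auto simp: staircase_profiles_def)
qed

lemma total_drop:
  assumes b: "2 \<le> b" "b \<le> m False"
    and cell: "\<And>r. b \<le> r \<Longrightarrow> r \<le> m False \<Longrightarrow> h False r \<le> slope False r \<and> slope False r \<le> k False r"
    and prev: "slope False b \<le> k False (b - 1)"
  shows "total {w \<in> staircase_profiles b. w False (b - 1) \<le> slope False b - 2} =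
    (\<Sum>c = h False (b - 1) - 1..slope False b - 2.
       capped False c (b - 2) * capped True (K True - 1) (m True - 1) * monom 1 (m False - b + 2))" (is "_ = ?rhs")
proof -
  let ?A = "{w \<in> staircase_profiles b. w False (b - 1) \<le> slope False b - 2}"
  have "total ?A = (\<Sum>c = h False (b - 1) - 1..slope False b - 2. total {w \<in> ?A. w False (b - 1) = c})"
  proof (rule sum.group[symmetric])
    show "finite ?A" using finite_staircase by simp
    have "h False (b - 1) - 1 \<le> w False (b - 1)" if "w \<in> turned_profiles" for w
      using profiles_bounds(3)[OF that, of "b - 1" False] b by simp
    then show "(\<lambda>w. w False (b - 1)) ` ?A \<subseteq> {h False (b - 1) - 1..slope False b - 2}"
      by (auto simp: staircase_profiles_def)
  qed simp
  also have "\<dots> = ?rhs"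
  proof (rule sum.cong[OF refl])
    fix c assume c: "c \<in> {h False (b - 1) - 1..slope False b - 2}"
    define u where "u r = (if r = b - 1 then c else slope False r)" for r
    have rows: "{b - 1..m False} = insert (b - 1) {b..m False}" using b by auto
    have set: "{w \<in> ?A. w False (b - 1) = c} =
      {w \<in> turned_profiles. (\<forall>r\<in>{b - 1..m False}. w False r = u r) \<and> w True (m True - 1) \<le> K True - 1}"
    proof -
      have "(\<forall>r\<in>{b..m False}. w False r = u r) = (\<forall>r\<in>{b..m False}. w False r = slope False r)" for w :: "bool \<Rightarrow> nat \<Rightarrow> int"
        using b by (intro ball_cong refl) (auto simp: u_def)
      moreover have "u (b - 1) = c" "c \<le> slope False b - 2" using c by (auto simp: u_def)
      ultimately show ?thesis unfolding rows staircase_profiles_def by auto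
    qed
    have "1 \<le> h False (b - 1)" using h_pos[of "b - 1" False] b by simp
    then have X: "total {w \<in> turned_profiles. (\<forall>r\<in>{b - 1..m False}. w False r = u r) \<and> w (\<not> False) (m (\<not> False) - 1) \<le> K (\<not> False) - 1} =
      capped False c (b - 1 - 1) * capped (\<not> False) (K (\<not> False) - 1) (m (\<not> False) - 1) * monom 1 (m False - (b - 1) + 1)"
    proof (intro sum_staircase_class[where \<delta> = 1])
      show "w False (b - 1 - 1) \<le> c" if "w \<in> turned_profiles" "w False (b - 1) = u (b - 1)" for w
        using monoD[OF profile_mono[OF that(1)], of "b - 1 - 1" "b - 1" False] that(2) by (simp add: u_def)
      show "h False (b - 1 - 1) - 1 \<le> c" if "1 < b - 1"
      proof -
        have "b - 1 \<le> m False" using b by simp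
        then show ?thesis using h_pred_le[of "b - 1" False] that c by simp
      qed
    qed (use b c cell prev slope_pred[of b False] in \<open>auto simp: u_def\<close>)
    have e: "m False - (b - 1) + 1 = m False - b + 2" "b - 1 - 1 = b - 2" using b by auto
    show "total {w \<in> ?A. w False (b - 1) = c} =
      capped False c (b - 2) * capped True (K True - 1) (m True - 1) * monom 1 (m False - b + 2)"
      using X unfolding set e not_False_eq_True .
  qed
  finally show ?thesis .
qed

lemma staircase_other_range:
  assumes "w \<in> turned_profiles" "w True (m True - 1) \<le> K True - 1"
  shows "w True (m True - 1) \<in> {h True (m True - 1) - 1..K True - 1}"
  using profiles_bounds(3)[OF assms(1), of "m True - 1" True] assms(2) m2[of True] by simp

lemma total_by_other_side:
  assumes "A \<subseteq> turned_profiles" "\<And>w. w \<in> A \<Longrightarrow> w True (m True - 1) \<le> K True - 1"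
  shows "total A = (\<Sum>j = h True (m True - 1) - 1..K True - 1. total {w \<in> A. w True (m True - 1) = j})"
proof (rule sum.group[symmetric])
  show "finite A" using finite_subset[OF assms(1) finite_turned_profiles] .
  show "(\<lambda>w. w True (m True - 1)) ` A \<subseteq> {h True (m True - 1) - 1..K True - 1}"
    using staircase_other_range assms by blast
qed simp

lemma total_stay:
  assumes b: "2 \<le> b" "b < m False"
    and cell: "\<And>r. b \<le> r \<Longrightarrow> r < m False \<Longrightarrow> h False r - 1 \<le> slope False r \<and> slope False r + 1 \<le> k False r"
    and hb: "h False b \<le> slope False b" and prev: "slope False b \<le> k False (b - 1)"
  shows "total {w \<in> staircase_profiles b. w False (b - 1) = slope False b} =
    (\<Sum>i = first_row False (slope False b)..b - 1. \<Sum>j = h True (m True - 1) - 1..K True - 1.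
       capped False (slope False b - 1) (i - 1) * capped True j (m True - 2) * monom 1 (m False - b + 2))"
proof -
  let ?z = "slope False b"
  let ?A = "{w \<in> staircase_profiles b. w False (b - 1) = ?z}"
  have A: "?A \<subseteq> turned_profiles" by (auto simp: staircase_profiles_def)
  have B: "1 \<le> b - 1" "b - 1 \<le> m False" "h False (b - 1) \<le> ?z" "?z \<le> k False (b - 1)"
    using b hb prev h_pred_le[of b False] by auto
  have "total ?A = (\<Sum>i = first_row False ?z..b - 1. total {w \<in> ?A. w False i = ?z \<and> w False (i - 1) \<le> ?z - 1})"
    by (rule total_by_first_row[OF A _ B]) auto
  also have "\<dots> = (\<Sum>i = first_row False ?z..b - 1. \<Sum>j = h True (m True - 1) - 1..K True - 1.
      total {w \<in> {w \<in> ?A. w False i = ?z \<and> w False (i - 1) \<le> ?z - 1}. w True (m True - 1) = j})"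
    by (rule sum.cong[OF refl], rule total_by_other_side) (use A in \<open>auto simp: staircase_profiles_def\<close>)
  also have "\<dots> = (\<Sum>i = first_row False ?z..b - 1. \<Sum>j = h True (m True - 1) - 1..K True - 1.
       capped False (?z - 1) (i - 1) * capped True j (m True - 2) * monom 1 (m False - b + 2))"
  proof (intro sum.cong refl)
    fix i j assume i: "i \<in> {first_row False ?z..b - 1}" and j: "j \<in> {h True (m True - 1) - 1..K True - 1}"
    have I: "1 \<le> i" "i \<le> b" "i < b" "?z \<le> k False i"
      using i b first_row(1)[OF B] first_row(3)[OF B, of i] by auto
    define u where "u r = (if r \<le> b then ?z else slope False r)" for r
    have set: "{w \<in> {w \<in> ?A. w False i = ?z \<and> w False (i - 1) \<le> ?z - 1}. w True (m True - 1) = j} =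
      {w \<in> turned_profiles. (\<forall>r\<in>{i..m False}. w False r = u r) \<and> w False (i - 1) \<le> ?z - 1 \<and> w True (m True - 1) = j}"
      (is "?L = ?R")
    proof (intro equalityI subsetI)
      fix w assume w: "w \<in> ?L"
      then have wt: "w \<in> turned_profiles" and e: "\<And>r. b \<le> r \<Longrightarrow> r \<le> m False \<Longrightarrow> w False r = slope False r" "w False i = ?z"
        by (auto simp: staircase_profiles_def)
      have "w False r = u r" if "i \<le> r" "r \<le> m False" for r
      proof (cases "r \<le> b")
        case True
        then have "w False i \<le> w False r" "w False r \<le> w False b"
          using monoD[OF profile_mono[OF wt]] that by auto
        then show ?thesis using e b True by (simp add: u_def)
      next
        case False then show ?thesis using e(1)[of r] that by (simp add: u_def)
      qed
      then show "w \<in> ?R" using w wt by auto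
    next
      fix w assume w: "w \<in> ?R"
      then have e: "\<And>r. i \<le> r \<Longrightarrow> r \<le> m False \<Longrightarrow> w False r = u r" by auto
      have "w False r = slope False r" if "r \<in> {b..m False}" for r
        using e[of r] that I by (cases "r = b") (auto simp: u_def)
      moreover have "w False (b - 1) = ?z" "w False i = ?z" using e[of "b - 1"] e[of i] I b by (auto simp: u_def)
      ultimately show "w \<in> ?L" using w j by (auto simp: staircase_profiles_def)
    qed
    have "0 \<le> ?z - 1" using h_pos[of b False] hb b by simp
    then have "total {w \<in> turned_profiles. (\<forall>r\<in>{i..m False}. w False r = u r) \<and> w False (i - 1) \<le> ?z - 1 \<and> w (\<not> False) (m (\<not> False) - 1) = j} =
      capped False (?z - 1) (i - 1) * capped (\<not> False) j (m (\<not> False) - 2) * monom 1 (m False - b + 1 + (if i < b then 1 else 0))"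
    proof (intro sum_staircase_column_class)
      show "h False (i - 1) - 1 \<le> ?z - 1" if "1 < i"
      proof -
        have "1 \<le> i - 1" "i - 1 \<le> b" using that I by linarith+
        then show ?thesis using h_mono[of "i - 1" b False] hb b by simp
      qed
    qed (use I b cell hb j m2[of True] wide[of True] in \<open>auto simp: u_def\<close>)
    then show "total {w \<in> {w \<in> ?A. w False i = ?z \<and> w False (i - 1) \<le> ?z - 1}. w True (m True - 1) = j} =
       capped False (?z - 1) (i - 1) * capped True j (m True - 2) * monom 1 (m False - b + 2)"
      unfolding set using I(3) by simp
  qed
  finally show ?thesis .
qed

text \<open>The zigzag chain ends with an even number of hexagons: the lower bound \<open>h b\<close> makes row \<open>b\<close> the end of the staircase.\<close>

lemma total_staircase_forced:
  assumes b: "1 \<le> b" "b < m False"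
    and cell: "\<And>r. b \<le> r \<Longrightarrow> r < m False \<Longrightarrow> h False r - 1 \<le> slope False r \<and> slope False r + 1 \<le> k False r"
    and hb: "h False b = slope False b + 1"
  shows "total (staircase_profiles b) =
    (\<Sum>j = h True (m True - 1) - 1..K True - 1.
       capped False (slope False b) (b - 1) * capped True j (m True - 2) * monom 1 (m False - b + 1))" (is "_ = ?rhs")
proof -
  have "total (staircase_profiles b) = (\<Sum>j = h True (m True - 1) - 1..K True - 1.
      total {w \<in> staircase_profiles b. w True (m True - 1) = j})"
    by (rule total_by_other_side) (auto simp: staircase_profiles_def)
  also have "\<dots> = ?rhs"
  proof (rule sum.cong[OF refl])
    fix j assume j: "j \<in> {h True (m True - 1) - 1..K True - 1}"
    have "w False (b - 1) \<le> slope False b" if "w \<in> turned_profiles" "\<forall>r\<in>{b..m False}. w False r = slope False r" for w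
      using monoD[OF profile_mono[OF that(1)], of "b - 1" b False] that(2) b by auto
    then have set: "{w \<in> staircase_profiles b. w True (m True - 1) = j} =
      {w \<in> turned_profiles. (\<forall>r\<in>{b..m False}. w False r = slope False r) \<and> w False (b - 1) \<le> slope False b \<and> w True (m True - 1) = j}"
      using j by (auto simp: staircase_profiles_def)
    have "0 \<le> slope False b" using h_pos[of b False] hb b by simp
    then have "total {w \<in> turned_profiles. (\<forall>r\<in>{b..m False}. w False r = slope False r) \<and> w False (b - 1) \<le> slope False b \<and> w (\<not> False) (m (\<not> False) - 1) = j} =
      capped False (slope False b) (b - 1) * capped (\<not> False) j (m (\<not> False) - 2) * monom 1 (m False - b + 1 + (if b < b then 1 else 0))"
    proof (intro sum_staircase_column_class)
      show "h False (b - 1) - 1 \<le> slope False b" if "1 < b"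
        using h_pred_le[of b False] hb that b by simp
      show "slope False b \<le> k False b" using cell[of b] b by simp
    qed (use b cell hb j m2[of True] wide[of True] in auto)
    then show "total {w \<in> staircase_profiles b. w True (m True - 1) = j} =
       capped False (slope False b) (b - 1) * capped True j (m True - 2) * monom 1 (m False - b + 1)"
      unfolding set by simp
  qed
  finally show ?thesis .
qed

text \<open>The zigzag chain ends with an odd number of hexagons: the rows above \<open>b\<close> have no hexagon with
  the index \<open>slope b\<close>, so they stay below the staircase.\<close>

lemma total_staircase_blocked:
  assumes b: "1 \<le> b" "b < m False"
    and cell: "\<And>r. b \<le> r \<Longrightarrow> r \<le> m False \<Longrightarrow> h False r \<le> slope False r \<and> slope False r \<le> k False r"
    and prev: "1 < b \<Longrightarrow> k False (b - 1) < slope False b"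
  shows "total (staircase_profiles b) =
    capped False (slope False b - 1) (b - 1) * capped True (K True - 1) (m True - 1) * monom 1 (m False - b + 1)"
proof -
  have cb: "h False b \<le> slope False b" "slope False b \<le> k False b" using cell[of b] b by auto
  have "1 \<le> slope False b" using h_pos[of b False] cb b by simp
  then have "total {w \<in> turned_profiles. (\<forall>r\<in>{b..m False}. w False r = slope False r) \<and> w (\<not> False) (m (\<not> False) - 1) \<le> K (\<not> False) - 1} =
    capped False (slope False b - 1) (b - 1) * capped (\<not> False) (K (\<not> False) - 1) (m (\<not> False) - 1) * monom 1 (m False - b + 1)"
  proof (intro sum_staircase_class[where \<delta> = "- 1"])
    show "w False (b - 1) \<le> slope False b - 1" if w: "w \<in> turned_profiles" for w
    proof (cases "b = 1")
      case True then show ?thesis using profiles_bounds(1)[OF w, of False] \<open>1 \<le> slope False b\<close> by simp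
    next
      case False
      then have "1 \<le> b - 1" "b - 1 \<le> m False" "1 < b" using b by linarith+
      then show ?thesis using profiles_bounds(4)[OF w, of "b - 1" False] prev by simp
    qed
    show "h False (b - 1) - 1 \<le> slope False b - 1" if "1 < b"
      using h_pred_le[of b False] cell[of b] that b by simp
    show "h False b - 1 \<le> slope False b" using cb by simp
  qed (use b cell cb in auto)
  then show ?thesis by (simp add: staircase_profiles_def)
qed

lemma total_staircase_step:
  assumes b: "2 \<le> b" "b < m False"
    and cell: "\<And>r. b \<le> r \<Longrightarrow> r < m False \<Longrightarrow> slope False r + 1 \<le> k False r"
      "\<And>r. b \<le> r \<Longrightarrow> r \<le> m False \<Longrightarrow> h False r \<le> slope False r"
    and prev: "slope False b \<le> k False (b - 1)"
  shows "total (staircase_profiles b) =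
    (\<Sum>i = first_row False (slope False b)..b - 1. \<Sum>j = h True (m True - 1) - 1..K True - 1.
       capped False (slope False b - 1) (i - 1) * capped True j (m True - 2) * monom 1 (m False - b + 2))
    + (\<Sum>c = h False (b - 1) - 1..slope False b - 2.
       capped False c (b - 2) * capped True (K True - 1) (m True - 1) * monom 1 (m False - b + 2))
    + total (staircase_profiles (b - 1))"
proof -
  let ?Y = "staircase_profiles b" and ?z = "slope False b"
  let ?A = "{w \<in> ?Y. w False (b - 1) = ?z}" and ?B = "{w \<in> ?Y. w False (b - 1) \<le> ?z - 2}"
    and ?C = "{w \<in> ?Y. w False (b - 1) = ?z - 1}"
  have "w False (b - 1) \<le> ?z" if "w \<in> ?Y" for w
    using that monoD[OF profile_mono[of w False], of "b - 1" b] b by (auto simp: staircase_profiles_def)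
  then have "?Y = (?A \<union> ?B) \<union> ?C" by force
  moreover have "finite ?A" "finite ?B" "finite ?C" using finite_staircase by auto
  moreover have "(?A \<union> ?B) \<inter> ?C = {}" "?A \<inter> ?B = {}" by auto
  ultimately have "total ?Y = total ?A + total ?B + total ?C"
    by (metis (no_types, lifting) finite_UnI sum.union_disjoint)
  moreover have kc: "slope False r \<le> k False r" if "b \<le> r" "r \<le> m False" for r
    using cell(1)[of r] that by (cases "r = m False") auto
  moreover have "total ?A = (\<Sum>i = first_row False ?z..b - 1. \<Sum>j = h True (m True - 1) - 1..K True - 1.
       capped False (?z - 1) (i - 1) * capped True j (m True - 2) * monom 1 (m False - b + 2))"
  proof (rule total_stay[OF b])
    show "h False r - 1 \<le> slope False r \<and> slope False r + 1 \<le> k False r" if "b \<le> r" "r < m False" for r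
      using cell(1)[OF that] cell(2)[of r] that by simp
    show "h False b \<le> ?z" using cell(2)[of b] b by simp
  qed (rule prev)
  moreover have "total ?B = (\<Sum>c = h False (b - 1) - 1..?z - 2.
       capped False c (b - 2) * capped True (K True - 1) (m True - 1) * monom 1 (m False - b + 2))"
    by (rule total_drop[OF b(1)]) (use b cell(2) kc prev in auto)
  moreover have "?C = staircase_profiles (b - 1)" using staircase_pred[OF b(1)] b by simp
  ultimately show ?thesis by simp
qed

context
  fixes n :: nat
  assumes zigzag: "\<And>r. 1 \<le> r \<Longrightarrow> r \<le> n \<Longrightarrow>
    cell_exists (m False) (k False) (h False) (m False - r div 2) (K False - int ((r - 1) div 2))"
begin

text \<open>The hexagons of the zigzag chain with even number \<open>2 * t\<close> allow step \<open>t\<close> of the staircase to be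
  raised, and those with odd number \<open>2 * t + 1\<close> allow it to be lowered.\<close>

lemma zigzag_even:
  assumes "1 \<le> t" "2 * t \<le> n"
  shows "1 \<le> m False - t" "t < m False" "h False (m False - t) - 1 \<le> slope False (m False - t)"
    "slope False (m False - t) + 1 \<le> k False (m False - t)"
proof -
  have "(2 * t - 1) div 2 = t - 1" using assms(1) by simp
  then have c: "cell_exists (m False) (k False) (h False) (m False - t) (K False - int (t - 1))"
    using zigzag[of "2 * t"] assms by simp
  then show "1 \<le> m False - t" "t < m False" by (auto simp: cell_exists_def)
  then have "K False - int (t - 1) = slope False (m False - t) + 1"
    using assms(1) by (simp add: slope_def of_nat_diff)
  then show "h False (m False - t) - 1 \<le> slope False (m False - t)"
    "slope False (m False - t) + 1 \<le> k False (m False - t)" using c by (auto simp: cell_exists_def)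
qed

lemma zigzag_odd:
  assumes "2 * t + 1 \<le> n"
  shows "1 \<le> m False - t" "h False (m False - t) \<le> slope False (m False - t)"
    "slope False (m False - t) \<le> k False (m False - t)"
proof -
  have c: "cell_exists (m False) (k False) (h False) (m False - t) (K False - int t)"
    using zigzag[of "2 * t + 1"] assms by simp
  then show 1: "1 \<le> m False - t" by (auto simp: cell_exists_def)
  then have "K False - int t = slope False (m False - t)" by (simp add: slope_def of_nat_diff)
  then show "h False (m False - t) \<le> slope False (m False - t)"
    "slope False (m False - t) \<le> k False (m False - t)" using c by (auto simp: cell_exists_def)
qed

lemma zigzag_row_even:
  assumes "m False - t \<le> r" "r < m False" "2 * t \<le> n"
  shows "h False r - 1 \<le> slope False r" "slope False r + 1 \<le> k False r"
proof -
  have "1 \<le> m False - r" "2 * (m False - r) \<le> n" "m False - (m False - r) = r" using assms by auto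
  then show "h False r - 1 \<le> slope False r" "slope False r + 1 \<le> k False r"
    using zigzag_even(3,4)[of "m False - r"] by simp_all
qed

lemma zigzag_row_odd:
  assumes "m False - t \<le> r" "r \<le> m False" "2 * t + 1 \<le> n"
  shows "h False r \<le> slope False r" "slope False r \<le> k False r"
proof -
  have "2 * (m False - r) + 1 \<le> n" "m False - (m False - r) = r" using assms by auto
  then show "h False r \<le> slope False r" "slope False r \<le> k False r"
    using zigzag_odd(2,3)[of "m False - r"] by simp_all
qed

lemma total_staircase_chain:
  "1 \<le> M \<Longrightarrow> 2 * M \<le> n \<Longrightarrow> total (staircase_profiles (m False - 1)) =
    (\<Sum>w = 1..M - 1. stay_sum w) + (\<Sum>w = 1..M - 1. drop_sum w) + total (staircase_profiles (m False - M))"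
proof (induction M rule: nat_induct_at_least)
  case base
  then show ?case by simp
next
  case (Suc M)
  let ?b = "m False - M"
  have M: "1 \<le> m False - Suc M" "M < m False" using zigzag_even(1)[of "Suc M"] Suc.prems by simp_all
  have b: "2 \<le> ?b" "?b < m False" using M Suc.hyps by linarith+
  have pos: "m False - ?b + 2 = M + 2" "m False - Suc M = ?b - 1" using M by simp_all
  have sl: "slope False ?b = K False - int M" using slope_diff M by simp
  have prev: "slope False ?b \<le> k False (?b - 1)"
  proof -
    have "slope False (m False - Suc M) + 1 \<le> k False (m False - Suc M)"
      by (rule zigzag_even(4)[OF _ Suc.prems]) simp
    moreover have "slope False (?b - 1) = slope False ?b - 1" by (rule slope_pred) (use b in linarith)
    ultimately show ?thesis unfolding pos(2) by linarith
  qed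
  have nM: "2 * M \<le> n" "2 * M + 1 \<le> n" using Suc.prems by simp_all
  have "total (staircase_profiles ?b) =
    (\<Sum>i = first_row False (slope False ?b)..?b - 1. \<Sum>j = h True (m True - 1) - 1..K True - 1.
       capped False (slope False ?b - 1) (i - 1) * capped True j (m True - 2) * monom 1 (m False - ?b + 2))
    + (\<Sum>c = h False (?b - 1) - 1..slope False ?b - 2.
       capped False c (?b - 2) * capped True (K True - 1) (m True - 1) * monom 1 (m False - ?b + 2))
    + total (staircase_profiles (?b - 1))"
    by (rule total_staircase_step[OF b _ _ prev])
       (rule zigzag_row_even(2)[OF _ _ nM(1)] zigzag_row_odd(1)[OF _ _ nM(2)], assumption, assumption)+
  then have step: "total (staircase_profiles ?b) = stay_sum M + drop_sum M + total (staircase_profiles (?b - 1))"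
    unfolding stay_sum_def drop_sum_def sl pos(1) .
  have "{1..Suc M - 1} = insert M {1..M - 1}" "M \<notin> {1..M - 1}" using Suc.hyps by auto
  then have "sum f {1..Suc M - 1} = f M + sum f {1..M - 1}" for f :: "nat \<Rightarrow> int poly" by simp
  then show ?case using Suc.IH[OF nM(1)] step unfolding pos(2) by (simp only: ac_simps)
qed

lemma total_top_wide:
  assumes n: "2 \<le> n"
    and last: "\<not> cell_exists (m False) (k False) (h False) (m False - (n + 1) div 2) (K False - int (n div 2))"
  shows "total top_profiles =
     (\<Sum>i = first_row False (K False)..m False - 1. capped False (K False - 1) (i - 1) * capped True (K True) (m True - 1) * monom 1 1)
   + (\<Sum>j = first_row True (K True)..m True - 1. capped False (K False) (m False - 1) * capped True (K True - 1) (j - 1) * monom 1 1)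
   - (\<Sum>i = first_row False (K False)..m False - 1. \<Sum>j = first_row True (K True)..m True - 1.
        capped False (K False - 1) (i - 1) * capped True (K True - 1) (j - 1) * monom 1 2)
   + drop_sum 0 + (\<Sum>w = 1..n div 2 - 1. stay_sum w) + (\<Sum>w = 1..n div 2 - 1. drop_sum w)
   + (if even n then \<Sum>j = h True (m True - 1) - 1..K True - 1.
        capped False (K False - int (n div 2)) (m False - n div 2 - 1) * capped True j (m True - 2) * monom 1 (n div 2 + 1)
      else F (m False - (n + 1) div 2) (k False) (h False) * capped True (K True - 1) (m True - 1) * monom 1 ((n + 1) div 2))"
proof -
  let ?M = "m False" and ?N = "n div 2"
  have N: "1 \<le> ?N" "2 * ?N \<le> n" using n by auto
  let ?b = "?M - ?N"
  have b: "1 \<le> ?b" "?N < ?M" "?b < ?M" using zigzag_even(1,2)[OF N] N(1) by simp_all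
  have sl: "slope False ?b = K False - int ?N" using slope_diff[of ?N] b by simp
  have mb: "?M - ?b + 1 = ?N + 1" using b by simp
  have rest: "total (staircase_profiles ?b) =
     (if even n then \<Sum>j = h True (m True - 1) - 1..K True - 1.
        capped False (K False - int ?N) (?M - ?N - 1) * capped True j (m True - 2) * monom 1 (?N + 1)
      else F (?M - (n + 1) div 2) (k False) (h False) * capped True (K True - 1) (m True - 1) * monom 1 ((n + 1) div 2))"
  proof (cases "even n")
    case True
    then have "(n + 1) div 2 = ?N" by simp
    then have "\<not> (h False ?b \<le> slope False ?b \<and> slope False ?b \<le> k False ?b)"
      using last b sl by (simp add: cell_exists_def)
    then have "h False ?b = slope False ?b + 1"
      using zigzag_even(3,4)[OF N] by linarith
    from total_staircase_forced[OF b(1,3) _ this]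
    show ?thesis using True zigzag_row_even[of ?N] N(2) unfolding sl mb by simp
  next
    case False
    then have n1: "(n + 1) div 2 = ?N + 1" and N2: "2 * ?N + 1 \<le> n" by auto
    have prev: "k False (?b - 1) < slope False ?b" if "1 < ?b"
    proof -
      have "h False (?b - 1) \<le> slope False ?b"
        using h_pred_le[of ?b False] zigzag_odd(2)[OF N2] that by simp
      then show ?thesis using last that sl n1 by (auto simp: cell_exists_def)
    qed
    have "total (staircase_profiles ?b) =
      capped False (slope False ?b - 1) (?b - 1) * capped True (K True - 1) (m True - 1) * monom 1 (?M - ?b + 1)"
      by (rule total_staircase_blocked[OF b(1,3) _ prev]) (use zigzag_row_odd[of ?N] N2 in blast)
    moreover have "capped False (slope False ?b - 1) (?b - 1) = F (?b - 1) (k False) (h False)"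
      unfolding capped_def
    proof (rule F_cong)
      fix r assume r: "1 \<le> r" "r \<le> ?b - 1"
      then have "k False r \<le> k False (?b - 1)" using k_mono[of r "?b - 1" False] by simp
      moreover have "1 < ?b" using r by simp
      ultimately show "min (k False r) (slope False ?b - 1) = k False r" using prev by simp
    qed
    ultimately show ?thesis using False n1 unfolding mb by simp
  qed
  have stair: "total {w \<in> staircase_profiles ?M. w False (?M - 1) \<le> K False - 1} =
    drop_sum 0 + total (staircase_profiles (?M - 1))"
  proof -
    let ?A = "{w \<in> staircase_profiles ?M. w False (?M - 1) \<le> K False - 2}"
      and ?C = "{w \<in> staircase_profiles ?M. w False (?M - 1) = K False - 1}"
    have "{w \<in> staircase_profiles ?M. w False (?M - 1) \<le> K False - 1} = ?A \<union> ?C" by auto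
    moreover have "?A \<inter> ?C = {}" by auto
    moreover have "finite ?A" "finite ?C" using finite_staircase by auto
    ultimately have "total {w \<in> staircase_profiles ?M. w False (?M - 1) \<le> K False - 1} = total ?A + total ?C"
      by (simp add: sum.union_disjoint)
    moreover have "?C = staircase_profiles (?M - 1)" using staircase_pred[OF m2[of False]] by simp
    moreover have "total ?A = drop_sum 0"
    proof -
      have "h False r \<le> slope False r \<and> slope False r \<le> k False r" if "?M \<le> r" "r \<le> ?M" for r
      proof -
        have "r = m False" using that by simp
        then show ?thesis using l_le_K[of False] by simp
      qed
      from total_drop[OF m2[of False] _ this] show ?thesis
        using wide[of False] by (simp add: drop_sum_def numeral_2_eq_2)
    qed
    ultimately show ?thesis by simp
  qed
  show ?thesis
    unfolding total_top_split total_column total_two_columns stair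
      total_staircase_chain[OF N] rest
    by (simp add: algebra_simps)
qed

end
end
end

lemma monom_one_eq_power: "monom 1 n = [:0, 1::int:] ^ n"
  by (simp add: monom_altdef)

theorem theorem4p2:
  fixes m m' :: nat and k h k' h' :: "nat \<Rightarrow> int"
    and p :: "int \<Rightarrow> nat" and q :: nat and x :: "int poly"
  assumes "2 \<le> m" and "2 \<le> m'"
    and "monotonic_CHS m k h" and "monotonic_CHS m' k' h'"
    and "k m - h m = k' m' - h' m'"
    and p: "p = (\<lambda>z. LEAST r. cell_exists m k h r z)"
    and q: "q = (LEAST r. cell_exists m' k' h' r (k' m'))"
    and x: "x = [:0, 1:]"
  shows
    "(k (m - 1) + k' (m' - 1) < k m + k' m' \<longrightarrow>
      F_turn m k h m' k' h' =
        (\<Sum>i = h m - 1..k m - 1.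
           F (m - 1) (\<lambda>s. min (k s) i) h * F (m' - 1) (\<lambda>t. min (k' t) (i - h m + h' m')) h' * x)
      + (\<Sum>j = p (k m)..m. \<Sum>i = q..m'.
           F (j - 1) (\<lambda>s. min (k s) (k m - 1)) h * F (i - 1) (\<lambda>t. min (k' t) (k' m' - 1)) h' * x))
   \<and>
     (\<forall>n. k (m - 1) + k' (m' - 1) = k m + k' m' \<and> n = zigzag_length m k h \<and> 2 \<le> n \<longrightarrow>
      F_turn m k h m' k' h' =
        (\<Sum>i = h m - 1..k m - 1.
           F (m - 1) (\<lambda>s. min (k s) i) h * F (m' - 1) (\<lambda>t. min (k' t) (i - h m + h' m')) h' * x)
      + (\<Sum>j = p (k m)..m - 1.
           F (j - 1) (\<lambda>s. min (k s) (k m - 1)) h * F (m' - 1) k' h' * x)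
      + (\<Sum>j = q..m' - 1.
           F (m - 1) k h * F (j - 1) (\<lambda>t. min (k' t) (k' m' - 1)) h' * x)
      - (\<Sum>i = p (k m)..m - 1. \<Sum>j = q..m' - 1.
           F (i - 1) (\<lambda>s. min (k s) (k m - 1)) h * F (j - 1) (\<lambda>t. min (k' t) (k' m' - 1)) h' * x ^ 2)
      + (\<Sum>i = h (m - 1) - 1..k m - 2.
           F (m - 2) (\<lambda>s. min (k s) i) h * F (m' - 1) (\<lambda>t. min (k' t) (k' m' - 1)) h' * x ^ 2)
      + (\<Sum>w = 1..n div 2 - 1. \<Sum>i = p (k m - int w)..m - w - 1. \<Sum>j = h' (m' - 1) - 1..k' m' - 1.
           F (i - 1) (\<lambda>s. min (k s) (k m - int w - 1)) h * F (m' - 2) (\<lambda>t. min (k' t) j) h' * x ^ (w + 2))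
      + (\<Sum>w = 1..n div 2 - 1. \<Sum>i = h (m - w - 1) - 1..k m - int w - 2.
           F (m - w - 2) (\<lambda>s. min (k s) i) h * F (m' - 1) (\<lambda>t. min (k' t) (k' m' - 1)) h' * x ^ (w + 2))
      + (if even n then
           (\<Sum>j = h' (m' - 1) - 1..k' m' - 1.
              F (m - n div 2 - 1) (\<lambda>s. min (k s) (k m - int (n div 2))) h
              * F (m' - 2) (\<lambda>t. min (k' t) j) h' * x ^ (n div 2 + 1))
         else
           F (m - (n + 1) div 2) k h * F (m' - 1) (\<lambda>t. min (k' t) (k' m' - 1)) h'
           * x ^ ((n + 1) div 2)))"
proof -
  define mm where "mm s = (if s then m' else m)" for s
  define kk where "kk s = (if s then k' else k)" for s
  define hh where "hh s = (if s then h' else h)" for s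
  have sys: "turned_system mm kk hh"
    using assms(3-5) by unfold_locales (auto simp: mm_def kk_def hh_def)
  interpret turned_system mm kk hh by (rule sys)
  have sel [simp]: "mm False = m" "mm True = m'" "kk False = k" "kk True = k'" "hh False = h" "hh True = h'"
    by (simp_all add: mm_def kk_def hh_def)
  have m2: "2 \<le> mm s" for s using assms(1,2) by (cases s) simp_all
  have fr: "first_row False z = p z" "first_row True (k' m') = q" for z
    by (simp_all add: first_row_def p q)
  have cap: "capped False c j = F j (\<lambda>s. min (k s) c) h" "capped True c j = F j (\<lambda>t. min (k' t) c) h'" for c j
    by (simp_all add: capped_def)
  have x1: "monom 1 1 = x" "monom 1 (Suc 0) = x" and xp: "monom 1 j = x ^ j" for j
    by (simp_all add: x monom_one_eq_power)
  have turn: "F_turn m k h m' k' h' =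
     (\<Sum>i = h m - 1..k m - 1.
        F (m - 1) (\<lambda>s. min (k s) i) h * F (m' - 1) (\<lambda>t. min (k' t) (i - h m + h' m')) h' * x)
     + total top_profiles"
    using F_turn_eq_test_polynomial total_turned_profiles
    by (simp add: test_polynomial_def cap x1 across_def)
  show ?thesis
  proof (intro conjI impI allI, goal_cases)
    case 1
    then show ?case using turn total_top_narrow[OF m2] by (simp add: cap fr x1)
  next
    case (2 n)
    then have n: "k (m - 1) + k' (m' - 1) = k m + k' m'" "n = zigzag_length m k h" "2 \<le> n" by blast+
    have "kk s (mm s - 1) \<le> K s" for s using k_mono[of "mm s - 1" "mm s" s] m2[of s] by simp
    from this[of False] this[of True] have "k (m - 1) = k m" "k' (m' - 1) = k' m'" using n(1) by simp_all
    then have wide: "kk s (mm s - 1) = K s" for s by (cases s) simp_all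
    define Z where "Z y \<longleftrightarrow> (\<forall>r\<in>{1..y}. cell_exists m k h (m - r div 2) (k m - int ((r - 1) div 2)))" for y
    have nZ: "n = (GREATEST y. Z y)" using n(2) by (simp only: zigzag_length_def Z_def)
    have bound: "y \<le> 2 * m" if Zy: "Z y" for y
    proof (rule ccontr)
      assume "\<not> y \<le> 2 * m"
      then have "2 * m \<in> {1..y}" using assms(1) by simp
      \<comment> \<open>Hexagon \<open>2 * m\<close> of the chain would lie in row 0.\<close>
      then have "cell_exists m k h (m - (2 * m) div 2) (k m - int ((2 * m - 1) div 2))"
        using Zy unfolding Z_def by blast
      then show False by (simp add: cell_exists_def)
    qed
    have "Z 0" by (simp add: Z_def)
    then have Zn: "Z n" unfolding nZ by (rule GreatestI_nat) (rule bound)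
    have last: "\<not> cell_exists m k h (m - (n + 1) div 2) (k m - int (n div 2))"
    proof
      assume c: "cell_exists m k h (m - (n + 1) div 2) (k m - int (n div 2))"
      have "Z (Suc n)" unfolding Z_def
      proof
        fix r assume r: "r \<in> {1..Suc n}"
        show "cell_exists m k h (m - r div 2) (k m - int ((r - 1) div 2))"
        proof (cases "r = Suc n")
          case True then show ?thesis using c by simp
        next
          case False
          then have "r \<in> {1..n}" using r by auto
          then show ?thesis using Zn unfolding Z_def by blast
        qed
      qed
      then have "Suc n \<le> n" using Greatest_le_nat[of Z "Suc n" "2 * m"] bound nZ by simp
      then show False by simp
    qed
    have zz: "cell_exists (mm False) (kk False) (hh False) (mm False - r div 2) (K False - int ((r - 1) div 2))"
      if "1 \<le> r" "r \<le> n" for r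
      using Zn that unfolding Z_def by simp
    have last': "\<not> cell_exists (mm False) (kk False) (hh False) (mm False - (n + 1) div 2) (K False - int (n div 2))"
      using last by simp
    have drop0: "drop_sum 0 = (\<Sum>i = h (m - 1) - 1..k m - 2.
        F (m - 2) (\<lambda>s. min (k s) i) h * F (m' - 1) (\<lambda>t. min (k' t) (k' m' - 1)) h' * monom 1 2)"
      unfolding drop_sum_def sel cap by (simp add: numeral_2_eq_2)
    have uncapped: "F (m' - 1) (\<lambda>t. min (k' t) (k' m')) h' = F (m' - 1) k' h'"
      "F (m - 1) (\<lambda>s. min (k s) (k m)) h = F (m - 1) k h"
      by (rule F_cong; use k_mono[of _ m' True] k_mono[of _ m False] in simp)+
    note top = total_top_wide[OF m2 wide zz n(3) last', unfolded drop0,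
        unfolded stay_sum_def drop_sum_def x1(1), unfolded sel cap fr xp uncapped]
    show ?case
      by (simp only: turn[unfolded xp] top add.assoc add_diff_eq diff_add_eq)
  qed
qed

end
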